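(* Let $X$ be a (complex) Banach space. For $1\leq p\leq 2$ and $C\geq 1$, the following statements are equivalent: (a) $X$ has Fourier type $p$ with constant $C$; (b) for every $(a_n)_n\in\ell_p(X)$ the Dirichlet series $D=\sum a_nn^{-s}$ converges in $\mathcal{H}_{p'}(X)$ and \[ \|D\|_{\mathcal{H}_{p'}(X)}\leq C\Big(\sum_{n=1}^\infty\|a_n\|_X^p\Big)^{1/p}; \] (c) for every $(x_\alpha)_{\alpha\in\mathbb{N}_0^{(\mathbb{N})}}\in\ell_p(X)$ there is a function $f\in H_{p'}(\mathbb{T}^\infty,X)$ such that $\hat f(\alpha)=x_\alpha$ for every $\alpha$ and \[ \|f\|_{H_{p'}(\mathbb{T}^\infty,X)}\leq C\Big(\sum_{\alpha\in\mathbb{N}_0^{(\mathbb{N})}}\|\hat f(\alpha)\|_X^p\Big)^{1/p}. \]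
   Context: Here $p'$ is the conjugate exponent, $\frac1p+\frac1{p'}=1$ (with $1'=\infty$ and the usual modification of $L_\infty$ norms). $\ell_p(X)$ denotes the space of $p$-summing families in $X$, i.e. those whose norms are $p$-th power summable. $X$ has Fourier type $p$ with constant $C$ if for each choice of finitely many vectors $x_1,\dots,x_N\in X$ \[ \Big(\int_{\mathbb{T}}\Big\|\sum_{k=1}^N x_kz^k\Big\|^{p'}dz\Big)^{1/p'}\leq C\Big(\sum_{k=1}^N\|x_k\|^p\Big)^{1/p}, \] where $\mathbb{T}$ is the unit circle in $\mathbb{C}$ and $dz$ the normalized Lebesgue measure. $\mathbb{T}^\infty=\prod_{k=1}^\infty\mathbb{T}$ carries the product of the normalized Lebesgue measures, also denoted $dz$. $\mathbb{Z}^{(\mathbb{N})}$ is the set of finitely supported sequences of integers, and $\mathbb{N}_0^{(\mathbb{N})}$ the subset of those with all entries $\geq0$. For $f\in L_1(\mathbb{T}^\infty,X)$ (Bochner) and $\alpha\in\mathbb{Z}^{(\mathbb{N})}$, $\hat f(\alpha)=\int_{\mathbb{T}^\infty}f(z)z^{-\alpha}dz$. For $1\le r\le\infty$, \[ H_r(\mathbb{T}^\infty,X)=\{f\in L_r(\mathbb{T}^\infty,X):\hat f(\alpha)=0\ \ \forall \alpha\in\mathbb{Z}^{(\mathbb{N})}\setminus\mathbb{N}_0^{(\mathbb{N})}\} \] with the $L_r$ norm. The Bohr transform $\mathfrak{B}_X$ assigns to $f\in H_r(\mathbb{T}^\infty,X)$ the (formal) Dirichlet series $\sum a_nn^{-s}$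 with $a_n=\hat f(\alpha)$ whenever $n=\mathfrak p_1^{\alpha_1}\cdots \mathfrak p_k^{\alpha_k}$ is the prime factorization of $n$ ($\mathfrak p_1<\mathfrak p_2<\dots$ the primes). $\mathcal{H}_r(X)$ is the image of $H_r(\mathbb{T}^\infty,X)$ under the (injective) map $\mathfrak{B}_X$, with norm $\|D\|_{\mathcal{H}_r(X)}=\|\mathfrak{B}_X^{-1}(D)\|_{H_r(\mathbb{T}^\infty,X)}$. *)

theory Defs
  imports "HOL-Probability.Probability" "HOL-Library.Infinite_Set"
begin

class complex_banach = banach +
  fixes scaleC :: "complex \<Rightarrow> 'a \<Rightarrow> 'a" (infixr "*\<^sub>C" 75)
  assumes scaleC_add_right: "c *\<^sub>C (x + y) = c *\<^sub>C x + c *\<^sub>C y"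
    and scaleC_add_left: "(c + d) *\<^sub>C x = c *\<^sub>C x + d *\<^sub>C x"
    and scaleC_scaleC: "c *\<^sub>C (d *\<^sub>C x) = (c * d) *\<^sub>C x"
    and scaleC_of_real: "complex_of_real r *\<^sub>C x = r *\<^sub>R x"
    and norm_scaleC: "norm (c *\<^sub>C x) = cmod c * norm x"

text \<open>The Bochner integral of the library is only available for second countable codomains.
  The following is the same construction for an arbitrary normed space, with Borel measurability
  replaced by strong measurability. Every function that is an almost everywhere limit of simple
  functions agrees almost everywhere with an everywhere limit, so that asking for
  convergence at every point is only a choice of representatives.\<close>

definition strongly_measurable :: "'a measure \<Rightarrow> ('a \<Rightarrow> 'b::real_normed_vector) \<Rightarrow> bool" where
  "strongly_measurable M f \<longleftrightarrow>
     (\<exists>s. (\<forall>i::nat. simple_function M (s i)) \<and> (\<forall>x\<in>space M. (\<lambda>i. s i x) \<longlonglongrightarrow> f x))"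

definition has_bochner_int :: "'a measure \<Rightarrow> ('a \<Rightarrow> 'b::real_normed_vector) \<Rightarrow> 'b \<Rightarrow> bool" where
  "has_bochner_int M f I \<longleftrightarrow>
     strongly_measurable M f \<and>
     (\<exists>s. (\<forall>i::nat. Bochner_Integration.simple_bochner_integrable M (s i)) \<and>
          (\<lambda>i. \<integral>\<^sup>+x. ennreal (norm (f x - s i x)) \<partial>M) \<longlonglongrightarrow> 0 \<and>
          (\<lambda>i. Bochner_Integration.simple_bochner_integral M (s i)) \<longlonglongrightarrow> I)"

definition bochner_int :: "'a measure \<Rightarrow> ('a \<Rightarrow> 'b::real_normed_vector) \<Rightarrow> 'b" where
  "bochner_int M f = (if \<exists>I. has_bochner_int M f I then THE I. has_bochner_int M f I else 0)"

text \<open>Elements of \<open>L\<^sub>r\<close> are represented by functions, so that the norm below is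
  a seminorm on \<open>Lr_space M r\<close> whose kernel consists of the functions vanishing almost everywhere.
  The real number \<open>Lr_norm M r f\<close> is meaningful only for \<open>f\<close> in \<open>Lr_space M r\<close>.\<close>

definition Lr_space :: "'a measure \<Rightarrow> ennreal \<Rightarrow> ('a \<Rightarrow> 'b::real_normed_vector) set" where
  "Lr_space M r = {f. strongly_measurable M f \<and>
     (if r = \<infinity> then esssup M (\<lambda>x. ennreal (norm (f x))) < \<infinity>
      else (\<integral>\<^sup>+x. ennreal (norm (f x) powr enn2real r) \<partial>M) < \<infinity>)}"

definition Lr_norm :: "'a measure \<Rightarrow> ennreal \<Rightarrow> ('a \<Rightarrow> 'b::real_normed_vector) \<Rightarrow> real" where
  "Lr_norm M r f =
     (if r = \<infinity> then enn2real (esssup M (\<lambda>x. ennreal (norm (f x))))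
      else enn2real (\<integral>\<^sup>+x. ennreal (norm (f x) powr enn2real r) \<partial>M) powr (1 / enn2real r))"

definition conj_exponent :: "real \<Rightarrow> ennreal" where
  "conj_exponent p = (if p = 1 then \<infinity> else ennreal (p / (p - 1)))"

definition ell :: "real \<Rightarrow> 'i set \<Rightarrow> ('i \<Rightarrow> 'b::real_normed_vector) set" where
  "ell p A = {x. (\<lambda>i. norm (x i) powr p) summable_on A}"

definition ell_norm :: "real \<Rightarrow> 'i set \<Rightarrow> ('i \<Rightarrow> 'b::real_normed_vector) \<Rightarrow> real" where
  "ell_norm p A x = (\<Sum>\<^sub>\<infinity>i\<in>A. norm (x i) powr p) powr (1 / p)"

definition circle_measure :: "complex measure" where
  "circle_measure =
     distr (uniform_measure lborel {0..2 * pi}) (restrict_space borel (sphere 0 1)) cis"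

definition fourier_type :: "'x::complex_banach itself \<Rightarrow> real \<Rightarrow> real \<Rightarrow> bool" where
  "fourier_type _ p C \<longleftrightarrow>
     (\<forall>(N::nat) (x :: nat \<Rightarrow> 'x).
        Lr_norm circle_measure (conj_exponent p) (\<lambda>z. \<Sum>k=1..N. z ^ k *\<^sub>C x k)
          \<le> C * (\<Sum>k=1..N. norm (x k) powr p) powr (1 / p))"

text \<open>The coordinates of the infinite torus are indexed from \<open>0\<close>, and accordingly
  \<open>nth_prime 0 = 2\<close>.\<close>

definition torus_measure :: "(nat \<Rightarrow> complex) measure" where
  "torus_measure = (\<Pi>\<^sub>M k\<in>UNIV. circle_measure)"

definition int_exponents :: "(nat \<Rightarrow> int) set" where
  "int_exponents = {\<alpha>. finite {k. \<alpha> k \<noteq> 0}}"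

definition nat_exponents :: "(nat \<Rightarrow> int) set" where
  "nat_exponents = {\<alpha> \<in> int_exponents. \<forall>k. 0 \<le> \<alpha> k}"

definition torus_monom :: "(nat \<Rightarrow> complex) \<Rightarrow> (nat \<Rightarrow> int) \<Rightarrow> complex" where
  "torus_monom z \<alpha> = (\<Prod>k | \<alpha> k \<noteq> 0. z k powi \<alpha> k)"

definition fourier_coeff ::
    "((nat \<Rightarrow> complex) \<Rightarrow> 'x::complex_banach) \<Rightarrow> (nat \<Rightarrow> int) \<Rightarrow> 'x" where
  "fourier_coeff f \<alpha> = bochner_int torus_measure (\<lambda>z. torus_monom z (\<lambda>k. - \<alpha> k) *\<^sub>C f z)"

definition hardy_space :: "ennreal \<Rightarrow> ((nat \<Rightarrow> complex) \<Rightarrow> 'x::complex_banach) set" where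
  "hardy_space r =
     {f \<in> Lr_space torus_measure r. \<forall>\<alpha> \<in> int_exponents - nat_exponents. fourier_coeff f \<alpha> = 0}"

text \<open>The formal Dirichlet series with coefficients \<open>a 1, a 2, \<dots>\<close> is represented by its coefficient
  function; the meaningless coefficient at index \<open>0\<close> is normalized to \<open>0\<close>.\<close>

definition dirichlet_series :: "(nat \<Rightarrow> 'x::zero) \<Rightarrow> (nat \<Rightarrow> 'x)" where
  "dirichlet_series a = (\<lambda>n. if n = 0 then 0 else a n)"

definition dirichlet_partial_sum :: "(nat \<Rightarrow> 'x::zero) \<Rightarrow> nat \<Rightarrow> (nat \<Rightarrow> 'x)" where
  "dirichlet_partial_sum a N = dirichlet_series (\<lambda>n. if n \<le> N then a n else 0)"

definition nth_prime :: "nat \<Rightarrow> nat" where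
  "nth_prime k = enumerate {q. prime q} k"

definition prime_exponents :: "nat \<Rightarrow> (nat \<Rightarrow> int)" where
  "prime_exponents n = (\<lambda>k. int (multiplicity (nth_prime k) n))"

definition bohr :: "((nat \<Rightarrow> complex) \<Rightarrow> 'x::complex_banach) \<Rightarrow> (nat \<Rightarrow> 'x)" where
  "bohr f = dirichlet_series (\<lambda>n. fourier_coeff f (prime_exponents n))"

definition dirichlet_hardy :: "ennreal \<Rightarrow> (nat \<Rightarrow> 'x::complex_banach) set" where
  "dirichlet_hardy r = bohr ` hardy_space r"

text \<open>The Bohr transform is injective up to equality almost everywhere, so that the norm does not
  depend on the preimage chosen by \<open>inv_into\<close>.\<close>

definition dirichlet_hardy_norm :: "ennreal \<Rightarrow> (nat \<Rightarrow> 'x::complex_banach) \<Rightarrow> real" where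
  "dirichlet_hardy_norm r D = Lr_norm torus_measure r (inv_into (hardy_space r) bohr D)"

definition converges_in_dirichlet_hardy ::
    "ennreal \<Rightarrow> (nat \<Rightarrow> 'x::complex_banach) \<Rightarrow> (nat \<Rightarrow> 'x) \<Rightarrow> bool" where
  "converges_in_dirichlet_hardy r a D \<longleftrightarrow>
     D \<in> dirichlet_hardy r \<and>
     (\<forall>N. dirichlet_partial_sum a N \<in> dirichlet_hardy r) \<and>
     (\<lambda>N. dirichlet_hardy_norm r (\<lambda>n. dirichlet_partial_sum a N n - D n)) \<longlonglongrightarrow> 0"

end

theory Submission
  imports Defs
begin

text \<open>A trigonometric polynomial \<open>\<Sum> x\<^sub>\<alpha> z\<^sup>\<alpha>\<close> on the infinite torus is averaged over the rotations that
  multiply the k-th coordinate by the power \<open>b ^ k\<close> of a single variable \<open>w\<close>. If \<open>b\<close> separates the exponents,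
  the polynomial becomes, for fixed \<open>z\<close>, a polynomial in \<open>w\<close> with coefficients of norm \<open>norm x\<^sub>\<alpha>\<close>, so that
  Fourier type gives the estimate with the same constant. Partial sums over finite sets of exponents then converge in
  \<open>L\<^sub>1\<close> and almost everywhere, and Fatou's lemma transfers the estimate to the limit. The Bohr transform
  carries this over to Dirichlet series, where the estimate for the tails gives convergence; conversely,
  polynomials in the first coordinate recover the Fourier type inequality. Norms in the Hardy space of Dirichlet series are
  computed from arbitrary representatives by uniqueness of Fourier coefficients. For the latter, without functionals
  on \<open>X\<close>, the bounded functions \<open>\<phi>\<close> that can be inserted into the vanishing integrals form an algebra
  closed under bounded pointwise limits which contains the coordinates, hence all indicator functions.\<close>

text \<open>The space \<open>X\<close> is not assumed separable, so Borel functions into it need not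
  be closed under sums, and every measurability argument has to keep simple approximations or a
  separable range at hand. A second obstacle is that the estimate must hold with exactly the
  constant C in the limit, although the limit function is only obtained almost everywhere. The tails
  are therefore cut so that their p-norms are at most \<open>(1 / 2) ^ n\<close>. The summability of
  these bounds produces the limit function from L1 estimates alone, while the norm bound is taken
  separately from the polynomials and so suffers no loss. Finally, the real numbers
  \<open>Lr_norm\<close> carry information only inside \<open>Lr_space\<close>; the estimates are
  thus made with \<open>Lr_le\<close>, which remains meaningful without knowing membership and
  survives limits.\<close>

lemma bounded_bilinear_scaleC: "bounded_bilinear (scaleC :: complex \<Rightarrow> 'x::complex_banach \<Rightarrow> 'x)"
proof
  fix r :: real and c d :: complex and x y :: 'x
  show "(c + d) *\<^sub>C x = c *\<^sub>C x + d *\<^sub>C x" by (rule scaleC_add_left)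
  show "c *\<^sub>C (x + y) = c *\<^sub>C x + c *\<^sub>C y" by (rule scaleC_add_right)
  show "(r *\<^sub>R c) *\<^sub>C x = r *\<^sub>R (c *\<^sub>C x)"
    by (simp add: scaleC_of_real[symmetric] scaleC_scaleC scaleR_conv_of_real)
  show "c *\<^sub>C (r *\<^sub>R x) = r *\<^sub>R (c *\<^sub>C x)"
    by (simp add: scaleC_of_real[symmetric] scaleC_scaleC mult.commute)
  show "\<exists>K. \<forall>a b. norm (a *\<^sub>C (b::'x)) \<le> norm a * norm b * K"
    by (rule exI[of _ 1]) (simp add: norm_scaleC)
qed

interpretation scaleC: bounded_bilinear "scaleC :: complex \<Rightarrow> 'x::complex_banach \<Rightarrow> 'x"
  by (rule bounded_bilinear_scaleC)

declare scaleC.zero_left [simp] scaleC.zero_right [simp]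

lemma scaleC_one [simp]: "1 *\<^sub>C (x::'x::complex_banach) = x"
  using scaleC_of_real[of 1 x] by simp

section \<open>Strong measurability\<close>

lemma strongly_measurable_simple: "simple_function M s \<Longrightarrow> strongly_measurable M s"
  unfolding strongly_measurable_def by (intro exI[of _ "\<lambda>_. s"]) auto

lemma strongly_measurable_const: "strongly_measurable M (\<lambda>_. c)"
  by (intro strongly_measurable_simple simple_function_const)

lemma strongly_measurable_cong:
  assumes "\<And>x. x \<in> space M \<Longrightarrow> f x = g x"
  shows "strongly_measurable M f \<longleftrightarrow> strongly_measurable M g"
  using assms unfolding strongly_measurable_def by simp

text \<open>Combining two simple functions pointwise gives a simple function for any
  \<open>h\<close>, so only sequential continuity of \<open>h\<close> is needed. Unary maps are
  covered by ignoring one argument.\<close>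

lemma strongly_measurable_continuous2:
  assumes "strongly_measurable M f" "strongly_measurable M g"
    and h: "\<And>a b u v. u \<longlonglongrightarrow> a \<Longrightarrow> v \<longlonglongrightarrow> b \<Longrightarrow> (\<lambda>i::nat. h (u i) (v i)) \<longlonglongrightarrow> h a b"
  shows "strongly_measurable M (\<lambda>x. h (f x) (g x))"
proof -
  obtain s t where s: "\<And>i. simple_function M (s i)" "\<And>x. x \<in> space M \<Longrightarrow> (\<lambda>i::nat. s i x) \<longlonglongrightarrow> f x"
    and t: "\<And>i. simple_function M (t i)" "\<And>x. x \<in> space M \<Longrightarrow> (\<lambda>i::nat. t i x) \<longlonglongrightarrow> g x"
    using assms(1,2) unfolding strongly_measurable_def by blast
  have "simple_function M (\<lambda>x. h (s i x) (t i x))" for i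
    by (rule simple_function_compose2[OF s(1) t(1)])
  moreover have "(\<lambda>i. h (s i x) (t i x)) \<longlonglongrightarrow> h (f x) (g x)" if "x \<in> space M" for x
    by (rule h[OF s(2)[OF that] t(2)[OF that]])
  ultimately show ?thesis
    unfolding strongly_measurable_def by (intro exI[of _ "\<lambda>i x. h (s i x) (t i x)"]) simp
qed

lemma strongly_measurable_add:
  "strongly_measurable M f \<Longrightarrow> strongly_measurable M g \<Longrightarrow> strongly_measurable M (\<lambda>x. f x + g x)"
  by (rule strongly_measurable_continuous2) (auto intro: tendsto_add)

lemma strongly_measurable_diff:
  "strongly_measurable M f \<Longrightarrow> strongly_measurable M g \<Longrightarrow> strongly_measurable M (\<lambda>x. f x - g x)"
  by (rule strongly_measurable_continuous2) (auto intro: tendsto_diff)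

lemma strongly_measurable_scaleC:
  "strongly_measurable M f \<Longrightarrow> strongly_measurable M g \<Longrightarrow>
    strongly_measurable M (\<lambda>x. f x *\<^sub>C (g x :: 'x::complex_banach))"
  by (rule strongly_measurable_continuous2) (auto intro: scaleC.tendsto)

lemma strongly_measurable_sum:
  assumes "\<And>i. i \<in> I \<Longrightarrow> strongly_measurable M (f i)"
  shows "strongly_measurable M (\<lambda>x. \<Sum>i\<in>I. f i x)"
  using assms
  by (induction I rule: infinite_finite_induct)
     (simp_all add: strongly_measurable_const strongly_measurable_add)

lemma borel_measurable_imp_strongly_measurable:
  fixes f :: "'a \<Rightarrow> 'b::{real_normed_vector, second_countable_topology}"
  shows "f \<in> borel_measurable M \<Longrightarrow> strongly_measurable M f"
  using borel_measurable_implies_sequence_metric[of f M 0] unfolding strongly_measurable_def by blast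

lemma strongly_measurable_imp_borel_measurable [measurable_dest]:
  assumes "strongly_measurable M f"
  shows "f \<in> borel_measurable M"
proof -
  obtain s where s: "\<And>i. simple_function M (s i)" "\<And>x. x \<in> space M \<Longrightarrow> (\<lambda>i::nat. s i x) \<longlonglongrightarrow> f x"
    using assms unfolding strongly_measurable_def by blast
  show ?thesis
    by (rule borel_measurable_LIMSEQ_metric[OF borel_measurable_simple_function s(2)]) (use s in auto)
qed

text \<open>The values of all the approximating simple functions form a countable set. Together with
  Borel measurability this is Pettis's characterization; the converse follows below.\<close>

lemma strongly_measurable_separable_range:
  assumes "strongly_measurable M f"
  obtains D where "countable D" "f ` space M \<subseteq> closure D"
proof -
  obtain s where s: "\<And>i. simple_function M (s i)" "\<And>x. x \<in> space M \<Longrightarrow> (\<lambda>i::nat. s i x) \<longlonglongrightarrow> f x"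
    using assms unfolding strongly_measurable_def by blast
  show thesis
  proof
    show "countable (\<Union>i. s i ` space M)"
      using s(1) by (intro countable_UN) (auto intro: countable_finite dest: simple_functionD(1))
    show "f ` space M \<subseteq> closure (\<Union>i. s i ` space M)"
    proof
      fix y assume "y \<in> f ` space M"
      then obtain x where x: "x \<in> space M" "y = f x" by auto
      show "y \<in> closure (\<Union>i. s i ` space M)"
        unfolding closure_sequential using x s(2)[OF x(1)]
        by (intro exI[of _ "\<lambda>i. s i x"]) auto
    qed
  qed
qed

text \<open>The n-th approximation of \<open>f\<close> takes the value in \<open>{d 0, \<dots>, d n}\<close> closest to \<open>f x\<close>,
  with ties resolved in favour of the smallest index.\<close>

lemma borel_measurable_separable_range_imp_strongly_measurable:
  fixes f :: "'a \<Rightarrow> 'b::real_normed_vector"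
  assumes [measurable]: "f \<in> borel_measurable M"
    and D: "countable D" "f ` space M \<subseteq> closure D"
  shows "strongly_measurable M f"
proof (cases "space M = {}")
  case True
  then show ?thesis unfolding strongly_measurable_def by auto
next
  case False
  then have "D \<noteq> {}" using D by auto
  define d where "d = from_nat_into D"
  have range_d: "range d = D" unfolding d_def by (rule range_from_nat_into[OF \<open>D \<noteq> {}\<close> D(1)])
  define c where "c n x = (LEAST j. j \<le> n \<and> (\<forall>i\<le>n. dist (f x) (d j) \<le> dist (f x) (d i)))" for n x
  have c_ex: "\<exists>j. j \<le> n \<and> (\<forall>i\<le>n. dist (f x) (d j) \<le> dist (f x) (d i))" for n x
  proof -
    have "\<exists>j\<in>{..n}. \<forall>i\<in>{..n}. dist (f x) (d j) \<le> dist (f x) (d i)"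
      using arg_min_if_finite[of "{..n}" "\<lambda>i. dist (f x) (d i)"] by (metis atMost_iff empty_iff finite_atMost le0 linorder_not_less)
    then show ?thesis by auto
  qed
  have c: "c n x \<le> n" "\<And>i. i \<le> n \<Longrightarrow> dist (f x) (d (c n x)) \<le> dist (f x) (d i)" for n x
    using LeastI_ex[OF c_ex[of n x]] unfolding c_def by auto
  \<comment> \<open>Only the real functions \<open>dist (f x) y\<close> with fixed \<open>y\<close>
    are compared, so no countable base of the codomain is needed.\<close>
  have c_meas [measurable]: "c n \<in> measurable M (count_space UNIV)" for n
  proof -
    have [measurable]: "(\<lambda>x. dist (f x) y) \<in> borel_measurable M" for y
      by (rule measurable_compose[OF assms(1) borel_measurable_continuous_onI]) (intro continuous_intros)
    show ?thesis unfolding c_def by measurable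
  qed
  show ?thesis
    unfolding strongly_measurable_def
  proof (intro exI[of _ "\<lambda>n x. d (c n x)"] conjI allI ballI)
    fix n
    have "simple_function M (c n)"
      unfolding simple_function_eq_measurable
      using c(1) by (auto intro: finite_subset[of _ "{..n}"])
    then show "simple_function M (\<lambda>x. d (c n x))" by (rule simple_function_compose1)
  next
    fix x assume x: "x \<in> space M"
    show "(\<lambda>n. d (c n x)) \<longlonglongrightarrow> f x"
    proof (rule tendstoI)
      fix e :: real assume "0 < e"
      have "f x \<in> closure D" using D(2) x by auto
      with \<open>0 < e\<close> obtain y where "y \<in> D" "dist y (f x) < e"
        unfolding closure_approachable by auto
      then obtain j where "dist (d j) (f x) < e" using range_d by auto
      then have "dist (d (c n x)) (f x) < e" if "j \<le> n" for n
        using c(2)[OF that, of x] by (simp add: dist_commute)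
      then show "\<forall>\<^sub>F n in sequentially. dist (d (c n x)) (f x) < e"
        unfolding eventually_sequentially by blast
    qed
  qed
qed

text \<open>A diagonal choice among the simple approximations need not converge. Borel measurability
  and separability of the range, on the other hand, both pass to pointwise limits.\<close>

lemma strongly_measurable_LIMSEQ:
  fixes f :: "'a \<Rightarrow> 'b::real_normed_vector"
  assumes u: "\<And>i. strongly_measurable M (u i)"
    and lim: "\<And>x. x \<in> space M \<Longrightarrow> (\<lambda>i::nat. u i x) \<longlonglongrightarrow> f x"
  shows "strongly_measurable M f"
proof -
  have "\<exists>D. countable D \<and> u i ` space M \<subseteq> closure D" for i
    by (rule strongly_measurable_separable_range[OF u[of i]]) auto
  then obtain D where D: "\<And>i. countable (D i)" "\<And>i. u i ` space M \<subseteq> closure (D i)"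
    by metis
  show ?thesis
  proof (rule borel_measurable_separable_range_imp_strongly_measurable)
    show "f \<in> borel_measurable M"
      by (rule borel_measurable_LIMSEQ_metric[OF strongly_measurable_imp_borel_measurable[OF u] lim])
    show "countable (\<Union>i. D i)" using D by auto
    show "f ` space M \<subseteq> closure (\<Union>i. D i)"
    proof
      fix y assume "y \<in> f ` space M"
      then obtain x where x: "x \<in> space M" "y = f x" by auto
      have "u i x \<in> closure (\<Union>i. D i)" for i
        using D(2)[of i] x(1) closure_mono[of "D i" "\<Union>i. D i"] by auto
      then have "f x \<in> closure (closure (\<Union>i. D i))"
        using lim[OF x(1)] unfolding closure_sequential[of _ "closure (\<Union>i. D i)"]
        by (intro exI[of _ "\<lambda>i. u i x"]) simp
      then show "y \<in> closure (\<Union>i. D i)" using x by simp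
    qed
  qed
qed

section \<open>The Bochner integral\<close>

abbreviation "simple_bochner_integrable \<equiv> Bochner_Integration.simple_bochner_integrable"
abbreviation "simple_bochner_integral \<equiv> Bochner_Integration.simple_bochner_integral"

text \<open>This estimate gives the uniqueness of the integral, the Cauchy property of the
  approximating integrals and, with \<open>t = 0\<close>, the norm bound for the integral.\<close>

lemma simple_bochner_integral_dist_le:
  fixes f :: "'a \<Rightarrow> 'b::real_normed_vector"
  assumes f: "strongly_measurable M f"
    and s: "simple_bochner_integrable M s" and t: "simple_bochner_integrable M t"
  shows "ennreal (norm (simple_bochner_integral M s - simple_bochner_integral M t)) \<le>
    (\<integral>\<^sup>+ x. norm (f x - s x) \<partial>M) + (\<integral>\<^sup>+ x. norm (f x - t x) \<partial>M)"
    (is "ennreal (norm (?s - ?t)) \<le> ?S + ?T")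
proof -
  have sm: "strongly_measurable M s" "strongly_measurable M t"
    using s t by (auto intro: strongly_measurable_simple elim: simple_bochner_integrable.cases)
  \<comment> \<open>The differences are measurable because they are strongly measurable; Borel
    measurability of \<open>f\<close> and \<open>s\<close> separately would not suffice in a
    nonseparable space.\<close>
  have [measurable]: "(\<lambda>x. f x - s x) \<in> borel_measurable M" "(\<lambda>x. f x - t x) \<in> borel_measurable M"
    using strongly_measurable_diff[OF f sm(1)] strongly_measurable_diff[OF f sm(2)]
    by (auto dest: strongly_measurable_imp_borel_measurable)
  have "ennreal (norm (?s - ?t)) = norm (simple_bochner_integral M (\<lambda>x. s x - t x))"
    using s t by (subst simple_bochner_integral_diff) auto
  also have "\<dots> \<le> simple_bochner_integral M (\<lambda>x. norm (s x - t x))"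
    using simple_bochner_integrable_compose2[of "(-)" M "s" "t"] s t
    by (auto intro!: simple_bochner_integral_norm_bound)
  also have "\<dots> = (\<integral>\<^sup>+x. norm (s x - t x) \<partial>M)"
    using simple_bochner_integrable_compose2[of "\<lambda>x y. norm (x - y)" M "s" "t"] s t
    by (auto intro!: simple_bochner_integral_eq_nn_integral)
  also have "\<dots> \<le> (\<integral>\<^sup>+x. ennreal (norm (f x - s x)) + ennreal (norm (f x - t x)) \<partial>M)"
  proof -
    have "norm (s x - t x) \<le> norm (f x - s x) + norm (f x - t x)" for x
      by (metis dual_order.refl norm_diff_triangle_le norm_minus_commute)
    then show ?thesis
      by (metis (mono_tags, lifting) ennreal_leI ennreal_plus nn_integral_mono norm_ge_zero)
  qed
  also have "\<dots> = ?S + ?T"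
    by (rule nn_integral_add) auto
  finally show ?thesis .
qed

lemma has_bochner_int_unique:
  assumes "has_bochner_int M f I" "has_bochner_int M f J"
  shows "I = J"
proof -
  obtain s t where s: "\<And>i::nat. simple_bochner_integrable M (s i)"
      "(\<lambda>i. \<integral>\<^sup>+x. ennreal (norm (f x - s i x)) \<partial>M) \<longlonglongrightarrow> 0"
      "(\<lambda>i. simple_bochner_integral M (s i)) \<longlonglongrightarrow> I"
    and t: "\<And>i::nat. simple_bochner_integrable M (t i)"
      "(\<lambda>i. \<integral>\<^sup>+x. ennreal (norm (f x - t i x)) \<partial>M) \<longlonglongrightarrow> 0"
      "(\<lambda>i. simple_bochner_integral M (t i)) \<longlonglongrightarrow> J"
    and f: "strongly_measurable M f"
    using assms unfolding has_bochner_int_def by blast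
  have "(\<lambda>i. ennreal (norm (simple_bochner_integral M (s i) - simple_bochner_integral M (t i))))
      \<longlonglongrightarrow> ennreal (norm (I - J))"
    by (intro tendsto_intros s t)
  moreover have "(\<lambda>i. (\<integral>\<^sup>+x. norm (f x - s i x) \<partial>M) + (\<integral>\<^sup>+x. norm (f x - t i x) \<partial>M)) \<longlonglongrightarrow> 0 + 0"
    by (intro tendsto_add s t)
  ultimately have "ennreal (norm (I - J)) \<le> 0 + 0"
    by (rule LIMSEQ_le) (use simple_bochner_integral_dist_le[OF f s(1) t(1)] in auto)
  then show ?thesis by simp
qed

lemma bochner_int_eq: "has_bochner_int M f I \<Longrightarrow> bochner_int M f = I"
  unfolding bochner_int_def using has_bochner_int_unique by (auto intro!: the_equality)

lemma bochner_int_cong: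
  assumes "\<And>x. x \<in> space M \<Longrightarrow> f x = g x"
  shows "bochner_int M f = bochner_int M g"
proof -
  have "has_bochner_int M f = has_bochner_int M g"
    unfolding has_bochner_int_def
    using assms by (intro ext) (simp cong: strongly_measurable_cong nn_integral_cong)
  then show ?thesis unfolding bochner_int_def by (simp only:)
qed

text \<open>Bochner's criterion, which can be checked without exhibiting approximations; in a
  complete space it implies that the integral exists.\<close>

definition bochner_integrable :: "'a measure \<Rightarrow> ('a \<Rightarrow> 'b::real_normed_vector) \<Rightarrow> bool" where
  "bochner_integrable M f \<longleftrightarrow>
     strongly_measurable M f \<and> (\<integral>\<^sup>+x. ennreal (norm (f x)) \<partial>M) < \<infinity>"

text \<open>The simple functions \<open>s i\<close> of a strongly measurable function need not be dominated, so that
  they are first set to zero wherever \<open>norm (s i x) > 2 * norm (f x)\<close>.\<close>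

lemma bochner_integrable_approx:
  fixes f :: "'a \<Rightarrow> 'b::real_normed_vector"
  assumes "bochner_integrable M f"
  obtains s where "\<And>i::nat. simple_bochner_integrable M (s i)"
    "(\<lambda>i. \<integral>\<^sup>+x. ennreal (norm (f x - s i x)) \<partial>M) \<longlonglongrightarrow> 0"
proof -
  have f: "strongly_measurable M f" and fin: "(\<integral>\<^sup>+x. ennreal (norm (f x)) \<partial>M) < \<infinity>"
    using assms unfolding bochner_integrable_def by auto
  obtain s where s: "\<And>i. simple_function M (s i)" "\<And>x. x \<in> space M \<Longrightarrow> (\<lambda>i::nat. s i x) \<longlonglongrightarrow> f x"
    using f unfolding strongly_measurable_def by blast
  have [measurable]: "f \<in> borel_measurable M" "s i \<in> borel_measurable M" for i
    using f s(1) by (auto intro: strongly_measurable_imp_borel_measurable borel_measurable_simple_function)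
  define t where "t i x = indicat_real {x \<in> space M. norm (s i x) \<le> 2 * norm (f x)} x *\<^sub>R s i x" for i x
  have t_simple: "simple_function M (t i)" for i
    unfolding t_def by (intro simple_function_compose2[where h="(*\<^sub>R)"] s simple_function_indicator) measurable
  have t_le: "norm (t i x) \<le> 2 * norm (f x)" for i x
    unfolding t_def by (auto split: split_indicator)
  have fin2: "(\<integral>\<^sup>+x. ennreal (c * norm (f x)) \<partial>M) < \<infinity>" if "0 \<le> c" for c
    using fin that by (simp add: ennreal_mult nn_integral_cmult ennreal_mult_less_top)
  \<comment> \<open>At zeros of \<open>f\<close> the truncation forces the value 0. Elsewhere
    \<open>norm (s i x)\<close> eventually drops below \<open>2 * norm (f x)\<close>, and the
    truncation becomes inactive.\<close>
  have t_lim: "(\<lambda>i. t i x) \<longlonglongrightarrow> f x" if x: "x \<in> space M" for x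
  proof (cases "f x = 0")
    case True
    then have "t i x = 0" for i using t_le[of i x] by simp
    then show ?thesis using True by simp
  next
    case False
    have "(\<lambda>i. norm (s i x)) \<longlonglongrightarrow> norm (f x)" by (intro tendsto_norm s x)
    then have "\<forall>\<^sub>F i in sequentially. norm (s i x) < 2 * norm (f x)"
      by (rule order_tendstoD) (use False in auto)
    then have "\<forall>\<^sub>F i in sequentially. s i x = t i x"
      by eventually_elim (use x in \<open>auto simp: t_def\<close>)
    then show ?thesis by (rule Lim_transform_eventually[OF s(2)[OF x]])
  qed
  show thesis
  proof
    fix i
    have "(\<integral>\<^sup>+x. norm (t i x) \<partial>M) \<le> (\<integral>\<^sup>+x. ennreal (2 * norm (f x)) \<partial>M)"
      by (intro nn_integral_mono ennreal_leI t_le)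
    also have "\<dots> < \<infinity>" by (rule fin2) simp
    finally show "simple_bochner_integrable M (t i)"
      by (intro simple_bochner_integrableI_bounded t_simple)
  next
    have m: "(\<lambda>x. f x - t i x) \<in> borel_measurable M" for i
      by (intro strongly_measurable_imp_borel_measurable strongly_measurable_diff f
          strongly_measurable_simple t_simple)
    have "(\<lambda>i. \<integral>\<^sup>+x. ennreal (norm (f x - t i x)) \<partial>M) \<longlonglongrightarrow> (\<integral>\<^sup>+x. 0 \<partial>M)"
    proof (rule nn_integral_dominated_convergence[where w="\<lambda>x. ennreal (3 * norm (f x))"])
      show "(\<lambda>x. ennreal (norm (f x - t i x))) \<in> borel_measurable M" for i
        using m[of i] by measurable
      show "AE x in M. ennreal (norm (f x - t i x)) \<le> ennreal (3 * norm (f x))" for i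
      proof (intro AE_I2 ennreal_leI)
        fix x show "norm (f x - t i x) \<le> 3 * norm (f x)"
          using norm_triangle_ineq4[of "f x" "t i x"] t_le[of i x] by simp
      qed
      show "AE x in M. (\<lambda>i. ennreal (norm (f x - t i x))) \<longlonglongrightarrow> 0"
      proof (rule AE_I2)
        fix x assume "x \<in> space M"
        then have "(\<lambda>i. norm (f x - t i x)) \<longlonglongrightarrow> norm (f x - f x)" by (intro tendsto_intros t_lim)
        then show "(\<lambda>i. ennreal (norm (f x - t i x))) \<longlonglongrightarrow> 0" by (simp flip: ennreal_0)
      qed
    qed (use fin2[of 3] in auto)
    then show "(\<lambda>i. \<integral>\<^sup>+x. ennreal (norm (f x - t i x)) \<partial>M) \<longlonglongrightarrow> 0" by simp
  qed
qed

text \<open>Completeness enters here: the integrals of L1 approximations form a Cauchy sequence and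
  therefore have a limit.\<close>

lemma has_bochner_int_bochner_int:
  fixes f :: "'a \<Rightarrow> 'b::banach"
  assumes "bochner_integrable M f"
  shows "has_bochner_int M f (bochner_int M f)"
proof -
  have f: "strongly_measurable M f" using assms unfolding bochner_integrable_def by simp
  obtain s where s: "\<And>i::nat. simple_bochner_integrable M (s i)"
    and lim: "(\<lambda>i. \<integral>\<^sup>+x. ennreal (norm (f x - s i x)) \<partial>M) \<longlonglongrightarrow> 0"
    using bochner_integrable_approx[OF assms] by blast
  have "Cauchy (\<lambda>i. simple_bochner_integral M (s i))"
  proof (rule metric_CauchyI)
    fix e :: real assume "0 < e"
    then have "0 < ennreal (e / 2)" by auto
    from order_tendstoD(2)[OF lim this]
    obtain n where n: "\<And>i. n \<le> i \<Longrightarrow> (\<integral>\<^sup>+x. ennreal (norm (f x - s i x)) \<partial>M) < ennreal (e / 2)"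
      by (auto simp: eventually_sequentially)
    show "\<exists>N. \<forall>i\<ge>N. \<forall>j\<ge>N. dist (simple_bochner_integral M (s i)) (simple_bochner_integral M (s j)) < e"
    proof (intro exI allI impI)
      fix i j assume ij: "n \<le> i" "n \<le> j"
      have "ennreal (norm (simple_bochner_integral M (s i) - simple_bochner_integral M (s j))) \<le>
          (\<integral>\<^sup>+x. norm (f x - s i x) \<partial>M) + (\<integral>\<^sup>+x. norm (f x - s j x) \<partial>M)"
        by (intro simple_bochner_integral_dist_le f s)
      also have "\<dots> < ennreal (e / 2) + ennreal (e / 2)"
        by (intro add_strict_mono n ij)
      also have "\<dots> = ennreal e" using \<open>0 < e\<close> by (simp flip: ennreal_plus)
      finally show "dist (simple_bochner_integral M (s i)) (simple_bochner_integral M (s j)) < e"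
        by (simp add: dist_norm ennreal_less_iff)
    qed
  qed
  then obtain I where "(\<lambda>i. simple_bochner_integral M (s i)) \<longlonglongrightarrow> I"
    using Cauchy_convergent_iff convergent_def by blast
  then have "has_bochner_int M f I"
    unfolding has_bochner_int_def using f s lim by blast
  then show ?thesis using bochner_int_eq by metis
qed

lemma bochner_integrable_add:
  assumes "bochner_integrable M f" "bochner_integrable M g"
  shows "bochner_integrable M (\<lambda>x. f x + g x)"
proof -
  have sm: "strongly_measurable M f" "strongly_measurable M g"
    using assms unfolding bochner_integrable_def by auto
  note [measurable] = sm[THEN strongly_measurable_imp_borel_measurable]
  have "(\<integral>\<^sup>+x. norm (f x + g x) \<partial>M) \<le> (\<integral>\<^sup>+x. ennreal (norm (f x)) + ennreal (norm (g x)) \<partial>M)"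
    by (intro nn_integral_mono) (simp add: norm_triangle_ineq flip: ennreal_plus)
  also have "\<dots> = (\<integral>\<^sup>+x. norm (f x) \<partial>M) + (\<integral>\<^sup>+x. norm (g x) \<partial>M)"
    by (rule nn_integral_add) auto
  also have "\<dots> < \<infinity>" using assms unfolding bochner_integrable_def by auto
  finally show ?thesis unfolding bochner_integrable_def using strongly_measurable_add[OF sm] by blast
qed

lemma bochner_int_add:
  fixes f g :: "'a \<Rightarrow> 'b::banach"
  assumes "bochner_integrable M f" "bochner_integrable M g"
  shows "bochner_int M (\<lambda>x. f x + g x) = bochner_int M f + bochner_int M g"
proof -
  obtain s t where s: "\<And>i::nat. simple_bochner_integrable M (s i)"
      "(\<lambda>i. \<integral>\<^sup>+x. ennreal (norm (f x - s i x)) \<partial>M) \<longlonglongrightarrow> 0"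
      "(\<lambda>i. simple_bochner_integral M (s i)) \<longlonglongrightarrow> bochner_int M f"
    and t: "\<And>i::nat. simple_bochner_integrable M (t i)"
      "(\<lambda>i. \<integral>\<^sup>+x. ennreal (norm (g x - t i x)) \<partial>M) \<longlonglongrightarrow> 0"
      "(\<lambda>i. simple_bochner_integral M (t i)) \<longlonglongrightarrow> bochner_int M g"
    and sm: "strongly_measurable M f" "strongly_measurable M g"
    using assms[THEN has_bochner_int_bochner_int] unfolding has_bochner_int_def by blast
  have st: "simple_bochner_integrable M (\<lambda>x. s i x + t i x)" for i
    using s(1) t(1) by (intro simple_bochner_integrable_compose2[where p="(+)"]) auto
  have sm_st: "strongly_measurable M (s i)" "strongly_measurable M (t i)" for i
    using s(1) t(1) by (auto intro: strongly_measurable_simple elim: simple_bochner_integrable.cases)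
  note [measurable] = strongly_measurable_diff[OF sm(1) sm_st(1), THEN strongly_measurable_imp_borel_measurable]
    strongly_measurable_diff[OF sm(2) sm_st(2), THEN strongly_measurable_imp_borel_measurable]
  have "(\<lambda>i. \<integral>\<^sup>+x. ennreal (norm (f x + g x - (s i x + t i x))) \<partial>M) \<longlonglongrightarrow> 0"
  proof (rule tendsto_sandwich[OF _ _ tendsto_const])
    show "\<forall>\<^sub>F i in sequentially. 0 \<le> (\<integral>\<^sup>+x. ennreal (norm (f x + g x - (s i x + t i x))) \<partial>M)" by simp
    have "(\<integral>\<^sup>+x. ennreal (norm (f x + g x - (s i x + t i x))) \<partial>M) \<le>
        (\<integral>\<^sup>+x. ennreal (norm (f x - s i x)) \<partial>M) + (\<integral>\<^sup>+x. ennreal (norm (g x - t i x)) \<partial>M)" for i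
    proof -
      have "(\<integral>\<^sup>+x. ennreal (norm (f x + g x - (s i x + t i x))) \<partial>M) \<le>
          (\<integral>\<^sup>+x. ennreal (norm (f x - s i x)) + ennreal (norm (g x - t i x)) \<partial>M)"
        by (intro nn_integral_mono) (simp add: norm_diff_triangle_ineq flip: ennreal_plus)
      also have "\<dots> = (\<integral>\<^sup>+x. ennreal (norm (f x - s i x)) \<partial>M) + (\<integral>\<^sup>+x. ennreal (norm (g x - t i x)) \<partial>M)"
        by (rule nn_integral_add) auto
      finally show ?thesis .
    qed
    then show "\<forall>\<^sub>F i in sequentially. (\<integral>\<^sup>+x. ennreal (norm (f x + g x - (s i x + t i x))) \<partial>M) \<le>
        (\<integral>\<^sup>+x. ennreal (norm (f x - s i x)) \<partial>M) + (\<integral>\<^sup>+x. ennreal (norm (g x - t i x)) \<partial>M)" by simp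
    show "(\<lambda>i. (\<integral>\<^sup>+x. ennreal (norm (f x - s i x)) \<partial>M) + (\<integral>\<^sup>+x. ennreal (norm (g x - t i x)) \<partial>M)) \<longlonglongrightarrow> 0"
      using tendsto_add[OF s(2) t(2)] by simp
  qed
  moreover have "(\<lambda>i. simple_bochner_integral M (\<lambda>x. s i x + t i x)) \<longlonglongrightarrow> bochner_int M f + bochner_int M g"
    unfolding simple_bochner_integral_add[OF s(1) t(1)] by (intro tendsto_add s t)
  ultimately show ?thesis
    using st strongly_measurable_add[OF sm]
    by (intro bochner_int_eq) (auto simp: has_bochner_int_def intro!: exI[of _ "\<lambda>i x. s i x + t i x"])
qed

text \<open>A bounded operator maps simple approximations to simple approximations. It is applied to
  negation, to multiplication by a fixed scalar, and to the map that sends a scalar to its multiple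
  of a fixed vector.\<close>

lemma has_bochner_int_bounded_linear:
  fixes T :: "'b::real_normed_vector \<Rightarrow> 'c::real_normed_vector"
  assumes T: "bounded_linear T" and f: "has_bochner_int M f I"
  shows "has_bochner_int M (\<lambda>x. T (f x)) (T I)"
proof -
  interpret T: bounded_linear T by fact
  obtain s where s: "\<And>i::nat. simple_bochner_integrable M (s i)"
      "(\<lambda>i. \<integral>\<^sup>+x. ennreal (norm (f x - s i x)) \<partial>M) \<longlonglongrightarrow> 0"
      "(\<lambda>i. simple_bochner_integral M (s i)) \<longlonglongrightarrow> I"
    and sm: "strongly_measurable M f"
    using f unfolding has_bochner_int_def by blast
  obtain K where K: "K > 0" "\<And>x. norm (T x) \<le> norm x * K" using T.pos_bounded by blast
  have sm_s: "strongly_measurable M (s i)" for i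
    using s(1) by (auto intro: strongly_measurable_simple elim: simple_bochner_integrable.cases)
  note [measurable] = strongly_measurable_diff[OF sm sm_s, THEN strongly_measurable_imp_borel_measurable]
  have "strongly_measurable M (\<lambda>x. T (f x))"
    using strongly_measurable_continuous2[OF sm sm, of "\<lambda>a b. T a"] T.tendsto by blast
  moreover have "simple_bochner_integrable M (\<lambda>x. T (s i x))" for i
    using s(1) by (intro simple_bochner_integrable_compose2[where p="\<lambda>a b. T a"]) (auto simp: T.zero)
  moreover have "(\<lambda>i. \<integral>\<^sup>+x. ennreal (norm (T (f x) - T (s i x))) \<partial>M) \<longlonglongrightarrow> 0"
  proof (rule tendsto_sandwich[OF _ _ tendsto_const])
    show "\<forall>\<^sub>F i in sequentially. 0 \<le> (\<integral>\<^sup>+x. ennreal (norm (T (f x) - T (s i x))) \<partial>M)" by simp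
    have "(\<integral>\<^sup>+x. ennreal (norm (T (f x) - T (s i x))) \<partial>M) \<le>
        ennreal K * (\<integral>\<^sup>+x. ennreal (norm (f x - s i x)) \<partial>M)" for i
    proof -
      have "(\<integral>\<^sup>+x. ennreal (norm (T (f x) - T (s i x))) \<partial>M) \<le>
          (\<integral>\<^sup>+x. ennreal K * ennreal (norm (f x - s i x)) \<partial>M)"
        using K by (intro nn_integral_mono) (simp add: mult.commute flip: ennreal_mult T.diff)
      then show ?thesis by (simp add: nn_integral_cmult)
    qed
    then show "\<forall>\<^sub>F i in sequentially. (\<integral>\<^sup>+x. ennreal (norm (T (f x) - T (s i x))) \<partial>M) \<le>
        ennreal K * (\<integral>\<^sup>+x. ennreal (norm (f x - s i x)) \<partial>M)" by simp
    show "(\<lambda>i. ennreal K * (\<integral>\<^sup>+x. ennreal (norm (f x - s i x)) \<partial>M)) \<longlonglongrightarrow> 0"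
      using ennreal_tendsto_cmult[OF _ s(2), of "ennreal K"] by simp
  qed
  moreover have "(\<lambda>i. simple_bochner_integral M (\<lambda>x. T (s i x))) \<longlonglongrightarrow> T I"
    unfolding simple_bochner_integral_linear[OF T.linear_axioms s(1)] by (intro T.tendsto s)
  ultimately show ?thesis
    unfolding has_bochner_int_def by (intro conjI exI[of _ "\<lambda>i x. T (s i x)"] allI)
qed

lemma bochner_integrable_bounded_linear:
  assumes T: "bounded_linear T" and f: "bochner_integrable M f"
  shows "bochner_integrable M (\<lambda>x. T (f x))"
proof -
  interpret T: bounded_linear T by fact
  obtain K where K: "K > 0" "\<And>x. norm (T x) \<le> norm x * K" using T.pos_bounded by blast
  have sm: "strongly_measurable M f" using f unfolding bochner_integrable_def by simp
  note [measurable] = sm[THEN strongly_measurable_imp_borel_measurable]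
  have "(\<integral>\<^sup>+x. norm (T (f x)) \<partial>M) \<le> (\<integral>\<^sup>+x. ennreal K * norm (f x) \<partial>M)"
    using K by (intro nn_integral_mono) (simp add: mult.commute flip: ennreal_mult)
  also have "\<dots> = ennreal K * (\<integral>\<^sup>+x. norm (f x) \<partial>M)" by (simp add: nn_integral_cmult)
  also have "\<dots> < \<infinity>" using f unfolding bochner_integrable_def by (simp add: ennreal_mult_less_top)
  finally show ?thesis
    using strongly_measurable_continuous2[OF sm sm, of "\<lambda>a b. T a"] T.tendsto
    unfolding bochner_integrable_def by blast
qed

lemma bochner_int_bounded_linear:
  fixes f :: "'a \<Rightarrow> 'b::banach"
  assumes "bounded_linear T" "bochner_integrable M f"
  shows "bochner_int M (\<lambda>x. T (f x)) = T (bochner_int M f)"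
  by (rule bochner_int_eq[OF has_bochner_int_bounded_linear[OF assms(1) has_bochner_int_bochner_int[OF assms(2)]]])

lemma bochner_integrable_diff:
  assumes "bochner_integrable M f" "bochner_integrable M g"
  shows "bochner_integrable M (\<lambda>x. f x - g x)"
  using bochner_integrable_add[OF assms(1) bochner_integrable_bounded_linear[OF _ assms(2)], of uminus]
  by (simp add: bounded_linear_minus bounded_linear_ident)

lemma bochner_int_diff:
  fixes f g :: "'a \<Rightarrow> 'b::banach"
  assumes "bochner_integrable M f" "bochner_integrable M g"
  shows "bochner_int M (\<lambda>x. f x - g x) = bochner_int M f - bochner_int M g"
proof -
  have um: "bounded_linear (uminus :: 'b \<Rightarrow> 'b)" by (simp add: bounded_linear_minus bounded_linear_ident)
  show ?thesis
    using bochner_int_add[OF assms(1) bochner_integrable_bounded_linear[OF um assms(2)]]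
      bochner_int_bounded_linear[OF um assms(2)] by simp
qed

lemma simple_bochner_integral_zero: "simple_bochner_integral M (\<lambda>_. 0) = 0"
  unfolding simple_bochner_integral_def by (intro sum.neutral) auto

lemma bochner_int_zero: "bochner_int M (\<lambda>_. 0) = (0::'b::real_normed_vector)"
  by (intro bochner_int_eq)
     (auto simp: has_bochner_int_def strongly_measurable_const simple_bochner_integral_zero
       simple_bochner_integrable.simps intro!: exI[of _ "\<lambda>i x. 0"])

lemma bochner_integrable_sum:
  assumes "\<And>i. i \<in> I \<Longrightarrow> bochner_integrable M (f i)"
  shows "bochner_integrable M (\<lambda>x. \<Sum>i\<in>I. f i x)"
  using assms
proof (induction I rule: infinite_finite_induct)
  case (insert i I) then show ?case by (simp add: bochner_integrable_add)
qed (simp_all add: bochner_integrable_def strongly_measurable_const)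

lemma bochner_int_sum:
  fixes f :: "'i \<Rightarrow> 'a \<Rightarrow> 'b::banach"
  assumes "\<And>i. i \<in> I \<Longrightarrow> bochner_integrable M (f i)"
  shows "bochner_int M (\<lambda>x. \<Sum>i\<in>I. f i x) = (\<Sum>i\<in>I. bochner_int M (f i))"
  using assms
proof (induction I rule: infinite_finite_induct)
  case (insert i I)
  then show ?case by (simp add: bochner_int_add bochner_integrable_sum)
qed (simp_all add: bochner_int_zero)

lemma norm_bochner_int_le:
  fixes f :: "'a \<Rightarrow> 'b::banach"
  assumes f: "bochner_integrable M f"
  shows "ennreal (norm (bochner_int M f)) \<le> (\<integral>\<^sup>+x. ennreal (norm (f x)) \<partial>M)"
proof -
  obtain s where s: "\<And>i::nat. simple_bochner_integrable M (s i)"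
      "(\<lambda>i. \<integral>\<^sup>+x. ennreal (norm (f x - s i x)) \<partial>M) \<longlonglongrightarrow> 0"
      "(\<lambda>i. simple_bochner_integral M (s i)) \<longlonglongrightarrow> bochner_int M f"
    and sm: "strongly_measurable M f"
    using f[THEN has_bochner_int_bochner_int] unfolding has_bochner_int_def by blast
  have z: "simple_bochner_integrable M (\<lambda>_. 0::'b)" by (auto simp: simple_bochner_integrable.simps)
  have "(\<lambda>i. ennreal (norm (simple_bochner_integral M (s i)))) \<longlonglongrightarrow> ennreal (norm (bochner_int M f))"
    by (intro tendsto_intros s)
  moreover have "(\<lambda>i. (\<integral>\<^sup>+x. norm (f x - s i x) \<partial>M) + (\<integral>\<^sup>+x. norm (f x) \<partial>M)) \<longlonglongrightarrow> 0 + (\<integral>\<^sup>+x. norm (f x) \<partial>M)"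
    by (intro tendsto_add s tendsto_const)
  ultimately have "ennreal (norm (bochner_int M f)) \<le> 0 + (\<integral>\<^sup>+x. norm (f x) \<partial>M)"
    by (rule LIMSEQ_le) (use simple_bochner_integral_dist_le[OF sm s(1) z] in \<open>auto simp: simple_bochner_integral_zero\<close>)
  then show ?thesis by simp
qed

lemma norm_bochner_int_diff_le:
  fixes f g :: "'a \<Rightarrow> 'b::banach"
  assumes "bochner_integrable M f" "bochner_integrable M g"
  shows "ennreal (norm (bochner_int M f - bochner_int M g)) \<le> (\<integral>\<^sup>+x. ennreal (norm (f x - g x)) \<partial>M)"
  using norm_bochner_int_le[OF bochner_integrable_diff[OF assms]] bochner_int_diff[OF assms] by simp

lemma has_bochner_int_lebesgue_integral:
  fixes f :: "'a \<Rightarrow> 'b::{banach, second_countable_topology}"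
  assumes "integrable M f"
  shows "has_bochner_int M f (integral\<^sup>L M f)"
  using has_bochner_integral_integrable[OF assms]
  by (auto elim!: has_bochner_integral.cases
      simp: has_bochner_int_def intro: borel_measurable_imp_strongly_measurable)

lemma bochner_integrable_bounded_scaleC:
  fixes f :: "'a \<Rightarrow> 'x::complex_banach"
  assumes f: "bochner_integrable M f" and [measurable]: "\<phi> \<in> borel_measurable M"
    and B: "\<And>x. x \<in> space M \<Longrightarrow> cmod (\<phi> x) \<le> B"
  shows "bochner_integrable M (\<lambda>x. \<phi> x *\<^sub>C f x)"
proof -
  have sm: "strongly_measurable M f" using f unfolding bochner_integrable_def by simp
  note [measurable] = sm[THEN strongly_measurable_imp_borel_measurable]
  have "(\<integral>\<^sup>+x. norm (\<phi> x *\<^sub>C f x) \<partial>M) \<le> (\<integral>\<^sup>+x. ennreal \<bar>B\<bar> * norm (f x) \<partial>M)"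
    using B by (intro nn_integral_mono)
      (fastforce simp: norm_scaleC intro!: mult_right_mono simp flip: ennreal_mult)
  also have "\<dots> = ennreal \<bar>B\<bar> * (\<integral>\<^sup>+x. norm (f x) \<partial>M)" by (simp add: nn_integral_cmult)
  also have "\<dots> < \<infinity>" using f unfolding bochner_integrable_def by (simp add: ennreal_mult_less_top)
  finally show ?thesis
    unfolding bochner_integrable_def
    using strongly_measurable_scaleC[OF borel_measurable_imp_strongly_measurable sm] by auto
qed

text \<open>Integrals of a scalar function in a fixed direction reduce to the scalar Lebesgue
  integral; this is how measures of sets and integrals of monomials are computed.\<close>

lemma bochner_int_scaleC_const:
  assumes "integrable M \<phi>"
  shows "bochner_integrable M (\<lambda>x. \<phi> x *\<^sub>C (v::'x::complex_banach))"
    and "bochner_int M (\<lambda>x. \<phi> x *\<^sub>C v) = integral\<^sup>L M \<phi> *\<^sub>C v"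
proof -
  have "bochner_integrable M \<phi>"
    using assms unfolding bochner_integrable_def
    by (auto simp: integrable_iff_bounded intro: borel_measurable_imp_strongly_measurable)
  then show "bochner_integrable M (\<lambda>x. \<phi> x *\<^sub>C v)"
    by (rule bochner_integrable_bounded_linear[OF scaleC.bounded_linear_left])
  show "bochner_int M (\<lambda>x. \<phi> x *\<^sub>C v) = integral\<^sup>L M \<phi> *\<^sub>C v"
    by (intro bochner_int_eq has_bochner_int_bounded_linear[OF scaleC.bounded_linear_left]
        has_bochner_int_lebesgue_integral assms)
qed

text \<open>Dominated convergence with the majorant \<open>2 * \<bar>B\<bar> * norm (f x)\<close>.
  It supplies the closure under bounded pointwise limits in the uniqueness theorem for Fourier
  coefficients.\<close>

lemma bochner_int_bounded_LIMSEQ: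
  fixes f :: "'a \<Rightarrow> 'x::complex_banach"
  assumes f: "bochner_integrable M f" and \<phi> [measurable]: "\<And>n::nat. \<phi> n \<in> borel_measurable M"
    and B: "\<And>n x. x \<in> space M \<Longrightarrow> cmod (\<phi> n x) \<le> B"
    and lim: "\<And>x. x \<in> space M \<Longrightarrow> (\<lambda>n. \<phi> n x) \<longlonglongrightarrow> \<psi> x"
  shows "(\<lambda>n. bochner_int M (\<lambda>x. \<phi> n x *\<^sub>C f x)) \<longlonglongrightarrow> bochner_int M (\<lambda>x. \<psi> x *\<^sub>C f x)"
proof -
  have \<psi> [measurable]: "\<psi> \<in> borel_measurable M" by (rule borel_measurable_LIMSEQ_metric[OF \<phi> lim])
  have \<psi>_B: "cmod (\<psi> x) \<le> B" if "x \<in> space M" for x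
    by (rule LIMSEQ_le_const2[OF tendsto_norm[OF lim[OF that]]]) (use B that in auto)
  have sm: "strongly_measurable M f" and fin: "(\<integral>\<^sup>+x. ennreal (norm (f x)) \<partial>M) < \<infinity>"
    using f unfolding bochner_integrable_def by auto
  note [measurable] = sm[THEN strongly_measurable_imp_borel_measurable]
  have int: "bochner_integrable M (\<lambda>x. \<phi> n x *\<^sub>C f x)" "bochner_integrable M (\<lambda>x. \<psi> x *\<^sub>C f x)" for n
    by (rule bochner_integrable_bounded_scaleC[OF f _ B] bochner_integrable_bounded_scaleC[OF f _ \<psi>_B]; simp)+
  have "(\<lambda>n. \<integral>\<^sup>+x. ennreal (cmod (\<phi> n x - \<psi> x) * norm (f x)) \<partial>M) \<longlonglongrightarrow> (\<integral>\<^sup>+x. 0 \<partial>M)"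
  proof (rule nn_integral_dominated_convergence[where w="\<lambda>x. ennreal (2 * \<bar>B\<bar>) * ennreal (norm (f x))"])
    show "AE x in M. ennreal (cmod (\<phi> n x - \<psi> x) * norm (f x)) \<le> ennreal (2 * \<bar>B\<bar>) * ennreal (norm (f x))" for n
    proof (rule AE_I2)
      fix x assume x: "x \<in> space M"
      have "cmod (\<phi> n x - \<psi> x) \<le> 2 * \<bar>B\<bar>"
        using norm_triangle_ineq4[of "\<phi> n x" "\<psi> x"] B[OF x, of n] \<psi>_B[OF x] by linarith
      then show "ennreal (cmod (\<phi> n x - \<psi> x) * norm (f x)) \<le> ennreal (2 * \<bar>B\<bar>) * ennreal (norm (f x))"
        by (simp add: mult_right_mono flip: ennreal_mult)
    qed
    show "(\<integral>\<^sup>+x. ennreal (2 * \<bar>B\<bar>) * ennreal (norm (f x)) \<partial>M) < \<infinity>"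
      using fin by (simp add: nn_integral_cmult ennreal_mult_less_top)
    show "AE x in M. (\<lambda>n. ennreal (cmod (\<phi> n x - \<psi> x) * norm (f x))) \<longlonglongrightarrow> 0"
    proof (rule AE_I2)
      fix x assume x: "x \<in> space M"
      have "(\<lambda>n. cmod (\<phi> n x - \<psi> x) * norm (f x)) \<longlonglongrightarrow> cmod (\<psi> x - \<psi> x) * norm (f x)"
        by (intro tendsto_intros lim x)
      then show "(\<lambda>n. ennreal (cmod (\<phi> n x - \<psi> x) * norm (f x))) \<longlonglongrightarrow> 0" by (simp flip: ennreal_0)
    qed
  qed auto
  then have lim0: "(\<lambda>n. \<integral>\<^sup>+x. ennreal (cmod (\<phi> n x - \<psi> x) * norm (f x)) \<partial>M) \<longlonglongrightarrow> 0" by simp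
  have "ennreal (norm (bochner_int M (\<lambda>x. \<phi> n x *\<^sub>C f x) - bochner_int M (\<lambda>x. \<psi> x *\<^sub>C f x))) \<le>
      (\<integral>\<^sup>+x. ennreal (cmod (\<phi> n x - \<psi> x) * norm (f x)) \<partial>M)" for n
    using norm_bochner_int_diff_le[OF int, of n]
    by (simp add: norm_scaleC flip: scaleC.diff_left)
  then have "(\<lambda>n. ennreal (norm (bochner_int M (\<lambda>x. \<phi> n x *\<^sub>C f x) - bochner_int M (\<lambda>x. \<psi> x *\<^sub>C f x)))) \<longlonglongrightarrow> 0"
    by (intro tendsto_sandwich[OF _ _ tendsto_const lim0]) auto
  then have "(\<lambda>n. norm (bochner_int M (\<lambda>x. \<phi> n x *\<^sub>C f x) - bochner_int M (\<lambda>x. \<psi> x *\<^sub>C f x))) \<longlonglongrightarrow> 0"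
    by (simp add: tendsto_ennreal_iff[of _ _ 0, simplified] flip: ennreal_0)
  then show ?thesis by (simp add: tendsto_norm_zero_iff LIM_zero_iff)
qed

text \<open>On the set where an approximating simple function \<open>s\<close> takes the value \<open>y\<close>, the integral of
  \<open>f - s\<close> has norm \<open>norm y\<close> times the measure of this set; hence the \<open>L\<^sub>1\<close> norm of \<open>s\<close> is at most
  that of \<open>f - s\<close>.\<close>

lemma AE_zero_if_bochner_int_indicator_zero:
  fixes f :: "'a \<Rightarrow> 'x::complex_banach"
  assumes f: "bochner_integrable M f" and M: "finite_measure M"
    and zero: "\<And>A. A \<in> sets M \<Longrightarrow> bochner_int M (\<lambda>x. indicator A x *\<^sub>C f x) = 0"
  shows "AE x in M. f x = 0"
proof -
  interpret finite_measure M by fact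
  have sm: "strongly_measurable M f" using f unfolding bochner_integrable_def by simp
  note [measurable] = sm[THEN strongly_measurable_imp_borel_measurable]
  obtain s where s: "\<And>i::nat. simple_bochner_integrable M (s i)"
    and lim: "(\<lambda>i. \<integral>\<^sup>+x. ennreal (norm (f x - s i x)) \<partial>M) \<longlonglongrightarrow> 0"
    using bochner_integrable_approx[OF f] by blast
  have s_le: "(\<integral>\<^sup>+x. norm (s i x) \<partial>M) \<le> (\<integral>\<^sup>+x. norm (f x - s i x) \<partial>M)" for i
  proof -
    have sf: "simple_function M (s i)" using s(1) by (auto elim: simple_bochner_integrable.cases)
    have fin: "finite (s i ` space M)" using sf by (rule simple_functionD)
    define A where "A y = s i -` {y} \<inter> space M" for y
    have A [measurable]: "A y \<in> sets M" for y unfolding A_def by (rule simple_functionD[OF sf])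
    note [measurable] = strongly_measurable_diff[OF sm strongly_measurable_simple[OF sf],
        THEN strongly_measurable_imp_borel_measurable]
    \<comment> \<open>The level sets \<open>A y\<close> partition the space, so exactly one summand
      survives at each point.\<close>
    have sum_ind: "(\<Sum>y\<in>s i ` space M. indicator (A y) x * g y) = g (s i x)" if "x \<in> space M"
      for x and g :: "'x \<Rightarrow> ennreal"
    proof -
      have "(\<Sum>y\<in>s i ` space M. indicator (A y) x * g y) = (\<Sum>y\<in>s i ` space M. if y = s i x then g y else 0)"
        by (intro sum.cong refl) (use that in \<open>auto simp: A_def indicator_def\<close>)
      also have "\<dots> = g (s i x)" using fin that by (subst sum.delta) auto
      finally show ?thesis .
    qed
    have A_le: "emeasure M (A y) * norm y \<le> (\<integral>\<^sup>+x. indicator (A y) x * ennreal (norm (f x - s i x)) \<partial>M)" for y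
    proof -
      have int: "integrable M (indicator (A y) :: 'a \<Rightarrow> complex)" by (rule integrable_const_bound[of _ 1]) (auto simp: indicator_def)
      have 1: "bochner_integrable M (\<lambda>x. indicator (A y) x *\<^sub>C f x)"
        by (rule bochner_integrable_bounded_scaleC[OF f, of _ 1]) (auto simp: indicator_def)
      have "ennreal (norm (bochner_int M (\<lambda>x. indicator (A y) x *\<^sub>C f x) - bochner_int M (\<lambda>x. indicator (A y) x *\<^sub>C y)))
          \<le> (\<integral>\<^sup>+x. norm (indicator (A y) x *\<^sub>C f x - indicator (A y) x *\<^sub>C y) \<partial>M)"
        by (intro norm_bochner_int_diff_le 1 bochner_int_scaleC_const int)
      also have "\<dots> = (\<integral>\<^sup>+x. indicator (A y) x * ennreal (norm (f x - s i x)) \<partial>M)"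
        by (intro nn_integral_cong) (auto simp: A_def indicator_def)
      also have "bochner_int M (\<lambda>x. indicator (A y) x *\<^sub>C f x) = 0" by (rule zero) simp
      also have "bochner_int M (\<lambda>x. indicator (A y) x *\<^sub>C y) = complex_of_real (measure M (A y)) *\<^sub>C y"
      proof -
        have "integral\<^sup>L M (\<lambda>x. complex_of_real (indicator (A y) x)) = complex_of_real (measure M (A y))"
          by (subst integral_complex_of_real) simp
        moreover have "(\<lambda>x. complex_of_real (indicator (A y) x)) = indicator (A y)"
          by (auto simp: indicator_def)
        ultimately show ?thesis using int by (simp add: bochner_int_scaleC_const)
      qed
      also have "ennreal (norm (0 - complex_of_real (measure M (A y)) *\<^sub>C y)) = emeasure M (A y) * norm y"
        by (simp add: norm_scaleC emeasure_eq_measure ennreal_mult)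
      finally show ?thesis .
    qed
    have "(\<integral>\<^sup>+x. norm (s i x) \<partial>M) = (\<integral>\<^sup>+x. (\<Sum>y\<in>s i ` space M. indicator (A y) x * ennreal (norm y)) \<partial>M)"
      by (intro nn_integral_cong) (simp add: sum_ind[where g="\<lambda>y. ennreal (norm y)"])
    also have "\<dots> = (\<Sum>y\<in>s i ` space M. emeasure M (A y) * norm y)"
      by (subst nn_integral_sum) (auto simp: nn_integral_multc)
    also have "\<dots> \<le> (\<Sum>y\<in>s i ` space M. \<integral>\<^sup>+x. indicator (A y) x * ennreal (norm (f x - s i x)) \<partial>M)"
      by (intro sum_mono A_le)
    also have "\<dots> = (\<integral>\<^sup>+x. (\<Sum>y\<in>s i ` space M. indicator (A y) x * ennreal (norm (f x - s i x))) \<partial>M)"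
      by (subst nn_integral_sum) auto
    also have "\<dots> = (\<integral>\<^sup>+x. norm (f x - s i x) \<partial>M)"
      by (intro nn_integral_cong) (simp add: sum_ind)
    finally show ?thesis .
  qed
  have "(\<integral>\<^sup>+x. norm (f x) \<partial>M) \<le> (\<integral>\<^sup>+x. norm (f x - s i x) \<partial>M) + (\<integral>\<^sup>+x. norm (f x - s i x) \<partial>M)" for i
  proof -
    have sf: "simple_function M (s i)" using s(1) by (auto elim: simple_bochner_integrable.cases)
    note [measurable] = strongly_measurable_diff[OF sm strongly_measurable_simple[OF sf],
        THEN strongly_measurable_imp_borel_measurable] borel_measurable_simple_function[OF sf]
    have "(\<integral>\<^sup>+x. norm (f x) \<partial>M) \<le> (\<integral>\<^sup>+x. ennreal (norm (f x - s i x)) + ennreal (norm (s i x)) \<partial>M)"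
      by (intro nn_integral_mono) (simp add: norm_triangle_sub add.commute flip: ennreal_plus)
    also have "\<dots> = (\<integral>\<^sup>+x. norm (f x - s i x) \<partial>M) + (\<integral>\<^sup>+x. norm (s i x) \<partial>M)"
      by (rule nn_integral_add) auto
    also have "\<dots> \<le> (\<integral>\<^sup>+x. norm (f x - s i x) \<partial>M) + (\<integral>\<^sup>+x. norm (f x - s i x) \<partial>M)"
      by (intro add_left_mono s_le)
    finally show ?thesis .
  qed
  then have "(\<integral>\<^sup>+x. norm (f x) \<partial>M) \<le> 0 + 0"
    by (intro LIMSEQ_le_const[OF tendsto_add[OF lim lim]]) auto
  then have "AE x in M. ennreal (norm (f x)) = 0"
    by (subst (asm) add_0, subst (asm) le_zero_eq, subst (asm) nn_integral_0_iff_AE) auto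
  then show ?thesis by simp
qed

section \<open>Bounds in \<open>L\<^sub>r\<close>\<close>

text \<open>A bound on the norm without roots and without \<open>enn2real\<close>. Since
  \<open>enn2real\<close> sends infinity to 0, a bound on \<open>Lr_norm\<close> alone says nothing
  about a function outside \<open>Lr_space\<close>.\<close>

definition Lr_le :: "'a measure \<Rightarrow> ennreal \<Rightarrow> real \<Rightarrow> ('a \<Rightarrow> 'b::real_normed_vector) \<Rightarrow> bool" where
  "Lr_le M r K f \<longleftrightarrow>
     (if r = \<infinity> then AE x in M. norm (f x) \<le> K
      else (\<integral>\<^sup>+x. ennreal (norm (f x) powr enn2real r) \<partial>M) \<le> ennreal (K powr enn2real r))"

lemma Lr_leI:
  assumes f: "f \<in> Lr_space M r" and r: "r = \<infinity> \<or> 0 < enn2real r" and K: "Lr_norm M r f \<le> K"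
  shows "Lr_le M r K f"
proof (cases "r = \<infinity>")
  case True
  let ?S = "esssup M (\<lambda>x. ennreal (norm (f x)))"
  have "?S < \<infinity>" "enn2real ?S \<le> K" using f K True unfolding Lr_space_def Lr_norm_def by auto
  then have "?S \<le> ennreal K" by (metis ennreal_enn2real ennreal_leI infinity_ennreal_def)
  have "AE x in M. ennreal (norm (f x)) \<le> ?S" by (rule esssup_AE)
  then have "AE x in M. norm (f x) \<le> K"
  proof eventually_elim
    case (elim x)
    then have "ennreal (norm (f x)) \<le> ennreal K" using \<open>?S \<le> ennreal K\<close> by (rule order_trans)
    moreover have "0 \<le> K" using K unfolding Lr_norm_def True by (auto intro: order_trans[OF enn2real_nonneg])
    ultimately show ?case by simp
  qed
  then show ?thesis unfolding Lr_le_def using True by simp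
next
  case False
  then have r: "0 < enn2real r" using r by simp
  let ?S = "\<integral>\<^sup>+x. ennreal (norm (f x) powr enn2real r) \<partial>M"
  have S: "?S < \<infinity>" "enn2real ?S powr (1 / enn2real r) \<le> K"
    using f K False unfolding Lr_space_def Lr_norm_def by auto
  have "enn2real ?S = (enn2real ?S powr (1 / enn2real r)) powr enn2real r"
    using r by (simp add: powr_powr)
  also have "\<dots> \<le> K powr enn2real r" using S r by (intro powr_mono2) auto
  finally have "?S \<le> ennreal (K powr enn2real r)"
    using S(1) by (metis ennreal_enn2real ennreal_leI infinity_ennreal_def)
  then show ?thesis unfolding Lr_le_def using False by simp
qed

lemma Lr_leD:
  assumes f: "strongly_measurable M f" and r: "r = \<infinity> \<or> 0 < enn2real r" and K: "0 \<le> K"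
    and le: "Lr_le M r K f"
  shows "f \<in> Lr_space M r" "Lr_norm M r f \<le> K"
proof -
  have [measurable]: "f \<in> borel_measurable M" using f by (rule strongly_measurable_imp_borel_measurable)
  have "f \<in> Lr_space M r \<and> Lr_norm M r f \<le> K"
  proof (cases "r = \<infinity>")
    case True
    let ?S = "esssup M (\<lambda>x. ennreal (norm (f x)))"
    have "?S \<le> ennreal K"
      using le True by (intro esssup_I) (auto simp: Lr_le_def ennreal_leI)
    then show ?thesis
      using f K True unfolding Lr_space_def Lr_norm_def
      by (auto intro!: enn2real_leI intro: le_less_trans)
  next
    case False
    then have r: "0 < enn2real r" using r by simp
    let ?S = "\<integral>\<^sup>+x. ennreal (norm (f x) powr enn2real r) \<partial>M"
    have S: "?S \<le> ennreal (K powr enn2real r)" using le False unfolding Lr_le_def by simp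
    then have "enn2real ?S \<le> K powr enn2real r" by (intro enn2real_leI) auto
    then have "enn2real ?S powr (1 / enn2real r) \<le> (K powr enn2real r) powr (1 / enn2real r)"
      using r by (intro powr_mono2) auto
    also have "\<dots> = K" using r K by (simp add: powr_powr)
    finally show ?thesis
      using f S False unfolding Lr_space_def Lr_norm_def by (auto intro: le_less_trans)
  qed
  then show "f \<in> Lr_space M r" "Lr_norm M r f \<le> K" by auto
qed

lemma Lr_norm_nonneg: "0 \<le> Lr_norm M r f"
  unfolding Lr_norm_def by simp

lemma Lr_le_bounded:
  assumes M: "prob_space M" and K: "\<And>x. x \<in> space M \<Longrightarrow> norm (f x) \<le> K"
  shows "Lr_le M r K f"
proof -
  interpret prob_space M by fact
  have "(\<integral>\<^sup>+x. ennreal (norm (f x) powr enn2real r) \<partial>M) \<le> (\<integral>\<^sup>+x. ennreal (K powr enn2real r) \<partial>M)"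
    by (intro nn_integral_mono ennreal_leI powr_mono2 K) auto
  then show ?thesis unfolding Lr_le_def using K by (simp add: emeasure_space_1)
qed

lemma Lr_le_mono:
  assumes "Lr_le M r K f" "0 \<le> K" "K \<le> L"
  shows "Lr_le M r L f"
proof -
  have "ennreal (K powr enn2real r) \<le> ennreal (L powr enn2real r)"
    using assms by (intro ennreal_leI powr_mono2) auto
  then show ?thesis
    using assms unfolding Lr_le_def by (auto elim!: eventually_mono intro: order_trans)
qed

text \<open>This integrates Young's inequality in the form
  \<open>t \<le> t\<^sup>r / (r K\<^sup>r\<^sup>-\<^sup>1) + (1 - 1/r) K\<close>.\<close>

lemma Lr_le_imp_L1_le:
  fixes f :: "'a \<Rightarrow> 'b::real_normed_vector"
  assumes M: "prob_space M" and f: "f \<in> borel_measurable M"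
    and r: "r = \<infinity> \<or> 1 < enn2real r" and K: "0 < K" and le: "Lr_le M r K f"
  shows "(\<integral>\<^sup>+x. ennreal (norm (f x)) \<partial>M) \<le> ennreal K"
proof -
  interpret prob_space M by fact
  note [measurable] = f
  show ?thesis
  proof (cases "r = \<infinity>")
    case True
    then have "(\<integral>\<^sup>+x. ennreal (norm (f x)) \<partial>M) \<le> (\<integral>\<^sup>+x. ennreal K \<partial>M)"
      using le by (intro nn_integral_mono_AE) (auto simp: Lr_le_def ennreal_leI)
    then show ?thesis by (simp add: emeasure_space_1)
  next
    case False
    define q where "q = enn2real r"
    have q: "1 < q" using r False unfolding q_def by simp
    \<comment> \<open>Young's inequality for \<open>t / K\<close> and 1 with the exponents q and
      \<open>q / (q - 1)\<close>, multiplied by K.\<close>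
    have young: "t \<le> t powr q / (q * K powr (q - 1)) + (1 - 1 / q) * K" if "0 \<le> t" for t
    proof -
      let ?s = "q / (q - 1)"
      have "K * (t / K * 1) \<le> K * ((t / K) powr q / q + 1 powr ?s / ?s)"
        using q K that by (intro mult_left_mono Youngs_inequality) (auto simp: field_simps)
      also have "\<dots> = t powr q / (q * K powr (q - 1)) + (1 - 1 / q) * K"
        using q K that by (simp add: powr_divide powr_diff field_simps)
      finally show ?thesis using K by simp
    qed
    let ?c = "1 / (q * K powr (q - 1))"
    have "(\<integral>\<^sup>+x. ennreal (norm (f x)) \<partial>M) \<le>
        (\<integral>\<^sup>+x. ennreal ?c * ennreal (norm (f x) powr q) + ennreal ((1 - 1 / q) * K) \<partial>M)"
    proof (intro nn_integral_mono)
      fix x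
      have "norm (f x) \<le> ?c * norm (f x) powr q + (1 - 1 / q) * K"
        using young[of "norm (f x)"] by simp
      then show "ennreal (norm (f x)) \<le> ennreal ?c * ennreal (norm (f x) powr q) + ennreal ((1 - 1 / q) * K)"
        using q K by (simp flip: ennreal_mult ennreal_plus)
    qed
    also have "\<dots> = ennreal ?c * (\<integral>\<^sup>+x. ennreal (norm (f x) powr q) \<partial>M) + ennreal ((1 - 1 / q) * K)"
      by (subst nn_integral_add) (auto simp: nn_integral_cmult emeasure_space_1)
    also have "\<dots> \<le> ennreal ?c * ennreal (K powr q) + ennreal ((1 - 1 / q) * K)"
      using le False unfolding Lr_le_def q_def by (intro add_mono mult_left_mono) auto
    also have "\<dots> = ennreal (?c * K powr q + (1 - 1 / q) * K)"
      using q K by (simp flip: ennreal_mult ennreal_plus)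
    \<comment> \<open>The first summand contributes \<open>K / q\<close>, so the two terms add up to
      exactly K and the passage to L1 costs no constant.\<close>
    also have "?c * K powr q + (1 - 1 / q) * K = K"
      using q K by (simp add: powr_diff field_simps)
    finally show ?thesis .
  qed
qed

lemma Lr_space_imp_bochner_integrable:
  fixes f :: "'a \<Rightarrow> 'b::real_normed_vector"
  assumes M: "prob_space M" and r: "r = \<infinity> \<or> 1 < enn2real r" and f: "f \<in> Lr_space M r"
  shows "bochner_integrable M f"
proof -
  have sm: "strongly_measurable M f" using f unfolding Lr_space_def by simp
  \<comment> \<open>Adding 1 keeps the bound positive even if the norm is zero.\<close>
  have "Lr_le M r (Lr_norm M r f + 1) f" using f r by (intro Lr_leI) auto
  then have "(\<integral>\<^sup>+x. ennreal (norm (f x)) \<partial>M) \<le> ennreal (Lr_norm M r f + 1)"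
    using sm r Lr_norm_nonneg[of M r f]
    by (intro Lr_le_imp_L1_le[OF M _ r]) (auto intro: strongly_measurable_imp_borel_measurable)
  also have "\<dots> < \<infinity>" by simp
  finally show ?thesis unfolding bochner_integrable_def using sm by simp
qed

lemma Lr_norm_cong_AE:
  assumes "strongly_measurable M f" "strongly_measurable M g" "AE x in M. f x = g x"
  shows "Lr_norm M r f = Lr_norm M r g"
proof -
  note [measurable] = assms(1,2)[THEN strongly_measurable_imp_borel_measurable]
  have "esssup M (\<lambda>x. ennreal (norm (f x))) = esssup M (\<lambda>x. ennreal (norm (g x)))"
    using assms(3) by (intro esssup_AE_cong) auto
  moreover have "(\<integral>\<^sup>+x. ennreal (norm (f x) powr enn2real r) \<partial>M) =
      (\<integral>\<^sup>+x. ennreal (norm (g x) powr enn2real r) \<partial>M)"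
    using assms(3) by (intro nn_integral_cong_AE) auto
  ultimately show ?thesis unfolding Lr_norm_def by simp
qed

text \<open>For a finite exponent this is Fatou's lemma; for the essential supremum the countably
  many exceptional null sets are united.\<close>

lemma Lr_le_LIMSEQ:
  assumes f: "\<And>i::nat. strongly_measurable M (f i)"
    and lim: "AE x in M. (\<lambda>i. f i x) \<longlonglongrightarrow> g x"
    and r: "r = \<infinity> \<or> 0 < enn2real r"
    and le: "\<And>i. Lr_le M r K (f i)"
  shows "Lr_le M r K g"
proof (cases "r = \<infinity>")
  case True
  have "AE x in M. \<forall>i. norm (f i x) \<le> K"
    using le True unfolding AE_all_countable Lr_le_def by simp
  with lim have "AE x in M. norm (g x) \<le> K"
  proof eventually_elim
    case (elim x)
    show ?case by (rule LIMSEQ_le_const2[OF tendsto_norm[OF elim(1)]]) (use elim in auto)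
  qed
  then show ?thesis using True unfolding Lr_le_def by simp
next
  case False
  then have r: "0 < enn2real r" using r by simp
  note [measurable] = f[THEN strongly_measurable_imp_borel_measurable]
  have "(\<integral>\<^sup>+x. ennreal (norm (g x) powr enn2real r) \<partial>M) =
      (\<integral>\<^sup>+x. liminf (\<lambda>i. ennreal (norm (f i x) powr enn2real r)) \<partial>M)"
    using lim
  proof (intro nn_integral_cong_AE, eventually_elim)
    fix x assume "(\<lambda>i. f i x) \<longlonglongrightarrow> g x"
    then have "(\<lambda>i. ennreal (norm (f i x) powr enn2real r)) \<longlonglongrightarrow> ennreal (norm (g x) powr enn2real r)"
      \<comment> \<open>A positive exponent makes the power continuous at 0 as well.\<close>
      using r by (intro tendsto_ennrealI tendsto_powr2 tendsto_norm) auto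
    then show "ennreal (norm (g x) powr enn2real r) = liminf (\<lambda>i. ennreal (norm (f i x) powr enn2real r))"
      by (intro lim_imp_Liminf[symmetric]) auto
  qed
  also have "\<dots> \<le> liminf (\<lambda>i. \<integral>\<^sup>+x. ennreal (norm (f i x) powr enn2real r) \<partial>M)"
    by (rule nn_integral_liminf) auto
  also have "\<dots> \<le> limsup (\<lambda>i. \<integral>\<^sup>+x. ennreal (norm (f i x) powr enn2real r) \<partial>M)"
    by (rule Liminf_le_Limsup) simp
  also have "\<dots> \<le> ennreal (K powr enn2real r)"
    using le False unfolding Lr_le_def by (intro Limsup_bounded) auto
  finally show ?thesis using False unfolding Lr_le_def by simp
qed

text \<open>The sum of the norms of the increments has finite integral, hence is finite almost
  everywhere. At such points the sequence is a telescoping, absolutely convergent series in a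
  complete space. This is the core of the Riesz-Fischer theorem.\<close>

lemma L1_Cauchy_converges_AE:
  fixes f :: "nat \<Rightarrow> 'a \<Rightarrow> 'b::banach"
  assumes f: "\<And>i. strongly_measurable M (f i)"
    and bound: "\<And>i. (\<integral>\<^sup>+x. ennreal (norm (f (Suc i) x - f i x)) \<partial>M) \<le> ennreal (b i)"
    and b: "\<And>i. 0 \<le> b i" "summable b"
  obtains g where "strongly_measurable M g" "AE x in M. (\<lambda>i. f i x) \<longlonglongrightarrow> g x"
proof -
  define S where "S x = (\<Sum>i. ennreal (norm (f (Suc i) x - f i x)))" for x
  have d_meas: "(\<lambda>x. f (Suc i) x - f i x) \<in> borel_measurable M" for i
    by (intro strongly_measurable_imp_borel_measurable strongly_measurable_diff f)
  have nd [measurable]: "(\<lambda>x. ennreal (norm (f (Suc i) x - f i x))) \<in> borel_measurable M" for i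
    using d_meas[of i] by measurable
  have S_meas [measurable]: "S \<in> borel_measurable M" unfolding S_def by measurable
  have "(\<integral>\<^sup>+x. S x \<partial>M) = (\<Sum>i. \<integral>\<^sup>+x. ennreal (norm (f (Suc i) x - f i x)) \<partial>M)"
    unfolding S_def by (rule nn_integral_suminf) measurable
  also have "\<dots> \<le> (\<Sum>i. ennreal (b i))"
    by (intro suminf_le bound) auto
  also have "\<dots> < \<infinity>" using b by (simp add: suminf_ennreal_eq[OF _ summable_sums])
  finally have "AE x in M. S x \<noteq> \<infinity>" by (intro nn_integral_PInf_AE) auto
  \<comment> \<open>Setting everything to 0 where \<open>S\<close> is infinite makes the convergence
    hold at every point, as \<open>strongly_measurable_LIMSEQ\<close> requires.\<close>
  define h where "h i x = (if S x \<noteq> \<infinity> then f i x else 0)" for i x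
  define g where "g x = (if S x \<noteq> \<infinity> then lim (\<lambda>i. f i x) else 0)" for x
  have conv: "(\<lambda>i. f i x) \<longlonglongrightarrow> lim (\<lambda>i. f i x)" if "S x \<noteq> \<infinity>" for x
  proof -
    have "summable (\<lambda>i. norm (f (Suc i) x - f i x))"
      using that unfolding S_def by (intro summable_suminf_not_top) auto
    then have "summable (\<lambda>i. f (Suc i) x - f i x)" by (rule summable_norm_cancel)
    then have "convergent (\<lambda>n. (\<Sum>i<n. f (Suc i) x - f i x) + f 0 x)"
      by (intro convergent_add convergent_const) (simp add: summable_iff_convergent)
    then have "convergent (\<lambda>i. f i x)" by (simp add: sum_lessThan_telescope[of "\<lambda>i. f i x"])
    then show ?thesis by (simp add: convergent_LIMSEQ_iff)
  qed
  have "strongly_measurable M (h i)" for i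
  proof -
    have "simple_function M (\<lambda>x. if S x \<noteq> \<infinity> then 1 else (0::real))"
      by (rule simple_function_If) auto
    then have "strongly_measurable M (\<lambda>x. (if S x \<noteq> \<infinity> then 1 else (0::real)) *\<^sub>R f i x)"
      by (intro strongly_measurable_continuous2[OF strongly_measurable_simple f, where h="(*\<^sub>R)"] tendsto_scaleR)
    moreover have "h i = (\<lambda>x. (if S x \<noteq> \<infinity> then 1 else (0::real)) *\<^sub>R f i x)"
      by (auto simp: h_def)
    ultimately show ?thesis by simp
  qed
  moreover have "(\<lambda>i. h i x) \<longlonglongrightarrow> g x" for x
    using conv[of x] by (auto simp: h_def g_def)
  ultimately have "strongly_measurable M g" by (rule strongly_measurable_LIMSEQ)
  moreover have "AE x in M. (\<lambda>i. f i x) \<longlonglongrightarrow> g x"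
    using \<open>AE x in M. S x \<noteq> \<infinity>\<close> by eventually_elim (use conv in \<open>simp add: g_def\<close>)
  ultimately show thesis by (rule that)
qed

lemma conj_exponent_cases:
  assumes "1 \<le> p" "p \<le> 2"
  shows "conj_exponent p = \<infinity> \<or> 1 < enn2real (conj_exponent p)"
    and "conj_exponent p = \<infinity> \<longleftrightarrow> p = 1"
proof -
  have "1 < p / (p - 1)" if "p \<noteq> 1" using assms that by (simp add: field_simps)
  then show "conj_exponent p = \<infinity> \<or> 1 < enn2real (conj_exponent p)"
    unfolding conj_exponent_def by (auto simp: enn2real_ennreal)
  show "conj_exponent p = \<infinity> \<longleftrightarrow> p = 1" unfolding conj_exponent_def by simp
qed

section \<open>Indicator functions in algebras of bounded functions\<close>

context
  fixes M :: "'a measure" and W :: "('a \<Rightarrow> complex) set"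
  assumes W_const: "\<And>c. (\<lambda>_. c) \<in> W"
    and W_add: "\<And>f g. f \<in> W \<Longrightarrow> g \<in> W \<Longrightarrow> (\<lambda>x. f x + g x) \<in> W"
    and W_mult: "\<And>f g. f \<in> W \<Longrightarrow> g \<in> W \<Longrightarrow> (\<lambda>x. f x * g x) \<in> W"
    and W_lim: "\<And>f g B. (\<And>n::nat. f n \<in> W) \<Longrightarrow> (\<And>n x. x \<in> space M \<Longrightarrow> cmod (f n x) \<le> B) \<Longrightarrow>
      (\<And>x. x \<in> space M \<Longrightarrow> (\<lambda>n. f n x) \<longlonglongrightarrow> g x) \<Longrightarrow> g \<in> W"
begin

lemma bounded_algebra_polynomial:
  assumes u: "(\<lambda>x. complex_of_real (u x)) \<in> W" and g: "real_polynomial_function (g :: real \<Rightarrow> real)"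
  shows "(\<lambda>x. complex_of_real (g (u x))) \<in> W"
  using g
proof induction
  case (linear g)
  then obtain c where "g = (\<lambda>x. x * c)" by (rule real_bounded_linear[THEN iffD1, THEN exE])
  then show ?case using W_mult[OF u W_const[of "complex_of_real c"]] by simp
next
  case (const c) then show ?case by (rule W_const)
next
  case (add f g) then show ?case using W_add[OF add.IH] by simp
next
  case (mult f g) then show ?case using W_mult[OF mult.IH] by simp
qed

text \<open>Weierstrass approximation on \<open>{-B..B}\<close>. The errors are at most 1, so the
  approximants have the common bound \<open>K + 1\<close> that \<open>W_lim\<close> asks
  for.\<close>

lemma bounded_algebra_continuous:
  assumes u: "(\<lambda>x. complex_of_real (u x)) \<in> W" and B: "\<And>x. x \<in> space M \<Longrightarrow> \<bar>u x\<bar> \<le> B"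
    and F: "continuous_on {-B..B} F"
  shows "(\<lambda>x. complex_of_real (F (u x))) \<in> W"
proof -
  have "\<exists>g. real_polynomial_function g \<and> (\<forall>t\<in>{-B..B}. \<bar>F t - g t\<bar> < 1 / real (Suc n))" for n
    by (rule Stone_Weierstrass_real_polynomial_function[OF compact_Icc F, of "1 / real (Suc n)"]) auto
  then obtain g where g: "\<And>n. real_polynomial_function (g n)"
    "\<And>n t. t \<in> {-B..B} \<Longrightarrow> \<bar>F t - g n t\<bar> < 1 / real (Suc n)"
    by metis
  have "bounded (F ` {-B..B})" by (intro compact_imp_bounded compact_continuous_image F compact_Icc)
  then obtain K where K: "\<And>t. t \<in> {-B..B} \<Longrightarrow> \<bar>F t\<bar> \<le> K"
    unfolding bounded_iff by (metis image_eqI real_norm_def)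
  have u_in: "u x \<in> {-B..B}" if "x \<in> space M" for x using B[OF that] by auto
  show ?thesis
  proof (rule W_lim)
    show "(\<lambda>x. complex_of_real (g n (u x))) \<in> W" for n
      by (rule bounded_algebra_polynomial[OF u g(1)])
    show "cmod (complex_of_real (g n (u x))) \<le> K + 1" if "x \<in> space M" for n x
    proof -
      have "1 / real (Suc n) \<le> 1" by simp
      then show ?thesis using g(2)[OF u_in[OF that], of n] K[OF u_in[OF that]] unfolding norm_of_real by linarith
    qed
    show "(\<lambda>n. complex_of_real (g n (u x))) \<longlonglongrightarrow> complex_of_real (F (u x))" if "x \<in> space M" for x
    proof (intro tendsto_of_real)
      have "(\<lambda>n. g n (u x) - F (u x)) \<longlonglongrightarrow> 0"
        by (rule Lim_null_comparison[OF _ LIMSEQ_inverse_real_of_nat])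
           (use g(2)[OF u_in[OF that]] in \<open>auto simp: abs_minus_commute inverse_eq_divide intro!: always_eventually less_imp_le\<close>)
      then show "(\<lambda>n. g n (u x)) \<longlonglongrightarrow> F (u x)" by (simp add: LIM_zero_iff)
    qed
  qed
qed

text \<open>Continuous ramps of slope \<open>n\<close> starting at \<open>c\<close> converge to the
  indicator. The inequality is strict because all ramps vanish at \<open>c\<close>.\<close>

lemma bounded_algebra_indicator_greater:
  assumes u: "(\<lambda>x. complex_of_real (u x)) \<in> W" and B: "\<And>x. x \<in> space M \<Longrightarrow> \<bar>u x\<bar> \<le> B"
  shows "indicator {x\<in>space M. c < u x} \<in> W"
proof (rule W_lim)
  let ?F = "\<lambda>(n::nat) t. min 1 (max 0 (real n * (t - c)))"
  show "(\<lambda>x. complex_of_real (?F n (u x))) \<in> W" for n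
    by (rule bounded_algebra_continuous[OF u B]) (auto intro!: continuous_intros)
  show "cmod (complex_of_real (?F n (u x))) \<le> 1" for n x by simp
  show "(\<lambda>n. complex_of_real (?F n (u x))) \<longlonglongrightarrow> indicator {x\<in>space M. c < u x} x" if x: "x \<in> space M" for x
  proof (cases "c < u x")
    case True
    obtain N where N: "1 / (u x - c) < real N" using reals_Archimedean2 by blast
    have "?F n (u x) = 1" if "N \<le> n" for n
    proof -
      have "1 \<le> real N * (u x - c)" using N True by (simp add: field_simps)
      also have "\<dots> \<le> real n * (u x - c)" using True that by (intro mult_right_mono) auto
      finally show ?thesis by simp
    qed
    then have "\<forall>\<^sub>F n in sequentially. complex_of_real (?F n (u x)) = 1"
      unfolding eventually_sequentially by (intro exI[of _ N]) simp
    then show ?thesis using True x by (simp add: tendsto_eventually)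
  next
    case False
    then have "real n * (u x - c) \<le> 0" for n by (simp add: mult_le_0_iff)
    then have "?F n (u x) = 0" for n by simp
    then show ?thesis using False by simp
  qed
qed

text \<open>Complements come from \<open>1 - indicator A\<close>, intersections from products,
  countable unions from limits of finite unions. It then suffices to place generators of a
  sigma-algebra in this family.\<close>

lemma bounded_algebra_sigma_algebra: "sigma_algebra (space M) {A. A \<subseteq> space M \<and> indicator A \<in> W}"
proof -
  let ?A = "{A. A \<subseteq> space M \<and> indicator A \<in> W}"
  \<comment> \<open>A constant sequence in \<open>W_lim\<close> shows that only the values on
    \<open>space M\<close> matter. This is needed since \<open>1 - indicator A\<close> equals 1
    outside the space, where the indicator of the complement is 0.\<close>
  have W_cong: "g \<in> W" if "f \<in> W" "\<And>x. x \<in> space M \<Longrightarrow> f x = g x" "\<And>x. x \<in> space M \<Longrightarrow> cmod (f x) \<le> B"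
    for f g B
    by (rule W_lim[of "\<lambda>_. f" B g]) (use that in auto)
  have compl: "space M - A \<in> ?A" if "A \<in> ?A" for A
  proof -
    have "(\<lambda>x. 1 + (-1) * indicator A x) \<in> W" using that by (intro W_add W_mult W_const) auto
    then have "indicator (space M - A) \<in> W" by (rule W_cong[where B=1]) (auto simp: indicator_def)
    then show ?thesis by auto
  qed
  have inter: "A \<inter> B \<in> ?A" if "A \<in> ?A" "B \<in> ?A" for A B
  proof -
    have "(\<lambda>x. indicator A x * indicator B x) \<in> W" using that by (intro W_mult) auto
    then show ?thesis using that by (auto simp: indicator_inter_arith[abs_def])
  qed
  have "algebra (space M) ?A"
    unfolding algebra_iff_Int
  proof (intro conjI ballI)
    show "{} \<in> ?A" using W_const[of 0] by (simp add: indicator_def[abs_def])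
  qed (use compl inter in auto)
  then interpret algebra "space M" ?A .
  show ?thesis
  proof
    fix A :: "nat \<Rightarrow> 'a set" assume A: "range A \<subseteq> ?A"
    have "indicator (\<Union>i. A i) \<in> W"
    proof (rule W_lim)
      have "(\<Union>i\<in>{..<n}. A i) \<in> ?A" for n using A by (intro finite_UN) auto
      then show "indicator (\<Union>i\<in>{..<n}. A i) \<in> W" for n by auto
      show "cmod (indicator (\<Union>i\<in>{..<n}. A i) x) \<le> 1" for n x by (auto simp: indicator_def)
      show "(\<lambda>n. indicator (\<Union>i\<in>{..<n}. A i) x) \<longlonglongrightarrow> (indicator (\<Union>i. A i) x :: complex)" for x
        by (rule LIMSEQ_indicator_UN)
    qed
    then show "(\<Union>i. A i) \<in> ?A" using A by auto
  qed
qed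

end

section \<open>Rotation invariance\<close>

abbreviation "circle_space \<equiv> restrict_space borel (sphere (0::complex) 1)"

lemma measurable_cis [measurable]: "cis \<in> measurable lborel circle_space"
  by (intro measurable_restrict_space2) (auto intro!: borel_measurable_continuous_onI continuous_intros)

lemma sets_circle_measure [measurable_cong]: "sets circle_measure = sets circle_space"
  unfolding circle_measure_def by simp

lemma space_circle_measure: "space circle_measure = sphere 0 1"
  unfolding circle_measure_def by (simp add: space_restrict_space)

lemma prob_space_circle_measure: "prob_space circle_measure"
  unfolding circle_measure_def
  by (intro prob_space.prob_space_distr prob_space_uniform_measure) auto

text \<open>The half-open interval contains each point of the circle once, so a shifted interval can
  be reassembled into one period.\<close>

lemma nn_integral_circle_measure:
  assumes [measurable]: "h \<in> borel_measurable circle_space"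
  shows "(\<integral>\<^sup>+z. h z \<partial>circle_measure) =
    (\<integral>\<^sup>+t. h (cis t) * indicator {0..<2 * pi} t \<partial>lborel) / ennreal (2 * pi)"
proof -
  have "(\<integral>\<^sup>+z. h z \<partial>circle_measure) = (\<integral>\<^sup>+t. h (cis t) * indicator {0..2 * pi} t \<partial>lborel) / ennreal (2 * pi)"
    unfolding circle_measure_def by (simp add: nn_integral_distr nn_integral_uniform_measure)
  also have "(\<integral>\<^sup>+t. h (cis t) * indicator {0..2 * pi} t \<partial>lborel) =
      (\<integral>\<^sup>+t. h (cis t) * indicator {0..<2 * pi} t \<partial>lborel)"
    using AE_lborel_singleton[of "2 * pi"]
    by (intro nn_integral_cong_AE) (auto elim!: eventually_mono simp: indicator_def)
  finally show ?thesis .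
qed

text \<open>The shifted interval splits at \<open>T\<close>, and the part beyond \<open>T\<close> is
  moved back by one period.\<close>

lemma nn_integral_period_shift:
  fixes h :: "real \<Rightarrow> ennreal"
  assumes [measurable]: "h \<in> borel_measurable lborel" and per: "\<And>t. h (t + T) = h t" and s: "0 \<le> s" "s \<le> T"
  shows "(\<integral>\<^sup>+t. h (t + s) * indicator {0..<T} t \<partial>lborel) = (\<integral>\<^sup>+t. h t * indicator {0..<T} t \<partial>lborel)"
proof -
  have shift: "(\<integral>\<^sup>+t. g (t + c) \<partial>lborel) = (\<integral>\<^sup>+t. g t \<partial>lborel)"
    if "g \<in> borel_measurable lborel" for g :: "real \<Rightarrow> ennreal" and c
    using nn_integral_real_affine[of g 1 c] that by (simp add: add.commute)
  have "(\<integral>\<^sup>+t. h (t + s) * indicator {0..<T} t \<partial>lborel) =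
      (\<integral>\<^sup>+t. h (t + s) * indicator {s..<s + T} (t + s) \<partial>lborel)"
    by (intro nn_integral_cong) (auto simp: indicator_def)
  also have "\<dots> = (\<integral>\<^sup>+t. h t * indicator {s..<s + T} t \<partial>lborel)"
    by (rule shift) measurable
  also have "\<dots> = (\<integral>\<^sup>+t. h t * indicator {s..<T} t + h t * indicator {T..<s + T} t \<partial>lborel)"
    using s by (intro nn_integral_cong) (auto simp: indicator_def)
  also have "\<dots> = (\<integral>\<^sup>+t. h t * indicator {s..<T} t \<partial>lborel) + (\<integral>\<^sup>+t. h t * indicator {T..<s + T} t \<partial>lborel)"
    by (rule nn_integral_add) auto
  also have "(\<integral>\<^sup>+t. h t * indicator {T..<s + T} t \<partial>lborel) =
      (\<integral>\<^sup>+t. h (t + T) * indicator {T..<s + T} (t + T) \<partial>lborel)"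
    by (rule shift[symmetric]) measurable
  also have "\<dots> = (\<integral>\<^sup>+t. h t * indicator {0..<s} t \<partial>lborel)"
    by (intro nn_integral_cong) (auto simp: indicator_def per)
  also have "(\<integral>\<^sup>+t. h t * indicator {s..<T} t \<partial>lborel) + (\<integral>\<^sup>+t. h t * indicator {0..<s} t \<partial>lborel) =
      (\<integral>\<^sup>+t. h t * indicator {s..<T} t + h t * indicator {0..<s} t \<partial>lborel)"
    by (rule nn_integral_add[symmetric]) auto
  also have "\<dots> = (\<integral>\<^sup>+t. h t * indicator {0..<T} t \<partial>lborel)"
    using s by (intro nn_integral_cong) (auto simp: indicator_def)
  finally show ?thesis .
qed

lemma measurable_circle_mult: "cmod w = 1 \<Longrightarrow> (*) w \<in> measurable circle_space circle_space"
  by (intro measurable_restrict_space2 measurable_restrict_space1)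
     (auto simp: space_restrict_space norm_mult)

text \<open>Multiplication by \<open>w = cis s\<close> shifts the angle by \<open>s\<close>, and
  \<open>indicator A (cis t)\<close> is periodic in \<open>t\<close>.\<close>

lemma distr_circle_measure_mult:
  assumes w: "cmod w = 1"
  shows "distr circle_measure circle_measure ((*) w) = circle_measure"
proof (rule measure_eqI)
  fix A assume "A \<in> sets (distr circle_measure circle_measure ((*) w))"
  then have [measurable]: "A \<in> sets circle_space" by (simp add: sets_circle_measure)
  note [measurable] = measurable_circle_mult[OF w]
  obtain s where s: "0 \<le> s" "s < 2 * pi" "w = cis s"
    using Arg2pi[of w] w by (metis is_Arg_def mult_1 of_real_1 cis_conv_exp)
  have "emeasure (distr circle_measure circle_measure ((*) w)) A =
      (\<integral>\<^sup>+z. indicator A z \<partial>distr circle_measure circle_measure ((*) w))"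
    by (simp add: sets_circle_measure)
  also have "\<dots> = (\<integral>\<^sup>+z. indicator A (w * z) \<partial>circle_measure)"
    by (rule nn_integral_distr) measurable
  also have "\<dots> = (\<integral>\<^sup>+t. indicator A (cis (t + s)) * indicator {0..<2 * pi} t \<partial>lborel) / ennreal (2 * pi)"
    by (subst nn_integral_circle_measure[of "\<lambda>z. indicator A (w * z)"], measurable)
       (simp add: s(3) cis_mult add.commute)
  also have "(\<integral>\<^sup>+t. indicator A (cis (t + s)) * indicator {0..<2 * pi} t \<partial>lborel) =
      (\<integral>\<^sup>+t. indicator A (cis t) * indicator {0..<2 * pi} t \<partial>lborel)"
    by (rule nn_integral_period_shift[where h="\<lambda>t. indicator A (cis t)"])
       (use s in \<open>auto simp: cis_mult[symmetric]\<close>)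
  also have "\<dots> / ennreal (2 * pi) = (\<integral>\<^sup>+z. indicator A z \<partial>circle_measure)"
    by (subst nn_integral_circle_measure) auto
  also have "\<dots> = emeasure circle_measure A" by (simp add: sets_circle_measure)
  finally show "emeasure (distr circle_measure circle_measure ((*) w)) A = emeasure circle_measure A" .
qed simp

section \<open>The product measure on the infinite torus\<close>

lemma product_prob_space_circle: "product_prob_space (\<lambda>_::nat. circle_measure)"
  by (simp add: product_prob_space_def product_sigma_finite_def product_prob_space_axioms_def
      prob_space_circle_measure prob_space_imp_sigma_finite)

lemma prob_space_torus_measure: "prob_space torus_measure"
  unfolding torus_measure_def by (intro prob_space_PiM prob_space_circle_measure)

lemma space_torus_measure: "space torus_measure = {z. \<forall>k. cmod (z k) = 1}"
  unfolding torus_measure_def by (auto simp: space_PiM space_circle_measure PiE_def Pi_def)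

lemma measurable_torus_component_circle: "(\<lambda>z. z k) \<in> measurable torus_measure circle_measure"
  unfolding torus_measure_def by simp

lemma measurable_torus_component [measurable]: "(\<lambda>z. z k) \<in> borel_measurable torus_measure"
proof -
  have "(\<lambda>z. z) \<in> measurable circle_measure borel"
    by (simp add: measurable_cong_sets[OF sets_circle_measure refl] measurable_restrict_space1)
  then show ?thesis by (rule measurable_compose[OF measurable_torus_component_circle])
qed

lemma measurable_torusI:
  assumes "\<And>k. (\<lambda>x. f x k) \<in> borel_measurable M" "\<And>x k. x \<in> space M \<Longrightarrow> cmod (f x k) = 1"
  shows "f \<in> measurable M torus_measure"
proof -
  have "(\<lambda>x. f x k) \<in> measurable M circle_measure" for k
    unfolding measurable_cong_sets[OF refl sets_circle_measure]
    by (intro measurable_restrict_space2) (use assms in auto)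
  then have "(\<lambda>x. \<lambda>k\<in>UNIV. f x k) \<in> measurable M torus_measure"
    unfolding torus_measure_def by (rule measurable_restrict)
  then show ?thesis by (simp add: restrict_UNIV)
qed

lemma measurable_torus_mult:
  assumes "\<And>k. cmod (w k) = 1"
  shows "(\<lambda>z k. w k * z k) \<in> measurable torus_measure torus_measure"
  by (rule measurable_torusI) (auto simp: norm_mult assms space_torus_measure)

text \<open>The product measure is determined by cylinders over finitely many coordinates, and on
  these the rotation acts factor by factor.\<close>

lemma distr_torus_measure_mult:
  assumes w: "\<And>k. cmod (w k) = 1"
  shows "distr torus_measure torus_measure (\<lambda>z k. w k * z k) = torus_measure"
proof -
  interpret product_prob_space "\<lambda>_::nat. circle_measure" UNIV by (rule product_prob_space_circle)
  have "distr torus_measure torus_measure (\<lambda>z k. w k * z k) = (\<Pi>\<^sub>M k\<in>UNIV. circle_measure)"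
  proof (rule PiM_eq)
    show "sets (distr torus_measure torus_measure (\<lambda>z k. w k * z k)) = sets (\<Pi>\<^sub>M k\<in>UNIV. circle_measure)"
      by (simp add: torus_measure_def)
  next
    fix J :: "nat set" and F :: "nat \<Rightarrow> complex set"
    assume J: "finite J" and F: "\<And>j. j \<in> J \<Longrightarrow> F j \<in> sets circle_measure"
    let ?E = "\<lambda>F. prod_emb UNIV (\<lambda>_. circle_measure) J (\<Pi>\<^sub>E j\<in>J. F j)"
    define G where "G j = (*) (w j) -` F j \<inter> space circle_measure" for j
    have m: "(*) (w j) \<in> measurable circle_measure circle_measure" for j
      using measurable_circle_mult[OF w] unfolding measurable_cong_sets[OF sets_circle_measure sets_circle_measure] .
    have G: "G j \<in> sets circle_measure" if "j \<in> J" for j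
      unfolding G_def by (rule measurable_sets[OF m F[OF that]])
    have E_iff: "z \<in> ?E H \<longleftrightarrow> z \<in> space torus_measure \<and> (\<forall>j\<in>J. z j \<in> H j)" for H z
      by (auto simp: prod_emb_def torus_measure_def space_PiM PiE_iff)
    have "?E F \<in> sets torus_measure"
      unfolding torus_measure_def using J F by (intro sets_PiM_I) auto
    then have "emeasure (distr torus_measure torus_measure (\<lambda>z k. w k * z k)) (?E F) =
        emeasure torus_measure ((\<lambda>z k. w k * z k) -` ?E F \<inter> space torus_measure)"
      by (intro emeasure_distr measurable_torus_mult w)
    also have "(\<lambda>z k. w k * z k) -` ?E F \<inter> space torus_measure = ?E G"
      using w by (auto simp: E_iff G_def space_torus_measure space_circle_measure norm_mult)
    also have "emeasure torus_measure (?E G) = (\<Prod>j\<in>J. emeasure circle_measure (G j))"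
      unfolding torus_measure_def using J G by (intro emeasure_PiM_emb) auto
    also have "\<dots> = (\<Prod>j\<in>J. emeasure circle_measure (F j))"
    proof (intro prod.cong refl)
      fix j assume j: "j \<in> J"
      have "emeasure circle_measure (F j) = emeasure (distr circle_measure circle_measure ((*) (w j))) (F j)"
        by (simp add: distr_circle_measure_mult w)
      also have "\<dots> = emeasure circle_measure (G j)"
        unfolding G_def by (rule emeasure_distr[OF m F[OF j]])
      finally show "emeasure circle_measure (G j) = emeasure circle_measure (F j)" by simp
    qed
    finally show "emeasure (distr torus_measure torus_measure (\<lambda>z k. w k * z k)) (?E F) =
        (\<Prod>j\<in>J. emeasure circle_measure (F j))" .
  qed
  then show ?thesis unfolding torus_measure_def .
qed

section \<open>Fourier coefficients on the infinite torus\<close>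

text \<open>Monomials with different supports can be multiplied only over a common index set; the
  additional factors are \<open>z k powi 0 = 1\<close>.\<close>

lemma torus_monom_eq_prod:
  assumes "finite S" "{k. \<alpha> k \<noteq> 0} \<subseteq> S"
  shows "torus_monom z \<alpha> = (\<Prod>k\<in>S. z k powi \<alpha> k)"
  unfolding torus_monom_def by (rule prod.mono_neutral_left) (use assms in auto)

lemma torus_monom_add:
  assumes "\<alpha> \<in> int_exponents" "\<beta> \<in> int_exponents" "\<And>k. z k \<noteq> 0"
  shows "torus_monom z (\<lambda>k. \<alpha> k + \<beta> k) = torus_monom z \<alpha> * torus_monom z \<beta>"
proof -
  let ?S = "{k. \<alpha> k \<noteq> 0} \<union> {k. \<beta> k \<noteq> 0}"
  have "finite ?S" using assms by (simp add: int_exponents_def)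
  then show ?thesis
    using assms(3)
    by (subst (1 2 3) torus_monom_eq_prod[of ?S]) (auto simp: power_int_add prod.distrib)
qed

lemma torus_monom_mult: "torus_monom (\<lambda>k. w k * z k) \<alpha> = torus_monom w \<alpha> * torus_monom z \<alpha>"
  by (simp add: torus_monom_def power_int_mult_distrib prod.distrib)

lemma torus_monom_zero: "torus_monom z (\<lambda>_. 0) = 1"
  by (simp add: torus_monom_def)

lemma measurable_torus_monom [measurable]: "(\<lambda>z. torus_monom z \<alpha>) \<in> borel_measurable torus_measure"
proof -
  have [measurable]: "(\<lambda>z::complex. z powi n) \<in> borel_measurable borel" for n
    unfolding power_int_def by measurable
  show ?thesis unfolding torus_monom_def by measurable
qed

lemma norm_torus_monom: "z \<in> space torus_measure \<Longrightarrow> cmod (torus_monom z \<alpha>) = 1"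
  by (simp add: torus_monom_def space_torus_measure norm_power_int flip: prod_norm)

lemma integrable_torus_monom: "integrable torus_measure (\<lambda>z. torus_monom z \<alpha>)"
proof -
  interpret prob_space torus_measure by (rule prob_space_torus_measure)
  show ?thesis
    by (rule integrable_const_bound[of _ 1]) (auto simp: norm_torus_monom)
qed

text \<open>For \<open>\<alpha> k \<noteq> 0\<close>, rotating the k-th coordinate by \<open>w\<close> multiplies the integral by \<open>w\<close> to the
  power \<open>\<alpha> k\<close>, and \<open>w\<close> can be chosen such that this is \<open>-1\<close>.\<close>

lemma integral_torus_monom:
  assumes "\<alpha> \<in> int_exponents"
  shows "integral\<^sup>L torus_measure (\<lambda>z. torus_monom z \<alpha>) = (if \<alpha> = (\<lambda>_. 0) then 1 else 0)"
proof (cases "\<alpha> = (\<lambda>_. 0)")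
  case True
  interpret prob_space torus_measure by (rule prob_space_torus_measure)
  show ?thesis using True by (simp add: torus_monom_zero prob_space)
next
  case False
  then obtain k where k: "\<alpha> k \<noteq> 0" by auto
  define w where "w j = (if j = k then cis (pi / of_int (\<alpha> k)) else 1)" for j
  have w: "cmod (w j) = 1" for j by (simp add: w_def)
  have "torus_monom w \<alpha> = (\<Prod>j | \<alpha> j \<noteq> 0. if j = k then cis (pi / of_int (\<alpha> k)) powi \<alpha> k else 1)"
    unfolding torus_monom_def by (intro prod.cong) (auto simp: w_def)
  also have "\<dots> = cis (pi / of_int (\<alpha> k)) powi \<alpha> k"
    using assms k by (subst prod.delta) (auto simp: int_exponents_def)
  also have "\<dots> = -1"
    using k by (simp add: cis_power_int)
  finally have w_monom: "torus_monom w \<alpha> = -1" .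
  have "integral\<^sup>L torus_measure (\<lambda>z. torus_monom z \<alpha>) =
      integral\<^sup>L (distr torus_measure torus_measure (\<lambda>z k. w k * z k)) (\<lambda>z. torus_monom z \<alpha>)"
    by (simp add: distr_torus_measure_mult w)
  also have "\<dots> = integral\<^sup>L torus_measure (\<lambda>z. torus_monom (\<lambda>k. w k * z k) \<alpha>)"
    by (intro integral_distr measurable_torus_mult w) simp
  also have "\<dots> = - integral\<^sup>L torus_measure (\<lambda>z. torus_monom z \<alpha>)"
    by (simp add: torus_monom_mult w_monom)
  finally show ?thesis using False by simp
qed

lemma bochner_integrable_torus_monom_scaleC:
  "bochner_integrable torus_measure f \<Longrightarrow> bochner_integrable torus_measure (\<lambda>z. torus_monom z \<alpha> *\<^sub>C f z)"
  by (rule bochner_integrable_bounded_scaleC[where B=1]) (auto simp: norm_torus_monom)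

text \<open>Monomials have modulus 1 on the torus, so each coefficient is a contraction from L1 to
  \<open>X\<close> and passes to L1 limits.\<close>

lemma norm_fourier_coeff_diff_le:
  assumes "bochner_integrable torus_measure f" "bochner_integrable torus_measure g"
  shows "ennreal (norm (fourier_coeff f \<alpha> - fourier_coeff g \<alpha>)) \<le> (\<integral>\<^sup>+z. ennreal (norm (f z - g z)) \<partial>torus_measure)"
proof -
  have "ennreal (norm (fourier_coeff f \<alpha> - fourier_coeff g \<alpha>)) \<le>
     (\<integral>\<^sup>+z. ennreal (norm (torus_monom z (\<lambda>k. - \<alpha> k) *\<^sub>C f z - torus_monom z (\<lambda>k. - \<alpha> k) *\<^sub>C g z)) \<partial>torus_measure)"
    unfolding fourier_coeff_def
    by (intro norm_bochner_int_diff_le bochner_integrable_torus_monom_scaleC assms)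
  also have "\<dots> = (\<integral>\<^sup>+z. ennreal (norm (f z - g z)) \<partial>torus_measure)"
    by (intro nn_integral_cong) (simp add: norm_scaleC norm_torus_monom flip: scaleC.diff_right)
  finally show ?thesis .
qed

lemma fourier_coeff_diff:
  assumes "bochner_integrable torus_measure f" "bochner_integrable torus_measure g"
  shows "fourier_coeff (\<lambda>z. f z - g z) \<alpha> = fourier_coeff f \<alpha> - fourier_coeff g \<alpha>"
  unfolding fourier_coeff_def scaleC.diff_right
  by (intro bochner_int_diff bochner_integrable_torus_monom_scaleC assms)

text \<open>The hypothesis places the constant 1 in \<open>V\<close>, but \<open>V\<close> is not
  visibly closed under products. Its multipliers \<open>W\<close> are, and they contain the
  monomials because membership in \<open>V\<close> tests all monomials at once. An indicator in
  \<open>W\<close>, applied to the constant 1, then gives a vanishing integral of \<open>f\<close>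
  over the set.\<close>

theorem AE_zero_if_fourier_coeff_zero:
  fixes f :: "(nat \<Rightarrow> complex) \<Rightarrow> 'x::complex_banach"
  assumes f: "bochner_integrable torus_measure f"
    and zero: "\<And>\<alpha>. \<alpha> \<in> int_exponents \<Longrightarrow> fourier_coeff f \<alpha> = 0"
  shows "AE z in torus_measure. f z = 0"
proof -
  let ?T = torus_measure
  define bdd where "bdd \<phi> \<longleftrightarrow> \<phi> \<in> borel_measurable ?T \<and> (\<exists>B. \<forall>z\<in>space ?T. cmod (\<phi> z) \<le> B)"
    for \<phi> :: "(nat \<Rightarrow> complex) \<Rightarrow> complex"
  have bddI: "bdd \<phi>" if "\<phi> \<in> borel_measurable ?T" "\<And>z. z \<in> space ?T \<Longrightarrow> cmod (\<phi> z) \<le> B" for \<phi> B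
    using that unfolding bdd_def by blast
  have bddE: "\<exists>B. 0 \<le> B \<and> (\<forall>z\<in>space ?T. cmod (\<phi> z) \<le> B)" if "bdd \<phi>" for \<phi>
  proof -
    obtain B where "\<forall>z\<in>space ?T. cmod (\<phi> z) \<le> B" using \<open>bdd \<phi>\<close> unfolding bdd_def by blast
    then show ?thesis by (intro exI[of _ "\<bar>B\<bar>"]) force
  qed
  have bdd_meas: "\<phi> \<in> borel_measurable ?T" if "bdd \<phi>" for \<phi> using that unfolding bdd_def by simp
  have bdd_add: "bdd (\<lambda>z. \<phi> z + \<psi> z)" if bd: "bdd \<phi>" "bdd \<psi>" for \<phi> \<psi>
  proof -
    obtain A B where "\<forall>z\<in>space ?T. cmod (\<phi> z) \<le> A" "\<forall>z\<in>space ?T. cmod (\<psi> z) \<le> B"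
      using bd[THEN bddE] by blast
    then show ?thesis
      using bd[THEN bdd_meas] by (intro bddI[where B="A + B"]) (auto intro!: norm_triangle_mono)
  qed
  have bdd_mult: "bdd (\<lambda>z. \<phi> z * \<psi> z)" if bd: "bdd \<phi>" "bdd \<psi>" for \<phi> \<psi>
  proof -
    obtain A B where "0 \<le> A" "\<forall>z\<in>space ?T. cmod (\<phi> z) \<le> A" "\<forall>z\<in>space ?T. cmod (\<psi> z) \<le> B"
      using bd[THEN bddE] by blast
    then show ?thesis
      using bd[THEN bdd_meas] by (intro bddI[where B="A * B"]) (auto simp: norm_mult intro!: mult_mono)
  qed
  have bdd_monom: "bdd (\<lambda>z. torus_monom z \<alpha>)" for \<alpha>
    by (rule bddI[where B=1]) (auto simp: norm_torus_monom)
  have int: "bochner_integrable ?T (\<lambda>z. \<phi> z *\<^sub>C f z)" if "bdd \<phi>" for \<phi>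
    using that bochner_integrable_bounded_scaleC[OF f] unfolding bdd_def by blast
  define V where "V = {\<phi>. bdd \<phi> \<and>
    (\<forall>\<alpha>\<in>int_exponents. bochner_int ?T (\<lambda>z. (\<phi> z * torus_monom z \<alpha>) *\<^sub>C f z) = 0)}"
  define W where "W = {\<psi>. bdd \<psi> \<and> (\<forall>\<phi>\<in>V. (\<lambda>z. \<phi> z * \<psi> z) \<in> V)}"
  have one_V: "(\<lambda>_. 1) \<in> V"
  proof -
    have "bochner_int ?T (\<lambda>z. torus_monom z \<alpha> *\<^sub>C f z) = 0" if "\<alpha> \<in> int_exponents" for \<alpha>
      \<comment> \<open>A Fourier coefficient integrates against the inverse monomial, hence the
        sign.\<close>
      using zero[of "\<lambda>k. - \<alpha> k"] that unfolding fourier_coeff_def by (simp add: int_exponents_def)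
    then show ?thesis unfolding V_def by (auto intro: bddI[where B=1])
  qed
  have W_const: "(\<lambda>_. c) \<in> W" for c
  proof -
    have "bdd (\<lambda>_. c)" by (rule bddI[where B="cmod c"]) auto
    moreover have "bochner_int ?T (\<lambda>z. (\<phi> z * c * torus_monom z \<alpha>) *\<^sub>C f z) = 0"
      if "\<phi> \<in> V" "\<alpha> \<in> int_exponents" for \<phi> \<alpha>
    proof -
      have "bochner_int ?T (\<lambda>z. c *\<^sub>C ((\<phi> z * torus_monom z \<alpha>) *\<^sub>C f z)) = c *\<^sub>C 0"
        using that bochner_int_bounded_linear[OF scaleC.bounded_linear_right int[OF bdd_mult[OF _ bdd_monom]]]
        unfolding V_def by auto
      then show ?thesis by (simp add: scaleC_scaleC mult_ac)
    qed
    ultimately show ?thesis unfolding W_def V_def by (auto intro: bdd_mult)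
  qed
  have V_add: "(\<lambda>z. \<phi> z + \<psi> z) \<in> V" if "\<phi> \<in> V" "\<psi> \<in> V" for \<phi> \<psi>
  proof -
    have "bochner_int ?T (\<lambda>z. ((\<phi> z + \<psi> z) * torus_monom z \<alpha>) *\<^sub>C f z) = 0" if \<alpha>: "\<alpha> \<in> int_exponents" for \<alpha>
      using \<open>\<phi> \<in> V\<close> \<open>\<psi> \<in> V\<close> \<alpha> bochner_int_add[OF int[OF bdd_mult[OF _ bdd_monom]] int[OF bdd_mult[OF _ bdd_monom]], of \<phi> \<psi> \<alpha> \<alpha>]
      unfolding V_def by (simp add: distrib_right scaleC.add_left)
    then show ?thesis using that unfolding V_def by (auto intro: bdd_add)
  qed
  have W_add: "(\<lambda>z. \<phi> z + \<psi> z) \<in> W" if "\<phi> \<in> W" "\<psi> \<in> W" for \<phi> \<psi>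
  proof -
    have "(\<lambda>z. \<eta> z * (\<phi> z + \<psi> z)) \<in> V" if "\<eta> \<in> V" for \<eta>
      using V_add[of "\<lambda>z. \<eta> z * \<phi> z" "\<lambda>z. \<eta> z * \<psi> z"] \<open>\<phi> \<in> W\<close> \<open>\<psi> \<in> W\<close> that
      unfolding W_def by (simp add: distrib_left)
    then show ?thesis using that unfolding W_def by (auto intro: bdd_add)
  qed
  have W_mult: "(\<lambda>z. \<phi> z * \<psi> z) \<in> W" if "\<phi> \<in> W" "\<psi> \<in> W" for \<phi> \<psi>
    using that unfolding W_def by (auto intro: bdd_mult simp flip: mult.assoc)
  have W_lim: "\<psi> \<in> W" if \<phi>: "\<And>n::nat. \<phi> n \<in> W"
    and B: "\<And>n z. z \<in> space ?T \<Longrightarrow> cmod (\<phi> n z) \<le> B"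
    and lim: "\<And>z. z \<in> space ?T \<Longrightarrow> (\<lambda>n. \<phi> n z) \<longlonglongrightarrow> \<psi> z" for \<phi> \<psi> B
  proof -
    have m: "\<phi> n \<in> borel_measurable ?T" for n using \<phi> bdd_meas unfolding W_def by auto
    have \<psi>_bdd: "bdd \<psi>"
    proof (rule bddI)
      show "\<psi> \<in> borel_measurable ?T" by (rule borel_measurable_LIMSEQ_metric[OF m lim])
      show "cmod (\<psi> z) \<le> B" if "z \<in> space ?T" for z
        by (rule LIMSEQ_le_const2[OF tendsto_norm[OF lim[OF that]]]) (use B that in auto)
    qed
    have "bochner_int ?T (\<lambda>z. (\<eta> z * \<psi> z * torus_monom z \<alpha>) *\<^sub>C f z) = 0"
      if \<eta>: "\<eta> \<in> V" and \<alpha>: "\<alpha> \<in> int_exponents" for \<eta> \<alpha>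
    proof -
      have \<eta>_bdd: "bdd \<eta>" using \<eta> unfolding V_def by simp
      note [measurable] = bdd_meas[OF \<eta>_bdd] m
      have "(\<lambda>n. bochner_int ?T (\<lambda>z. \<phi> n z *\<^sub>C ((\<eta> z * torus_monom z \<alpha>) *\<^sub>C f z))) \<longlonglongrightarrow>
          bochner_int ?T (\<lambda>z. \<psi> z *\<^sub>C ((\<eta> z * torus_monom z \<alpha>) *\<^sub>C f z))"
        by (rule bochner_int_bounded_LIMSEQ[OF int[OF bdd_mult[OF \<eta>_bdd bdd_monom]] m B lim])
      moreover have "bochner_int ?T (\<lambda>z. \<phi> n z *\<^sub>C ((\<eta> z * torus_monom z \<alpha>) *\<^sub>C f z)) = 0" for n
        using \<phi>[of n] \<eta> \<alpha> unfolding W_def V_def by (auto simp: scaleC_scaleC mult_ac)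
      ultimately show ?thesis by (simp add: scaleC_scaleC mult_ac LIMSEQ_const_iff)
    qed
    then show ?thesis using \<psi>_bdd unfolding W_def V_def by (auto intro: bdd_mult)
  qed
  have W_cong: "\<psi> \<in> W" if \<phi>: "\<phi> \<in> W" and eq: "\<And>z. z \<in> space ?T \<Longrightarrow> \<phi> z = \<psi> z" for \<phi> \<psi>
  proof -
    have "bdd \<phi>" using \<phi> unfolding W_def by simp
    then obtain B where B: "\<forall>z\<in>space ?T. cmod (\<phi> z) \<le> B" using bddE by blast
    show ?thesis
    proof (rule W_lim)
      show "(\<lambda>n. \<phi> z) \<longlonglongrightarrow> \<psi> z" if "z \<in> space ?T" for z by (simp add: eq[OF that])
    qed (use \<phi> B in auto)
  qed
  have W_monom: "(\<lambda>z. torus_monom z \<beta>) \<in> W" if \<beta>: "\<beta> \<in> int_exponents" for \<beta>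
  proof -
    have "bochner_int ?T (\<lambda>z. (\<phi> z * torus_monom z \<beta> * torus_monom z \<alpha>) *\<^sub>C f z) = 0"
      if \<phi>: "\<phi> \<in> V" and \<alpha>: "\<alpha> \<in> int_exponents" for \<phi> \<alpha>
    proof -
      have "{k. \<beta> k + \<alpha> k \<noteq> 0} \<subseteq> {k. \<beta> k \<noteq> 0} \<union> {k. \<alpha> k \<noteq> 0}" by auto
      then have "(\<lambda>k. \<beta> k + \<alpha> k) \<in> int_exponents"
        using \<alpha> \<beta> unfolding int_exponents_def by (auto intro: finite_subset)
      then have "bochner_int ?T (\<lambda>z. (\<phi> z * torus_monom z (\<lambda>k. \<beta> k + \<alpha> k)) *\<^sub>C f z) = 0"
        using \<phi> unfolding V_def by simp
      also have "bochner_int ?T (\<lambda>z. (\<phi> z * torus_monom z (\<lambda>k. \<beta> k + \<alpha> k)) *\<^sub>C f z) =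
          bochner_int ?T (\<lambda>z. (\<phi> z * torus_monom z \<beta> * torus_monom z \<alpha>) *\<^sub>C f z)"
      proof (rule bochner_int_cong)
        fix z assume "z \<in> space ?T"
        then have "z k \<noteq> 0" for k by (auto simp: space_torus_measure dest: spec[of _ k])
        then show "(\<phi> z * torus_monom z (\<lambda>k. \<beta> k + \<alpha> k)) *\<^sub>C f z = (\<phi> z * torus_monom z \<beta> * torus_monom z \<alpha>) *\<^sub>C f z"
          by (simp add: torus_monom_add[OF \<beta> \<alpha>] mult.assoc)
      qed
      finally show ?thesis .
    qed
    then show ?thesis using bdd_monom unfolding W_def V_def by (auto intro: bdd_mult)
  qed
  have z_eq: "torus_monom z (\<lambda>j. if j = k then n else 0) = z k powi n" if "n \<noteq> 0" for z k n
    using that by (simp add: torus_monom_def)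
  have coord: "(\<lambda>z. z k) \<in> W" "(\<lambda>z. inverse (z k)) \<in> W" for k
    using W_monom[of "\<lambda>j. if j = k then 1 else 0"] W_monom[of "\<lambda>j. if j = k then -1 else 0"]
    by (simp_all add: z_eq int_exponents_def power_int_minus)
  \<comment> \<open>On the torus the inverse of a coordinate is its conjugate, so the real and
    imaginary parts of a coordinate are combinations of elements of \<open>W\<close>.\<close>
  have inv: "inverse (z k) = cnj (z k)" if "z \<in> space ?T" for z k
  proof (rule inverse_unique)
    show "z k * cnj (z k) = 1" using that complex_norm_square[of "z k"] by (simp add: space_torus_measure)
  qed
  have Re_W: "(\<lambda>z. complex_of_real (Re (z k))) \<in> W" for k
  proof (rule W_cong)
    show "(\<lambda>z. (1 / 2) * (z k + inverse (z k))) \<in> W" by (intro W_mult W_add W_const coord)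
    show "(1 / 2) * (z k + inverse (z k)) = complex_of_real (Re (z k))" if "z \<in> space ?T" for z
      unfolding inv[OF that] by (simp add: complex_add_cnj)
  qed
  have Im_W: "(\<lambda>z. complex_of_real (Im (z k))) \<in> W" for k
  proof (rule W_cong)
    show "(\<lambda>z. (- \<i> / 2) * (z k + (-1) * inverse (z k))) \<in> W" by (intro W_mult W_add W_const coord)
    show "(- \<i> / 2) * (z k + (-1) * inverse (z k)) = complex_of_real (Im (z k))" if "z \<in> space ?T" for z
      unfolding inv[OF that] by (simp add: complex_eq_iff)
  qed
  let ?A = "{A. A \<subseteq> space ?T \<and> indicator A \<in> W}"
  interpret sigma_algebra "space ?T" ?A
    by (rule bounded_algebra_sigma_algebra[OF W_const W_add W_mult W_lim])
  \<comment> \<open>The sets with indicator in \<open>W\<close>, made into a measure space with the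
    zero measure as a placeholder, so that Borel measurability of the coordinates can be
    expressed.\<close>
  define N where "N = measure_of (space ?T) ?A (\<lambda>_. 0)"
  have space_N: "space N = space ?T" and sets_N: "sets N = ?A"
    unfolding N_def by (simp_all add: space_measure_of_conv sets_measure_of_eq)
  have ind: "indicator {z\<in>space ?T. c < u z} \<in> W"
    if "(\<lambda>z. complex_of_real (u z)) \<in> W" "\<And>z. z \<in> space ?T \<Longrightarrow> \<bar>u z\<bar> \<le> 1" for u c
    by (rule bounded_algebra_indicator_greater[OF W_const W_add W_mult W_lim that])
  have "\<bar>Re (z k)\<bar> \<le> 1" "\<bar>Im (z k)\<bar> \<le> 1" if "z \<in> space ?T" for z k
    using that abs_Re_le_cmod[of "z k"] abs_Im_le_cmod[of "z k"] by (simp_all add: space_torus_measure)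
  then have "indicator {z\<in>space ?T. c < Re (z k)} \<in> W" "indicator {z\<in>space ?T. c < Im (z k)} \<in> W" for c k
    by (intro ind Re_W Im_W; simp)+
  then have "(\<lambda>z. Re (z k)) \<in> borel_measurable N" "(\<lambda>z. Im (z k)) \<in> borel_measurable N" for k
    by (auto simp: borel_measurable_iff_greater space_N sets_N)
  then have coord_N: "(\<lambda>z. z k) \<in> borel_measurable N" for k
    by (simp add: borel_measurable_complex_iff)
  \<comment> \<open>Preimages under single coordinates generate the product sigma-algebra, so
    measurability of the coordinates with respect to \<open>N\<close> suffices.\<close>
  have sub: "sets ?T \<subseteq> ?A"
    unfolding torus_measure_def sets_PiM_single
    unfolding space_PiM[symmetric] torus_measure_def[symmetric]
  proof (rule sigma_sets_subset, safe)
    fix k and X assume "X \<in> sets circle_measure"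
    then obtain Y where Y: "Y \<in> sets borel" "X = sphere 0 1 \<inter> Y"
      by (auto simp: sets_circle_measure sets_restrict_space)
    have "(\<lambda>z. z k) -` Y \<inter> space N \<in> sets N" by (rule measurable_sets[OF coord_N Y(1)])
    also have "(\<lambda>z. z k) -` Y \<inter> space N = {z \<in> space ?T. z k \<in> X}"
      using Y(2) by (auto simp: space_N space_torus_measure)
    finally show "indicator {z \<in> space ?T. z k \<in> X} \<in> W" by (simp add: sets_N)
  qed
  have "bochner_int ?T (\<lambda>z. indicator A z *\<^sub>C f z) = 0" if "A \<in> sets ?T" for A
  proof -
    have "indicator A \<in> W" using that sub by auto
    then have "(\<lambda>z. 1 * indicator A z) \<in> V" using one_V unfolding W_def by (simp only: mem_Collect_eq)
    then have "\<forall>\<alpha>\<in>int_exponents. bochner_int ?T (\<lambda>z. (indicator A z * torus_monom z \<alpha>) *\<^sub>C f z) = 0"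
      unfolding V_def by simp
    from this[THEN bspec, of "\<lambda>_. 0"] show ?thesis by (simp add: int_exponents_def torus_monom_zero)
  qed
  then show ?thesis
    using prob_space_torus_measure
    by (intro AE_zero_if_bochner_int_indicator_zero[OF f]) (simp_all add: prob_space_def)
qed

section \<open>Trigonometric polynomials\<close>

definition torus_poly ::
    "(nat \<Rightarrow> int) set \<Rightarrow> ((nat \<Rightarrow> int) \<Rightarrow> 'x::complex_banach) \<Rightarrow> (nat \<Rightarrow> complex) \<Rightarrow> 'x" where
  "torus_poly F x z = (\<Sum>\<alpha>\<in>F. torus_monom z \<alpha> *\<^sub>C x \<alpha>)"

lemma bochner_integrable_torus_poly: "bochner_integrable torus_measure (torus_poly F x)"
  unfolding torus_poly_def
  by (intro bochner_integrable_sum bochner_int_scaleC_const integrable_torus_monom)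

lemma strongly_measurable_torus_poly: "strongly_measurable torus_measure (torus_poly F x)"
  using bochner_integrable_torus_poly unfolding bochner_integrable_def by blast

lemma norm_torus_poly_le: "z \<in> space torus_measure \<Longrightarrow> norm (torus_poly F x z) \<le> (\<Sum>\<alpha>\<in>F. norm (x \<alpha>))"
  unfolding torus_poly_def by (rule sum_norm_le) (simp add: norm_scaleC norm_torus_monom)

lemma torus_poly_diff:
  "finite G \<Longrightarrow> F \<subseteq> G \<Longrightarrow> torus_poly G x z - torus_poly F x z = torus_poly (G - F) x z"
  unfolding torus_poly_def by (simp add: sum_diff)

text \<open>Orthogonality of the monomials: only the term whose exponent difference is zero has a
  nonzero integral.\<close>

lemma fourier_coeff_torus_poly:
  assumes F: "finite F" "F \<subseteq> int_exponents" and \<beta>: "\<beta> \<in> int_exponents"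
  shows "fourier_coeff (torus_poly F x) \<beta> = (if \<beta> \<in> F then x \<beta> else 0)"
proof -
  have exp: "(\<lambda>k. \<alpha> k - \<beta> k) \<in> int_exponents" if "\<alpha> \<in> F" for \<alpha>
  proof -
    have "{k. \<alpha> k - \<beta> k \<noteq> 0} \<subseteq> {k. \<alpha> k \<noteq> 0} \<union> {k. \<beta> k \<noteq> 0}" by auto
    then show ?thesis using F(2) \<beta> that unfolding int_exponents_def by (auto intro: finite_subset)
  qed
  have "fourier_coeff (torus_poly F x) \<beta> =
      bochner_int torus_measure (\<lambda>z. \<Sum>\<alpha>\<in>F. torus_monom z (\<lambda>k. \<alpha> k - \<beta> k) *\<^sub>C x \<alpha>)"
    unfolding fourier_coeff_def
  proof (rule bochner_int_cong)
    fix z assume "z \<in> space torus_measure"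
    then have z: "z k \<noteq> 0" for k by (auto simp: space_torus_measure dest: spec[of _ k])
    have "torus_monom z (\<lambda>k. \<alpha> k - \<beta> k) = torus_monom z (\<lambda>k. - \<beta> k) * torus_monom z \<alpha>" if "\<alpha> \<in> F" for \<alpha>
      using torus_monom_add[of "\<lambda>k. - \<beta> k" \<alpha> z] F(2) \<beta> z that by (auto simp: int_exponents_def)
    then show "torus_monom z (\<lambda>k. - \<beta> k) *\<^sub>C torus_poly F x z =
        (\<Sum>\<alpha>\<in>F. torus_monom z (\<lambda>k. \<alpha> k - \<beta> k) *\<^sub>C x \<alpha>)"
      unfolding torus_poly_def scaleC.sum_right by (intro sum.cong) (auto simp: scaleC_scaleC)
  qed
  also have "\<dots> = (\<Sum>\<alpha>\<in>F. integral\<^sup>L torus_measure (\<lambda>z. torus_monom z (\<lambda>k. \<alpha> k - \<beta> k)) *\<^sub>C x \<alpha>)"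
    by (simp add: bochner_int_sum bochner_int_scaleC_const integrable_torus_monom)
  also have "\<dots> = (\<Sum>\<alpha>\<in>F. if \<alpha> = \<beta> then x \<alpha> else 0)"
    by (intro sum.cong) (auto simp: integral_torus_monom exp fun_eq_iff)
  also have "\<dots> = (if \<beta> \<in> F then x \<beta> else 0)" using F(1) by simp
  finally show ?thesis .
qed

section \<open>From Fourier type to polynomials on the torus\<close>

lemma measurable_circle_ident: "(\<lambda>w. w) \<in> borel_measurable circle_measure"
  unfolding measurable_cong_sets[OF sets_circle_measure refl] by (intro measurable_restrict_space1) simp

lemma strongly_measurable_circle_poly:
  "strongly_measurable circle_measure (\<lambda>w. \<Sum>i\<in>F. w ^ e i *\<^sub>C (v i :: 'x::complex_banach))"
proof -
  note [measurable] = measurable_circle_ident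
  have "(\<lambda>w. w ^ n) \<in> borel_measurable circle_measure" for n by measurable
  then show ?thesis
    by (intro strongly_measurable_sum strongly_measurable_scaleC strongly_measurable_const
        borel_measurable_imp_strongly_measurable)
qed

text \<open>Fourier type speaks of all powers from 1 to N. Powers that are not attained by
  \<open>e\<close> receive the coefficient 0, which changes neither side, so any injective choice of
  positive exponents is admissible.\<close>

lemma fourier_type_sum:
  fixes v :: "'i \<Rightarrow> 'x::complex_banach"
  assumes ft: "fourier_type TYPE('x) p C" and F: "finite F" and e: "inj_on e F" "\<And>i. i \<in> F \<Longrightarrow> 1 \<le> e i"
    and r: "conj_exponent p = \<infinity> \<or> 0 < enn2real (conj_exponent p)"
  shows "Lr_le circle_measure (conj_exponent p) (C * (\<Sum>i\<in>F. norm (v i) powr p) powr (1 / p))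
    (\<lambda>w. \<Sum>i\<in>F. w ^ e i *\<^sub>C v i)"
proof -
  let ?r = "conj_exponent p"
  define N where "N = Max (insert 0 (e ` F))"
  define y where "y k = (if k \<in> e ` F then v (inv_into F e k) else 0)" for k
  have sub: "e ` F \<subseteq> {1..N}" unfolding N_def using F e(2) by auto
  have reindex: "(\<Sum>k=1..N. h k (y k)) = (\<Sum>i\<in>F. h (e i) (v i))" if "\<And>k. h k 0 = 0"
    for h :: "nat \<Rightarrow> 'x \<Rightarrow> 'c::comm_monoid_add"
  proof -
    have "(\<Sum>k=1..N. h k (y k)) = (\<Sum>k\<in>e ` F. h k (y k))"
      using sub that by (intro sum.mono_neutral_right) (auto simp: y_def)
    also have "\<dots> = (\<Sum>i\<in>F. h (e i) (v i))"
      using e(1) by (subst sum.reindex) (auto simp: y_def intro!: sum.cong)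
    finally show ?thesis .
  qed
  have "Lr_norm circle_measure ?r (\<lambda>z. \<Sum>k=1..N. z ^ k *\<^sub>C y k) \<le> C * (\<Sum>k=1..N. norm (y k) powr p) powr (1 / p)"
    using ft unfolding fourier_type_def by blast
  then have le: "Lr_norm circle_measure ?r (\<lambda>w. \<Sum>i\<in>F. w ^ e i *\<^sub>C v i) \<le> C * (\<Sum>i\<in>F. norm (v i) powr p) powr (1 / p)"
    using reindex[of "\<lambda>k y. _ ^ k *\<^sub>C y"] reindex[of "\<lambda>k y. norm y powr p"] by simp
  have "norm (\<Sum>i\<in>F. w ^ e i *\<^sub>C v i) \<le> (\<Sum>i\<in>F. norm (v i))" if "w \<in> space circle_measure" for w
    using that by (intro sum_norm_le) (simp add: norm_scaleC space_circle_measure norm_power)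
  then have "Lr_le circle_measure ?r (\<Sum>i\<in>F. norm (v i)) (\<lambda>w. \<Sum>i\<in>F. w ^ e i *\<^sub>C v i)"
    by (rule Lr_le_bounded[OF prob_space_circle_measure])
  then have "(\<lambda>w. \<Sum>i\<in>F. w ^ e i *\<^sub>C v i) \<in> Lr_space circle_measure ?r"
    by (rule Lr_leD(1)[OF strongly_measurable_circle_poly r, rotated]) (simp add: sum_nonneg)
  then show ?thesis using r le by (rule Lr_leI)
qed

text \<open>Two exponents have the same value \<open>\<Sum>\<^sub>k \<alpha>\<^sub>k b\<^sup>k\<close> only if \<open>b\<close> is a root of the polynomial with the
  coefficients \<open>\<alpha>\<^sub>k - \<beta>\<^sub>k\<close>, which excludes finitely many \<open>b\<close> only.\<close>

lemma nat_exponents_injective_weight: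
  assumes "finite F" "F \<subseteq> nat_exponents"
  obtains b :: nat where "inj_on (\<lambda>\<alpha>. \<Sum>k | \<alpha> k \<noteq> 0. nat (\<alpha> k) * b ^ k) F"
proof -
  define S where "S = (\<Union>\<alpha>\<in>F. {k. \<alpha> k \<noteq> 0})"
  have S: "finite S" unfolding S_def using assms by (auto simp: nat_exponents_def int_exponents_def)
  define P where "P \<alpha> \<beta> = (\<Sum>k\<in>S. monom (\<alpha> k - \<beta> k) k)" for \<alpha> \<beta> :: "nat \<Rightarrow> int"
  have P_coeff: "coeff (P \<alpha> \<beta>) k = (if k \<in> S then \<alpha> k - \<beta> k else 0)" for \<alpha> \<beta> k
    unfolding P_def coeff_sum coeff_monom using S by simp
  have P_nz: "P \<alpha> \<beta> \<noteq> 0" if "\<alpha> \<in> F" "\<beta> \<in> F" "\<alpha> \<noteq> \<beta>" for \<alpha> \<beta>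
  proof -
    obtain k where k: "\<alpha> k \<noteq> \<beta> k" using \<open>\<alpha> \<noteq> \<beta>\<close> by auto
    then have "k \<in> S" using that(1,2) unfolding S_def by (cases "\<alpha> k = 0") auto
    then have "coeff (P \<alpha> \<beta>) k \<noteq> 0" using k by (simp add: P_coeff)
    then show ?thesis by auto
  qed
  let ?D = "{(\<alpha>, \<beta>). \<alpha> \<in> F \<and> \<beta> \<in> F \<and> \<alpha> \<noteq> \<beta>}"
  have "finite ?D" by (rule finite_subset[of _ "F \<times> F"]) (use assms in auto)
  then have fin: "finite (\<Union>(\<alpha>, \<beta>)\<in>?D. {b. poly (P \<alpha> \<beta>) b = 0})"
    using P_nz by (intro finite_UN_I) (auto intro: poly_roots_finite)
  have "infinite (range int)" by (simp add: finite_image_iff)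
  then obtain b where b: "int b \<notin> (\<Union>(\<alpha>, \<beta>)\<in>?D. {b. poly (P \<alpha> \<beta>) b = 0})"
    using fin by (meson image_subsetI infinite_super rangeI subsetI finite_subset rangeE)
  have weight: "int (\<Sum>k | \<alpha> k \<noteq> 0. nat (\<alpha> k) * b ^ k) = (\<Sum>k\<in>S. \<alpha> k * int b ^ k)" if \<alpha>: "\<alpha> \<in> F" for \<alpha>
  proof -
    have "\<forall>k. 0 \<le> \<alpha> k" using \<alpha> assms(2) by (auto simp: nat_exponents_def)
    then have "int (\<Sum>k | \<alpha> k \<noteq> 0. nat (\<alpha> k) * b ^ k) = (\<Sum>k | \<alpha> k \<noteq> 0. \<alpha> k * int b ^ k)" by simp
    also have "\<dots> = (\<Sum>k\<in>S. \<alpha> k * int b ^ k)"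
      using S \<alpha> by (intro sum.mono_neutral_left) (auto simp: S_def)
    finally show ?thesis .
  qed
  have "inj_on (\<lambda>\<alpha>. \<Sum>k | \<alpha> k \<noteq> 0. nat (\<alpha> k) * b ^ k) F"
  proof (rule inj_onI, rule ccontr)
    fix \<alpha> \<beta> assume *: "\<alpha> \<in> F" "\<beta> \<in> F" "\<alpha> \<noteq> \<beta>"
      "(\<Sum>k | \<alpha> k \<noteq> 0. nat (\<alpha> k) * b ^ k) = (\<Sum>k | \<beta> k \<noteq> 0. nat (\<beta> k) * b ^ k)"
    then have "poly (P \<alpha> \<beta>) (int b) = 0"
      using weight[OF *(1)] weight[OF *(2)]
      by (simp add: P_def poly_sum poly_monom left_diff_distrib sum_subtractf)
    then show False using b * by auto
  qed
  then show thesis by (rule that)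
qed

text \<open>Rotating the k-th coordinate of \<open>z\<close> by \<open>w\<close> to the power \<open>b ^ k\<close> turns the polynomial into a
  polynomial in \<open>w\<close> with coefficients of the same norms, to which the Fourier type applies. Averaging over \<open>w\<close> does
  not change the integral over \<open>z\<close>.\<close>

lemma fourier_type_torus_poly:
  fixes x :: "(nat \<Rightarrow> int) \<Rightarrow> 'x::complex_banach"
  assumes ft: "fourier_type TYPE('x) p C" and p: "1 \<le> p" "p \<le> 2" and C: "1 \<le> C"
    and F: "finite F" "F \<subseteq> nat_exponents"
  shows "Lr_le torus_measure (conj_exponent p) (C * (\<Sum>\<alpha>\<in>F. norm (x \<alpha>) powr p) powr (1 / p)) (torus_poly F x)"
proof (cases "p = 1")
  case True
  have "(\<Sum>\<alpha>\<in>F. norm (x \<alpha>)) \<le> C * (\<Sum>\<alpha>\<in>F. norm (x \<alpha>) powr p) powr (1 / p)"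
    using mult_right_mono[OF C, of "\<Sum>\<alpha>\<in>F. norm (x \<alpha>)"] True by (simp add: sum_nonneg)
  then show ?thesis
    by (intro Lr_le_bounded prob_space_torus_measure) (auto intro: order_trans[OF norm_torus_poly_le])
next
  case False
  let ?r = "conj_exponent p" and ?K = "C * (\<Sum>\<alpha>\<in>F. norm (x \<alpha>) powr p) powr (1 / p)"
  define q where "q = enn2real ?r"
  have r: "?r \<noteq> \<infinity>" "0 < q" using conj_exponent_cases[OF p] False unfolding q_def by auto
  obtain b where b: "inj_on (\<lambda>\<alpha>. \<Sum>k | \<alpha> k \<noteq> 0. nat (\<alpha> k) * b ^ k) F"
    using nat_exponents_injective_weight[OF F] by blast
  define e where "e \<alpha> = (\<Sum>k | \<alpha> k \<noteq> 0. nat (\<alpha> k) * b ^ k)" for \<alpha> :: "nat \<Rightarrow> int"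
  define R where "R w z = (\<lambda>k. w ^ (b ^ k) * z k)" for w :: complex and z
  define g where "g z = ennreal (norm (torus_poly F x z) powr q)" for z
  interpret T: prob_space torus_measure by (rule prob_space_torus_measure)
  interpret S: prob_space circle_measure by (rule prob_space_circle_measure)
  interpret pair_sigma_finite circle_measure torus_measure ..
  note [measurable] = strongly_measurable_imp_borel_measurable[OF strongly_measurable_torus_poly[of F x]]
  have g [measurable]: "g \<in> borel_measurable torus_measure" unfolding g_def by measurable
  note [measurable] = measurable_compose[OF measurable_fst measurable_circle_ident]
  have "(\<lambda>y. R (fst y) (snd y)) \<in> measurable (circle_measure \<Otimes>\<^sub>M torus_measure) torus_measure"
    unfolding R_def
    by (rule measurable_torusI)
      (auto simp: space_pair_measure space_circle_measure space_torus_measure norm_mult norm_power)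
  then have gR: "(\<lambda>(w, z). g (R w z)) \<in> borel_measurable (circle_measure \<Otimes>\<^sub>M torus_measure)"
    using measurable_compose[OF _ g] by (simp add: case_prod_beta)
  have monom_R: "torus_monom (R w z) \<alpha> = w ^ e \<alpha> * torus_monom z \<alpha>" if "\<alpha> \<in> F" for w z \<alpha>
  proof -
    have nn: "\<forall>k. 0 \<le> \<alpha> k" using F(2) that by (auto simp: nat_exponents_def)
    have "(w ^ (b ^ k)) powi \<alpha> k = w ^ (nat (\<alpha> k) * b ^ k)" for k
      using nn by (simp add: power_int_def power_mult[symmetric] mult.commute)
    then have "torus_monom (\<lambda>k. w ^ (b ^ k)) \<alpha> = w ^ e \<alpha>"
      unfolding torus_monom_def e_def by (simp add: power_sum)
    then show ?thesis unfolding R_def torus_monom_mult by simp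
  qed
  have inner: "(\<integral>\<^sup>+w. g (R w z) \<partial>circle_measure) \<le> ennreal (?K powr q)" if z: "z \<in> space torus_measure" for z
  proof -
    \<comment> \<open>The zero exponent has weight 0, whereas Fourier type starts with the first
      power; hence the \<open>Suc\<close>. The additional factor \<open>w\<close> has modulus 1 and
      disappears in the norm.\<close>
    have "Lr_le circle_measure ?r (C * (\<Sum>\<alpha>\<in>F. norm (torus_monom z \<alpha> *\<^sub>C x \<alpha>) powr p) powr (1 / p))
        (\<lambda>w. \<Sum>\<alpha>\<in>F. w ^ Suc (e \<alpha>) *\<^sub>C (torus_monom z \<alpha> *\<^sub>C x \<alpha>))"
      by (rule fourier_type_sum[OF ft F(1)]) (use b r in \<open>auto simp: e_def inj_on_def q_def\<close>)
    then have "(\<integral>\<^sup>+w. ennreal (norm (\<Sum>\<alpha>\<in>F. w ^ Suc (e \<alpha>) *\<^sub>C (torus_monom z \<alpha> *\<^sub>C x \<alpha>)) powr q) \<partial>circle_measure)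
        \<le> ennreal (?K powr q)"
      using r z unfolding Lr_le_def q_def by (simp add: norm_scaleC norm_torus_monom)
    also have "(\<integral>\<^sup>+w. ennreal (norm (\<Sum>\<alpha>\<in>F. w ^ Suc (e \<alpha>) *\<^sub>C (torus_monom z \<alpha> *\<^sub>C x \<alpha>)) powr q) \<partial>circle_measure) =
        (\<integral>\<^sup>+w. g (R w z) \<partial>circle_measure)"
    proof (rule nn_integral_cong)
      fix w assume "w \<in> space circle_measure"
      then have "cmod w = 1" by (simp add: space_circle_measure)
      have "(\<Sum>\<alpha>\<in>F. w ^ Suc (e \<alpha>) *\<^sub>C (torus_monom z \<alpha> *\<^sub>C x \<alpha>)) = w *\<^sub>C torus_poly F x (R w z)"
        unfolding torus_poly_def scaleC.sum_right
        by (intro sum.cong) (simp_all add: scaleC_scaleC monom_R mult.assoc)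
      then show "ennreal (norm (\<Sum>\<alpha>\<in>F. w ^ Suc (e \<alpha>) *\<^sub>C (torus_monom z \<alpha> *\<^sub>C x \<alpha>)) powr q) = g (R w z)"
        using \<open>cmod w = 1\<close> unfolding g_def by (simp add: norm_scaleC)
    qed
    finally show ?thesis .
  qed
  have rot: "(\<integral>\<^sup>+z. g (R w z) \<partial>torus_measure) = (\<integral>\<^sup>+z. g z \<partial>torus_measure)" if "w \<in> space circle_measure" for w
  proof -
    have w: "cmod (w ^ (b ^ k)) = 1" for k using that by (simp add: space_circle_measure norm_power)
    have "(\<integral>\<^sup>+z. g z \<partial>torus_measure) = (\<integral>\<^sup>+z. g z \<partial>distr torus_measure torus_measure (R w))"
      unfolding R_def using distr_torus_measure_mult[of "\<lambda>k. w ^ (b ^ k)"] w by simp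
    also have "\<dots> = (\<integral>\<^sup>+z. g (R w z) \<partial>torus_measure)"
      unfolding R_def by (intro nn_integral_distr measurable_torus_mult w) simp
    finally show ?thesis by simp
  qed
  have "(\<integral>\<^sup>+z. g z \<partial>torus_measure) = (\<integral>\<^sup>+w. \<integral>\<^sup>+z. g z \<partial>torus_measure \<partial>circle_measure)"
    by (simp add: S.emeasure_space_1)
  also have "\<dots> = (\<integral>\<^sup>+w. \<integral>\<^sup>+z. g (R w z) \<partial>torus_measure \<partial>circle_measure)"
    by (rule nn_integral_cong) (rule rot[symmetric])
  also have "\<dots> = (\<integral>\<^sup>+z. \<integral>\<^sup>+w. g (R w z) \<partial>circle_measure \<partial>torus_measure)"
    by (rule Fubini'[OF gR, symmetric])
  also have "\<dots> \<le> (\<integral>\<^sup>+z. ennreal (?K powr q) \<partial>torus_measure)"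
    by (intro nn_integral_mono inner)
  also have "\<dots> = ennreal (?K powr q)" by (simp add: T.emeasure_space_1)
  finally show ?thesis using r unfolding Lr_le_def g_def q_def by simp
qed

section \<open>Functions with prescribed Fourier coefficients\<close>

text \<open>If a finite set nearly exhausts the total sum, little is left for anything disjoint from
  it. Taking unions of such sets makes the sequence increasing and only strengthens disjointness. No
  enumeration of the index set is chosen.\<close>

lemma summable_on_finite_tails:
  fixes g :: "'i \<Rightarrow> real"
  assumes g: "g summable_on A" "\<And>i. i \<in> A \<Longrightarrow> 0 \<le> g i" and \<epsilon>: "\<And>n::nat. 0 < \<epsilon> n"
  obtains G :: "nat \<Rightarrow> 'i set" where "\<And>n. finite (G n)" "\<And>n. G n \<subseteq> A" "incseq G"
    "\<And>n H. finite H \<Longrightarrow> H \<subseteq> A \<Longrightarrow> H \<inter> G n = {} \<Longrightarrow> sum g H \<le> \<epsilon> n"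
proof -
  have "\<exists>F. finite F \<and> F \<subseteq> A \<and> infsum g A - sum g F \<le> \<epsilon> n" for n
  proof -
    have "infsum g A - \<epsilon> n < infsum g A" using \<epsilon> by simp
    also have "infsum g A = (SUP F\<in>{F. finite F \<and> F \<subseteq> A}. sum g F)"
      by (rule infsum_nonneg_is_SUPREMUM_real[OF g])
    finally have "infsum g A - \<epsilon> n < (SUP F\<in>{F. finite F \<and> F \<subseteq> A}. sum g F)" .
    moreover have "bdd_above (sum g ` {F. finite F \<and> F \<subseteq> A})"
      using g by (intro bdd_aboveI[of _ "infsum g A"]) (auto intro: finite_sum_le_infsum)
    ultimately obtain F where "finite F" "F \<subseteq> A" "infsum g A - \<epsilon> n < sum g F"
      by (subst (asm) less_cSUP_iff) auto
    then show ?thesis by (intro exI[of _ F]) simp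
  qed
  then obtain F where F: "\<And>n. finite (F n)" "\<And>n. F n \<subseteq> A" "\<And>n. infsum g A - sum g (F n) \<le> \<epsilon> n"
    by metis
  show thesis
  proof
    let ?G = "\<lambda>n. \<Union>i\<le>n. F i"
    show "finite (?G n)" "?G n \<subseteq> A" for n using F by auto
    show "incseq ?G" by (rule monoI) (auto intro: order_trans)
    fix n H assume H: "finite H" "H \<subseteq> A" "H \<inter> ?G n = {}"
    have "sum g H + sum g (F n) = sum g (H \<union> F n)"
      using H F(1) by (intro sum.union_disjoint[symmetric]) auto
    also have "\<dots> \<le> infsum g A"
      using H F g by (intro finite_sum_le_infsum) auto
    finally show "sum g H \<le> \<epsilon> n" using F(3)[of n] by simp
  qed
qed

text \<open>The estimate for \<open>P m - P n\<close> is used in two ways: its L1 form yields an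
  almost everywhere limit \<open>f\<close>, and Fatou's lemma extends it to \<open>f - P n\<close>,
  which identifies the coefficients of \<open>f\<close>.\<close>

proposition fourier_type_imp_hardy_function:
  fixes x :: "(nat \<Rightarrow> int) \<Rightarrow> 'x::complex_banach"
  assumes ft: "fourier_type TYPE('x) p C" and p: "1 \<le> p" "p \<le> 2" and C: "1 \<le> C"
    and x: "x \<in> ell p nat_exponents"
  shows "\<exists>f\<in>hardy_space (conj_exponent p). (\<forall>\<alpha>\<in>nat_exponents. fourier_coeff f \<alpha> = x \<alpha>) \<and>
    Lr_norm torus_measure (conj_exponent p) f \<le> C * ell_norm p nat_exponents x"
proof -
  let ?r = "conj_exponent p" and ?T = torus_measure
  let ?g = "\<lambda>\<alpha>. norm (x \<alpha>) powr p"
  note r = conj_exponent_cases(1)[OF p]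
  then have r0: "?r = \<infinity> \<or> 0 < enn2real ?r" by auto
  have sum_g: "?g summable_on nat_exponents" using x unfolding ell_def by simp
  \<comment> \<open>Chosen so that its p-th root is \<open>(1 / 2) ^ n\<close>, which is
    summable.\<close>
  define \<epsilon> where "\<epsilon> n = ((1 / 2) ^ n) powr p" for n :: nat
  obtain G where G: "\<And>n. finite (G n)" "\<And>n. G n \<subseteq> nat_exponents" "incseq G"
    and tail: "\<And>n H. finite H \<Longrightarrow> H \<subseteq> nat_exponents \<Longrightarrow> H \<inter> G n = {} \<Longrightarrow> sum ?g H \<le> \<epsilon> n"
    by (rule summable_on_finite_tails[OF sum_g, of \<epsilon>]) (auto simp: \<epsilon>_def)
  have nat_int: "nat_exponents \<subseteq> int_exponents" by (auto simp: nat_exponents_def)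
  have G_int: "G n \<subseteq> int_exponents" for n using G(2) nat_int by blast
  define P where "P n = torus_poly (G n) x" for n
  have P_sm: "strongly_measurable ?T (P n)" for n unfolding P_def by (rule strongly_measurable_torus_poly)
  have P_diff: "Lr_le ?T ?r (C * (1 / 2) ^ n) (\<lambda>z. P m z - P n z)" if "n \<le> m" for n m
  proof -
    have sub: "G n \<subseteq> G m" using G(3) that by (rule incseqD)
    have "Lr_le ?T ?r (C * (\<Sum>\<alpha>\<in>G m - G n. ?g \<alpha>) powr (1 / p)) (torus_poly (G m - G n) x)"
      using G by (intro fourier_type_torus_poly ft p C) auto
    moreover have "(\<Sum>\<alpha>\<in>G m - G n. ?g \<alpha>) powr (1 / p) \<le> \<epsilon> n powr (1 / p)"
      using G p by (intro powr_mono2 tail sum_nonneg) auto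
    moreover have "\<epsilon> n powr (1 / p) = (1 / 2) ^ n" unfolding \<epsilon>_def using p by (simp add: powr_powr)
    moreover have "(\<lambda>z. P m z - P n z) = torus_poly (G m - G n) x"
      unfolding P_def using torus_poly_diff[OF G(1) sub] by auto
    ultimately show ?thesis using C by (auto elim!: Lr_le_mono intro!: mult_left_mono)
  qed
  have L1: "(\<integral>\<^sup>+z. ennreal (norm (h z)) \<partial>?T) \<le> ennreal (C * (1 / 2) ^ n)"
    if "strongly_measurable ?T h" "Lr_le ?T ?r (C * (1 / 2) ^ n) h" for h :: "_ \<Rightarrow> 'x" and n
    using that C by (intro Lr_le_imp_L1_le[OF prob_space_torus_measure _ r])
      (auto intro: strongly_measurable_imp_borel_measurable)
  have summ: "summable (\<lambda>n. C * (1 / 2) ^ n)" by (intro summable_mult summable_geometric) simp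
  have P_step: "(\<integral>\<^sup>+z. ennreal (norm (P (Suc n) z - P n z)) \<partial>?T) \<le> ennreal (C * (1 / 2) ^ n)" for n
    by (intro L1 strongly_measurable_diff P_sm P_diff) simp
  obtain f where f: "strongly_measurable ?T f" and lim: "AE z in ?T. (\<lambda>n. P n z) \<longlonglongrightarrow> f z"
    by (rule L1_Cauchy_converges_AE[OF P_sm P_step _ summ]) (use C in auto)
  \<comment> \<open>Here \<open>n\<close> stays fixed and Fatou's lemma is applied along
    \<open>m\<close>; the shift to \<open>m + n\<close> makes \<open>P_diff\<close> applicable to
    every term.\<close>
  have f_P: "Lr_le ?T ?r (C * (1 / 2) ^ n) (\<lambda>z. f z - P n z)" for n
  proof (rule Lr_le_LIMSEQ[OF _ _ r0])
    show "strongly_measurable ?T (\<lambda>z. P (m + n) z - P n z)" for m by (intro strongly_measurable_diff P_sm)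
    show "AE z in ?T. (\<lambda>m. P (m + n) z - P n z) \<longlonglongrightarrow> f z - P n z"
      using lim by eventually_elim (intro tendsto_intros LIMSEQ_ignore_initial_segment)
    show "Lr_le ?T ?r (C * (1 / 2) ^ n) (\<lambda>z. P (m + n) z - P n z)" for m by (rule P_diff) simp
  qed
  have ell_nonneg: "0 \<le> C * ell_norm p nat_exponents x" using C unfolding ell_norm_def by simp
  \<comment> \<open>The bound is inherited from the polynomials \<open>P n\<close> themselves and
    not from \<open>f_P\<close>, so that the constant remains C.\<close>
  have "Lr_le ?T ?r (C * ell_norm p nat_exponents x) f"
  proof (rule Lr_le_LIMSEQ[OF P_sm lim r0])
    fix n
    have "(\<Sum>\<alpha>\<in>G n. ?g \<alpha>) powr (1 / p) \<le> (\<Sum>\<^sub>\<infinity>\<alpha>\<in>nat_exponents. ?g \<alpha>) powr (1 / p)"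
      using p G sum_g by (intro powr_mono2 sum_nonneg finite_sum_le_infsum) auto
    then have "C * (\<Sum>\<alpha>\<in>G n. ?g \<alpha>) powr (1 / p) \<le> C * ell_norm p nat_exponents x"
      unfolding ell_norm_def using C by simp
    moreover have "Lr_le ?T ?r (C * (\<Sum>\<alpha>\<in>G n. ?g \<alpha>) powr (1 / p)) (P n)"
      unfolding P_def by (intro fourier_type_torus_poly ft p C G)
    ultimately show "Lr_le ?T ?r (C * ell_norm p nat_exponents x) (P n)"
      using C by (auto elim!: Lr_le_mono)
  qed
  note f_Lr = Lr_leD[OF f r0 ell_nonneg this]
  have f_int: "bochner_integrable ?T f"
    by (rule Lr_space_imp_bochner_integrable[OF prob_space_torus_measure r f_Lr(1)])
  have half: "(\<lambda>n. C * (1 / 2) ^ n) \<longlonglongrightarrow> 0"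
    by (rule summable_LIMSEQ_zero[OF summ])
  have coeff_le: "norm (fourier_coeff f \<alpha> - fourier_coeff (P n) \<alpha>) \<le> C * (1 / 2) ^ n" for n \<alpha>
  proof -
    have "ennreal (norm (fourier_coeff f \<alpha> - fourier_coeff (P n) \<alpha>)) \<le> (\<integral>\<^sup>+z. ennreal (norm (f z - P n z)) \<partial>?T)"
      unfolding P_def by (intro norm_fourier_coeff_diff_le f_int bochner_integrable_torus_poly)
    also have "\<dots> \<le> ennreal (C * (1 / 2) ^ n)" by (intro L1 strongly_measurable_diff f P_sm f_P)
    finally show ?thesis using C by simp
  qed
  have coeff_P: "fourier_coeff (P n) \<alpha> = (if \<alpha> \<in> G n then x \<alpha> else 0)" if "\<alpha> \<in> int_exponents" for n \<alpha>
    unfolding P_def by (rule fourier_coeff_torus_poly[OF G(1) G_int that])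
  have coeff_eq: "fourier_coeff f \<alpha> = x \<alpha>" if \<alpha>: "\<alpha> \<in> nat_exponents" for \<alpha>
  proof -
    have "norm (fourier_coeff f \<alpha> - x \<alpha>) \<le> C * (1 / 2) ^ n + C * (1 / 2) ^ n" for n
    proof -
      have "norm (fourier_coeff (P n) \<alpha> - x \<alpha>) \<le> C * (1 / 2) ^ n"
      proof (cases "\<alpha> \<in> G n")
        case True
        then show ?thesis using \<alpha> nat_int C by (simp add: coeff_P subset_iff)
      next
        \<comment> \<open>A single exponent outside \<open>G n\<close> is itself a tail, so its
          coefficient is small.\<close>
        case False
        then have "norm (x \<alpha>) powr p \<le> \<epsilon> n" using tail[of "{\<alpha>}" n] \<alpha> by simp
        then have "(norm (x \<alpha>) powr p) powr (1 / p) \<le> \<epsilon> n powr (1 / p)" using p by (intro powr_mono2) auto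
        then have "norm (x \<alpha>) \<le> 1 * (1 / 2) ^ n" unfolding \<epsilon>_def using p by (simp add: powr_powr)
        also have "\<dots> \<le> C * (1 / 2) ^ n" using C by (intro mult_right_mono) auto
        finally show ?thesis using False \<alpha> nat_int by (simp add: coeff_P subset_iff)
      qed
      then show ?thesis using coeff_le[of \<alpha> n] norm_triangle_ineq[of "fourier_coeff f \<alpha> - fourier_coeff (P n) \<alpha>" "fourier_coeff (P n) \<alpha> - x \<alpha>"] by simp
    qed
    then have "norm (fourier_coeff f \<alpha> - x \<alpha>) \<le> 0 + 0"
      by (intro LIMSEQ_le_const[OF tendsto_add[OF half half]]) auto
    then show ?thesis by simp
  qed
  have coeff_zero: "fourier_coeff f \<alpha> = 0" if \<alpha>: "\<alpha> \<in> int_exponents - nat_exponents" for \<alpha>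
  proof -
    have "\<alpha> \<notin> G n" for n using G(2) \<alpha> by auto
    then have "norm (fourier_coeff f \<alpha>) \<le> C * (1 / 2) ^ n" for n
      using coeff_le[of \<alpha> n] \<alpha> by (simp add: coeff_P)
    then have "norm (fourier_coeff f \<alpha>) \<le> 0"
      by (intro LIMSEQ_le_const[OF half]) auto
    then show ?thesis by simp
  qed
  have "f \<in> hardy_space ?r" unfolding hardy_space_def using f_Lr(1) coeff_zero by simp
  then show ?thesis using coeff_eq f_Lr(2) by blast
qed

section \<open>The Bohr transform\<close>

lemma bij_betw_nth_prime: "bij_betw nth_prime UNIV {q. prime q}"
  unfolding nth_prime_def[abs_def] by (rule bij_enumerate[OF primes_infinite])

lemma prime_nth_prime: "prime (nth_prime k)"
  using bij_betw_nth_prime by (auto simp: bij_betw_def)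

lemma inj_nth_prime: "inj nth_prime"
  using bij_betw_nth_prime by (auto simp: bij_betw_def)

text \<open>Unique factorization; families over exponents and sequences starting at 1 are exchanged
  along this bijection.\<close>

lemma bij_betw_prime_exponents: "bij_betw prime_exponents {1..} nat_exponents"
  unfolding bij_betw_def
proof (intro conjI set_eqI iffI)
  show "inj_on prime_exponents {1..}"
  proof (rule inj_onI)
    fix m n :: nat assume mn: "m \<in> {1..}" "n \<in> {1..}" "prime_exponents m = prime_exponents n"
    have "multiplicity q m = multiplicity q n" if q: "prime q" for q
    proof -
      obtain k where "q = nth_prime k" using q bij_betw_nth_prime by (auto simp: bij_betw_def image_iff set_eq_iff)
      then show ?thesis using fun_cong[OF mn(3), of k] by (simp add: prime_exponents_def)
    qed
    then have "normalize m = normalize n" using mn by (intro multiplicity_eq_imp_eq) auto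
    then show "m = n" by simp
  qed
next
  fix \<alpha> assume "\<alpha> \<in> prime_exponents ` {1..}"
  then obtain n where n: "1 \<le> n" "\<alpha> = prime_exponents n" by auto
  have "nth_prime ` {k. \<alpha> k \<noteq> 0} \<subseteq> prime_factors n"
    using n prime_nth_prime by (auto simp: prime_exponents_def prime_factors_multiplicity)
  then have "finite (nth_prime ` {k. \<alpha> k \<noteq> 0})" by (rule finite_subset) simp
  then have "finite {k. \<alpha> k \<noteq> 0}"
    using inj_on_subset[OF inj_nth_prime] by (simp add: finite_image_iff)
  then show "\<alpha> \<in> nat_exponents" using n by (simp add: nat_exponents_def int_exponents_def prime_exponents_def)
next
  fix \<alpha> assume \<alpha>: "\<alpha> \<in> nat_exponents"
  define S where "S = nth_prime ` {k. \<alpha> k \<noteq> 0}"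
  define e where "e q = nat (\<alpha> (inv nth_prime q))" for q
  define n where "n = (\<Prod>q\<in>S. q ^ e q)"
  have S: "finite S" using \<alpha> by (simp add: S_def nat_exponents_def int_exponents_def)
  have "0 \<notin> S" unfolding S_def using prime_nth_prime not_prime_0 by (metis imageE)
  then have "n \<noteq> 0" unfolding n_def by (simp add: S)
  have "int (multiplicity (nth_prime k) n) = \<alpha> k" for k
  proof -
    have "multiplicity (nth_prime k) n = (if nth_prime k \<in> S then e (nth_prime k) else 0)"
      unfolding n_def using S prime_nth_prime
      by (intro multiplicity_prod_prime_powers) (auto simp: S_def)
    moreover have "nth_prime k \<in> S \<longleftrightarrow> \<alpha> k \<noteq> 0"
      unfolding S_def using inj_nth_prime by (auto dest: injD)
    ultimately show ?thesis
      using \<alpha> inj_nth_prime by (auto simp: e_def nat_exponents_def)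
  qed
  then have "\<alpha> = prime_exponents n" by (auto simp: prime_exponents_def)
  then show "\<alpha> \<in> prime_exponents ` {1..}" using \<open>n \<noteq> 0\<close> by auto
qed

text \<open>The Bohr transform records the nonnegative exponents only; at the others both functions
  have coefficient 0 by membership in the Hardy space.\<close>

lemma hardy_space_eq_AE:
  fixes f g :: "(nat \<Rightarrow> complex) \<Rightarrow> 'x::complex_banach"
  assumes r: "r = \<infinity> \<or> 1 < enn2real r" and fg: "f \<in> hardy_space r" "g \<in> hardy_space r"
    and eq: "bohr f = bohr g"
  shows "AE z in torus_measure. f z = g z"
proof -
  have int: "bochner_integrable torus_measure f" "bochner_integrable torus_measure g"
    using fg Lr_space_imp_bochner_integrable[OF prob_space_torus_measure r] unfolding hardy_space_def by auto
  have "fourier_coeff f \<alpha> = fourier_coeff g \<alpha>" if \<alpha>: "\<alpha> \<in> int_exponents" for \<alpha>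
  proof (cases "\<alpha> \<in> nat_exponents")
    case True
    then obtain n where "1 \<le> n" "\<alpha> = prime_exponents n"
      using bij_betw_prime_exponents by (auto simp: bij_betw_def)
    then show ?thesis using fun_cong[OF eq, of n] by (simp add: bohr_def dirichlet_series_def)
  next
    case False
    then show ?thesis using fg \<alpha> unfolding hardy_space_def by simp
  qed
  then have "AE z in torus_measure. f z - g z = 0"
    using int by (intro AE_zero_if_fourier_coeff_zero bochner_integrable_diff) (simp_all add: fourier_coeff_diff)
  then show ?thesis by simp
qed

lemma dirichlet_hardy_norm_bohr:
  assumes r: "r = \<infinity> \<or> 1 < enn2real r" and f: "f \<in> hardy_space r"
  shows "dirichlet_hardy_norm r (bohr f) = Lr_norm torus_measure r f"
proof -
  let ?g = "inv_into (hardy_space r) bohr (bohr f)"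
  have g: "?g \<in> hardy_space r" "bohr ?g = bohr f"
    using f by (simp_all add: inv_into_into f_inv_into_f)
  have "AE z in torus_measure. ?g z = f z" by (rule hardy_space_eq_AE[OF r g(1) f g(2)])
  then show ?thesis
    unfolding dirichlet_hardy_norm_def using f g(1)
    by (intro Lr_norm_cong_AE) (auto simp: hardy_space_def Lr_space_def)
qed

section \<open>Transport of norms between circle, torus and Dirichlet series\<close>

lemma Lr_norm_distr:
  assumes T: "T \<in> measurable M N" and h: "h \<in> borel_measurable N"
  shows "Lr_norm (distr M N T) r h = Lr_norm M r (\<lambda>x. h (T x))"
proof -
  note [measurable] = T h
  have "esssup (distr M N T) (\<lambda>x. ennreal (norm (h x))) = esssup M (\<lambda>x. ennreal (norm (h (T x))))"
  proof -
    \<comment> \<open>The essential supremum is determined by the almost everywhere upper bounds, so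
      it is enough that these correspond.\<close>
    have "(AE x in distr M N T. ennreal (norm (h x)) \<le> c) \<longleftrightarrow> (AE x in M. ennreal (norm (h (T x))) \<le> c)" for c
      by (rule AE_distr_iff[OF T]) measurable
    then show ?thesis by (subst (1 2) esssup_eq_AE) auto
  qed
  moreover have "(\<integral>\<^sup>+x. ennreal (norm (h x) powr enn2real r) \<partial>distr M N T) =
      (\<integral>\<^sup>+x. ennreal (norm (h (T x)) powr enn2real r) \<partial>M)"
    by (rule nn_integral_distr[OF T]) measurable
  ultimately show ?thesis unfolding Lr_norm_def by simp
qed

text \<open>Each coordinate is distributed according to the circle measure. This leads back from the
  torus to the inequality in one variable.\<close>

lemma Lr_norm_torus_component:
  assumes "h \<in> borel_measurable circle_measure"
  shows "Lr_norm torus_measure r (\<lambda>z. h (z k)) = Lr_norm circle_measure r h"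
proof -
  have "distr torus_measure circle_measure (\<lambda>z. z k) = circle_measure"
    unfolding torus_measure_def by (rule distr_PiM_component) (auto intro: prob_space_circle_measure)
  then show ?thesis using Lr_norm_distr[OF measurable_torus_component_circle[of k] assms, of r] by simp
qed

lemma ell_norm_reindex_prime_exponents:
  fixes x :: "(nat \<Rightarrow> int) \<Rightarrow> 'x::real_normed_vector"
  shows "(\<lambda>n. x (prime_exponents n)) \<in> ell p {1..} \<longleftrightarrow> x \<in> ell p nat_exponents"
    and "ell_norm p {1..} (\<lambda>n. x (prime_exponents n)) = ell_norm p nat_exponents x"
  using summable_on_reindex_bij_betw[OF bij_betw_prime_exponents, of "\<lambda>\<alpha>. norm (x \<alpha>) powr p"]
    infsum_reindex_bij_betw[OF bij_betw_prime_exponents, of "\<lambda>\<alpha>. norm (x \<alpha>) powr p"]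
  unfolding ell_def ell_norm_def by auto

lemma ell_cong: "(\<And>i. i \<in> A \<Longrightarrow> x i = y i) \<Longrightarrow> x \<in> ell p A \<longleftrightarrow> y \<in> ell p A"
  unfolding ell_def by (simp cong: summable_on_cong)

lemma ell_norm_cong: "(\<And>i. i \<in> A \<Longrightarrow> x i = y i) \<Longrightarrow> ell_norm p A x = ell_norm p A y"
  unfolding ell_norm_def by (simp cong: infsum_cong)

text \<open>The assumption \<open>ex\<close> is statement (c) for a general exponent
  \<open>r\<close>. The sequence becomes a family over exponents, and the function obtained for it
  is a preimage of the series, from which the norm may be read off.\<close>

lemma dirichlet_hardy_norm_le:
  fixes a :: "nat \<Rightarrow> 'x::complex_banach"
  assumes r: "r = \<infinity> \<or> 1 < enn2real r"
    and ex: "\<And>x :: (nat \<Rightarrow> int) \<Rightarrow> 'x. x \<in> ell p nat_exponents \<Longrightarrow>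
      \<exists>f\<in>hardy_space r. (\<forall>\<alpha>\<in>nat_exponents. fourier_coeff f \<alpha> = x \<alpha>) \<and>
        Lr_norm torus_measure r f \<le> C * ell_norm p nat_exponents (fourier_coeff f)"
    and a: "a \<in> ell p {1..}"
  shows "dirichlet_series a \<in> dirichlet_hardy r"
    and "dirichlet_hardy_norm r (dirichlet_series a) \<le> C * ell_norm p {1..} a"
proof -
  define x where "x \<alpha> = a (inv_into {1..} prime_exponents \<alpha>)" for \<alpha>
  have x: "x (prime_exponents n) = a n" if "n \<in> {1..}" for n
    unfolding x_def using that bij_betw_prime_exponents by (simp add: bij_betw_def)
  have "x \<in> ell p nat_exponents"
    using a x ell_cong[of "{1..}" "\<lambda>n. x (prime_exponents n)" a p] ell_norm_reindex_prime_exponents(1)[of x p] by blast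
  then obtain f where f: "f \<in> hardy_space r" "\<And>\<alpha>. \<alpha> \<in> nat_exponents \<Longrightarrow> fourier_coeff f \<alpha> = x \<alpha>"
    and le: "Lr_norm torus_measure r f \<le> C * ell_norm p nat_exponents (fourier_coeff f)"
    using ex by blast
  have "prime_exponents n \<in> nat_exponents" if "1 \<le> n" for n
    using bij_betw_prime_exponents that by (auto simp: bij_betw_def)
  then have bohr_f: "bohr f = dirichlet_series a"
    by (auto simp: bohr_def dirichlet_series_def f(2) x)
  show "dirichlet_series a \<in> dirichlet_hardy r"
    unfolding dirichlet_hardy_def using f(1) bohr_f by (metis imageI)
  have "ell_norm p nat_exponents (fourier_coeff f) = ell_norm p nat_exponents x"
    by (rule ell_norm_cong) (rule f(2))
  also have "\<dots> = ell_norm p {1..} (\<lambda>n. x (prime_exponents n))"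
    by (rule ell_norm_reindex_prime_exponents(2)[symmetric])
  also have "\<dots> = ell_norm p {1..} a" by (rule ell_norm_cong) (rule x)
  finally show "dirichlet_hardy_norm r (dirichlet_series a) \<le> C * ell_norm p {1..} a"
    using le dirichlet_hardy_norm_bohr[OF r f(1)] bohr_f by simp
qed

text \<open>The unordered sums over \<open>{1..}\<close> are rewritten as ordinary series, whose
  tails tend to 0; \<open>Suc\<close> skips the index 0.\<close>

lemma ell_norm_tail_tendsto_zero:
  fixes a :: "nat \<Rightarrow> 'x::real_normed_vector"
  assumes a: "a \<in> ell p {1..}" and p: "0 < p"
  shows "(\<lambda>N. ell_norm p {1..} (\<lambda>n. if n \<le> N then 0 else a n)) \<longlonglongrightarrow> 0"
proof -
  let ?g = "\<lambda>n. norm (a n) powr p"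
  have g: "?g summable_on {1..}" using a unfolding ell_def by simp
  have "summable (\<lambda>n. ?g (Suc n))"
  proof -
    have bij: "bij_betw Suc UNIV {1..}" by (rule bij_betw_byWitness[of _ "\<lambda>n. n - 1"]) auto
    have "(\<lambda>n. ?g (Suc n)) summable_on UNIV"
      by (rule summable_on_reindex_bij_betw[OF bij, THEN iffD2, OF g])
    then show ?thesis by (rule summable_on_imp_summable)
  qed
  then have tail: "(\<lambda>N. \<Sum>n. ?g (Suc (n + N))) \<longlonglongrightarrow> 0" by (rule suminf_exist_split2)
  have eq: "(\<Sum>\<^sub>\<infinity>n\<in>{1..}. norm (if n \<le> N then 0 else a n) powr p) = (\<Sum>n. ?g (Suc (n + N)))" for N
  proof -
    have bij: "bij_betw (\<lambda>n. Suc (n + N)) UNIV {N<..}"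
      by (rule bij_betw_byWitness[of _ "\<lambda>n. n - Suc N"]) auto
    have "(\<Sum>\<^sub>\<infinity>n\<in>{1..}. norm (if n \<le> N then 0 else a n) powr p) = (\<Sum>\<^sub>\<infinity>n\<in>{N<..}. ?g n)"
      by (rule infsum_cong_neutral) auto
    also have "\<dots> = (\<Sum>\<^sub>\<infinity>n. ?g (Suc (n + N)))"
      by (rule infsum_reindex_bij_betw[OF bij, symmetric])
    also have "\<dots> = (\<Sum>n. ?g (Suc (n + N)))"
    proof -
      have "?g summable_on {N<..}" by (rule summable_on_subset_banach[OF g]) auto
      then have "(\<lambda>n. ?g (Suc (n + N))) summable_on UNIV"
        by (rule summable_on_reindex_bij_betw[OF bij, THEN iffD2])
      then show ?thesis by (intro sums_unique has_sum_imp_sums has_sum_infsum)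
    qed
    finally show ?thesis .
  qed
  have "(\<lambda>N. (\<Sum>n. ?g (Suc (n + N))) powr (1 / p)) \<longlonglongrightarrow> 0 powr (1 / p)"
    using p \<open>summable (\<lambda>n. ?g (Suc n))\<close>
    by (intro tendsto_powr2 tail tendsto_const) (auto intro!: always_eventually suminf_nonneg simp: summable_iff_shift[of "\<lambda>n. ?g (Suc n)"])
  then show ?thesis unfolding ell_norm_def eq by simp
qed

section \<open>Convergence of Dirichlet series and the return to Fourier type\<close>

proposition hardy_functions_imp_dirichlet_convergence:
  fixes a :: "nat \<Rightarrow> 'x::complex_banach"
  assumes r: "r = \<infinity> \<or> 1 < enn2real r" and p: "0 < p"
    and ex: "\<And>x :: (nat \<Rightarrow> int) \<Rightarrow> 'x. x \<in> ell p nat_exponents \<Longrightarrow>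
      \<exists>f\<in>hardy_space r. (\<forall>\<alpha>\<in>nat_exponents. fourier_coeff f \<alpha> = x \<alpha>) \<and>
        Lr_norm torus_measure r f \<le> C * ell_norm p nat_exponents (fourier_coeff f)"
    and a: "a \<in> ell p {1..}"
  shows "converges_in_dirichlet_hardy r a (dirichlet_series a)"
    and "dirichlet_hardy_norm r (dirichlet_series a) \<le> C * ell_norm p {1..} a"
proof -
  have D: "dirichlet_series b \<in> dirichlet_hardy r"
      "dirichlet_hardy_norm r (dirichlet_series b) \<le> C * ell_norm p {1..} b"
    if "b \<in> ell p {1..}" for b :: "nat \<Rightarrow> 'x"
    by (rule dirichlet_hardy_norm_le[OF r ex that]; assumption)+
  show "dirichlet_hardy_norm r (dirichlet_series a) \<le> C * ell_norm p {1..} a" by (rule D(2)[OF a])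
  have sub: "b \<in> ell p {1..}" if "\<And>n. norm (b n) \<le> norm (a n)" for b :: "nat \<Rightarrow> 'x"
    using a p that unfolding ell_def
    by (auto intro!: summable_on_comparison_test[of "\<lambda>n. norm (a n) powr p"] powr_mono2)
  have "dirichlet_partial_sum a N \<in> dirichlet_hardy r" for N
    unfolding dirichlet_partial_sum_def by (rule D(1)) (rule sub, simp)
  moreover have "(\<lambda>N. dirichlet_hardy_norm r (\<lambda>n. dirichlet_partial_sum a N n - dirichlet_series a n)) \<longlonglongrightarrow> 0"
  proof (rule tendsto_sandwich[OF _ _ tendsto_const])
    show "\<forall>\<^sub>F N in sequentially. 0 \<le> dirichlet_hardy_norm r (\<lambda>n. dirichlet_partial_sum a N n - dirichlet_series a n)"
      by (simp add: dirichlet_hardy_norm_def Lr_norm_nonneg)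
    show "\<forall>\<^sub>F N in sequentially. dirichlet_hardy_norm r (\<lambda>n. dirichlet_partial_sum a N n - dirichlet_series a n)
        \<le> C * ell_norm p {1..} (\<lambda>n. if n \<le> N then 0 else a n)"
    proof (intro always_eventually allI)
      fix N
      \<comment> \<open>A partial sum minus the series is the negative tail. It is again a Dirichlet
        series with coefficients in \<open>ell p {1..}\<close>, so the norm bound applied to it
        gives the rate of convergence.\<close>
      let ?b = "\<lambda>n. if n \<le> N then 0 else - a n"
      have "(\<lambda>n. dirichlet_partial_sum a N n - dirichlet_series a n) = dirichlet_series ?b"
        by (auto simp: dirichlet_partial_sum_def dirichlet_series_def)
      moreover have "dirichlet_hardy_norm r (dirichlet_series ?b) \<le> C * ell_norm p {1..} ?b"
        by (rule D(2)) (rule sub, simp)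
      moreover have "ell_norm p {1..} ?b = ell_norm p {1..} (\<lambda>n. if n \<le> N then 0 else a n)"
        unfolding ell_norm_def by (simp add: if_distrib cong: if_cong)
      ultimately show "dirichlet_hardy_norm r (\<lambda>n. dirichlet_partial_sum a N n - dirichlet_series a n)
        \<le> C * ell_norm p {1..} (\<lambda>n. if n \<le> N then 0 else a n)" by simp
    qed
    show "(\<lambda>N. C * ell_norm p {1..} (\<lambda>n. if n \<le> N then 0 else a n)) \<longlonglongrightarrow> 0"
      using tendsto_mult_left[OF ell_norm_tail_tendsto_zero[OF a p], of C] by simp
  qed
  ultimately show "converges_in_dirichlet_hardy r a (dirichlet_series a)"
    unfolding converges_in_dirichlet_hardy_def using D(1)[OF a] by blast
qed

text \<open>The first coordinate belongs to the prime 2. A polynomial in it has a Bohr transform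
  with coefficient \<open>x k\<close> at \<open>2 ^ k\<close> for k from 1 to N and 0 elsewhere, and
  both norms in the inequality are preserved.\<close>

proposition dirichlet_norm_bound_imp_fourier_type:
  assumes p: "1 \<le> p" "p \<le> 2"
    and le: "\<And>a :: nat \<Rightarrow> 'x::complex_banach. a \<in> ell p {1..} \<Longrightarrow>
      dirichlet_hardy_norm (conj_exponent p) (dirichlet_series a) \<le> C * ell_norm p {1..} a"
  shows "fourier_type TYPE('x) p C"
  unfolding fourier_type_def
proof (intro allI)
  fix N and x :: "nat \<Rightarrow> 'x"
  let ?r = "conj_exponent p" and ?T = torus_measure
  note r = conj_exponent_cases(1)[OF p]
  define \<delta> where "\<delta> k = (\<lambda>j::nat. if j = 0 then int k else 0)" for k
  define F where "F = \<delta> ` {1..N}"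
  \<comment> \<open>\<open>nat (\<alpha> 0)\<close> recovers the degree k from the exponent
    \<open>\<delta> k\<close>.\<close>
  define P where "P = torus_poly F (\<lambda>\<alpha>. x (nat (\<alpha> 0)))"
  have inj: "inj_on \<delta> {1..N}" by (rule inj_onI) (auto simp: \<delta>_def dest: fun_cong[of _ _ 0])
  have F: "finite F" "F \<subseteq> nat_exponents" "F \<subseteq> int_exponents"
    by (auto simp: F_def \<delta>_def nat_exponents_def int_exponents_def)
  have P_eq: "P z = (\<Sum>k=1..N. z 0 ^ k *\<^sub>C x k)" for z
  proof -
    have "torus_monom z (\<delta> k) = z 0 ^ k" if "k \<in> {1..N}" for k
      using that by (simp add: torus_monom_def \<delta>_def)
    moreover have "\<delta> k 0 = int k" for k by (simp add: \<delta>_def)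
    ultimately show ?thesis
      unfolding P_def torus_poly_def F_def sum.reindex[OF inj] comp_def by (intro sum.cong) simp_all
  qed
  have coeff: "fourier_coeff P \<alpha> = (if \<alpha> \<in> F then x (nat (\<alpha> 0)) else 0)" if "\<alpha> \<in> int_exponents" for \<alpha>
    unfolding P_def by (rule fourier_coeff_torus_poly[OF F(1,3) that])
  have P: "P \<in> hardy_space ?r"
  proof -
    have "Lr_le ?T ?r (\<Sum>\<alpha>\<in>F. norm (x (nat (\<alpha> 0)))) P"
      unfolding P_def by (intro Lr_le_bounded prob_space_torus_measure norm_torus_poly_le)
    then have "P \<in> Lr_space ?T ?r"
      using r unfolding P_def
      by (intro Lr_leD(1)[OF strongly_measurable_torus_poly]) (auto intro: sum_nonneg)
    then show ?thesis unfolding hardy_space_def using coeff F(2) by auto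
  qed
  have fin: "norm (fourier_coeff P \<alpha>) powr p = 0" if "\<alpha> \<in> nat_exponents - F" for \<alpha>
    using that by (simp add: coeff nat_exponents_def)
  let ?g = "\<lambda>\<alpha>. norm (fourier_coeff P \<alpha>) powr p"
  have "?g summable_on nat_exponents \<longleftrightarrow> ?g summable_on F"
    by (rule summable_on_cong_neutral) (use fin F in auto)
  then have ell: "fourier_coeff P \<in> ell p nat_exponents"
    unfolding ell_def using F(1) by (simp add: summable_on_finite)
  have "infsum ?g nat_exponents = infsum ?g F"
    by (rule infsum_cong_neutral) (use fin F in auto)
  then have "ell_norm p nat_exponents (fourier_coeff P) = (\<Sum>\<alpha>\<in>F. norm (fourier_coeff P \<alpha>) powr p) powr (1 / p)"
    unfolding ell_norm_def using F(1) by simp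
  also have "(\<Sum>\<alpha>\<in>F. norm (fourier_coeff P \<alpha>) powr p) = (\<Sum>\<alpha>\<in>F. norm (x (nat (\<alpha> 0))) powr p)"
    using F(3) by (intro sum.cong) (auto simp: coeff)
  also have "\<dots> = (\<Sum>k=1..N. norm (x k) powr p)"
    unfolding F_def by (subst sum.reindex[OF inj]) (simp add: \<delta>_def)
  finally have norm_eq: "ell_norm p nat_exponents (fourier_coeff P) = (\<Sum>k=1..N. norm (x k) powr p) powr (1 / p)" .
  have meas: "(\<lambda>w. \<Sum>k=1..N. w ^ k *\<^sub>C x k) \<in> borel_measurable circle_measure"
    by (rule strongly_measurable_imp_borel_measurable[OF strongly_measurable_circle_poly])
  have "Lr_norm circle_measure ?r (\<lambda>w. \<Sum>k=1..N. w ^ k *\<^sub>C x k) = Lr_norm ?T ?r P"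
    using Lr_norm_torus_component[OF meas, of ?r 0] by (simp add: P_eq[abs_def])
  also have "\<dots> = dirichlet_hardy_norm ?r (bohr P)"
    by (rule dirichlet_hardy_norm_bohr[OF r P, symmetric])
  also have "\<dots> \<le> C * ell_norm p {1..} (\<lambda>n. fourier_coeff P (prime_exponents n))"
    unfolding bohr_def by (rule le) (use ell ell_norm_reindex_prime_exponents(1) in blast)
  also have "\<dots> = C * (\<Sum>k=1..N. norm (x k) powr p) powr (1 / p)"
    unfolding ell_norm_reindex_prime_exponents(2) norm_eq ..
  finally show "Lr_norm circle_measure ?r (\<lambda>w. \<Sum>k=1..N. w ^ k *\<^sub>C x k)
      \<le> C * (\<Sum>k=1..N. norm (x k) powr p) powr (1 / p)" .
qed

theorem proposition2p2:
  fixes p C :: real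
  assumes "1 \<le> p" and "p \<le> 2" and "1 \<le> C"
  shows "(fourier_type TYPE('x::complex_banach) p C \<longleftrightarrow>
           (\<forall>a :: nat \<Rightarrow> 'x. a \<in> ell p {1..} \<longrightarrow>
              converges_in_dirichlet_hardy (conj_exponent p) a (dirichlet_series a) \<and>
              dirichlet_hardy_norm (conj_exponent p) (dirichlet_series a)
                \<le> C * ell_norm p {1..} a))
       \<and> (fourier_type TYPE('x) p C \<longleftrightarrow>
           (\<forall>x :: (nat \<Rightarrow> int) \<Rightarrow> 'x. x \<in> ell p nat_exponents \<longrightarrow>
              (\<exists>f \<in> hardy_space (conj_exponent p).
                 (\<forall>\<alpha> \<in> nat_exponents. fourier_coeff f \<alpha> = x \<alpha>) \<and>
                 Lr_norm torus_measure (conj_exponent p) f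
                   \<le> C * ell_norm p nat_exponents (fourier_coeff f))))"
    (is "(?a \<longleftrightarrow> ?b) \<and> (_ \<longleftrightarrow> ?c)")
proof -
  have r: "conj_exponent p = \<infinity> \<or> 1 < enn2real (conj_exponent p)"
    by (rule conj_exponent_cases(1)[OF assms(1,2)])
  \<comment> \<open>The implications form the cycle from (a) to (c), from (c) to (b) and from (b)
    back to (a).\<close>
  have "?c" if a: ?a
  proof (intro allI impI)
    fix x :: "(nat \<Rightarrow> int) \<Rightarrow> 'x" assume x: "x \<in> ell p nat_exponents"
    obtain f where f: "f \<in> hardy_space (conj_exponent p)"
      "\<And>\<alpha>. \<alpha> \<in> nat_exponents \<Longrightarrow> fourier_coeff f \<alpha> = x \<alpha>"
      "Lr_norm torus_measure (conj_exponent p) f \<le> C * ell_norm p nat_exponents x"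
      using fourier_type_imp_hardy_function[OF a assms x] by blast
    \<comment> \<open>Statement (c) measures the coefficients of \<open>f\<close>, the construction
      measures \<open>x\<close>; the two agree on \<open>nat_exponents\<close>.\<close>
    moreover have "ell_norm p nat_exponents (fourier_coeff f) = ell_norm p nat_exponents x"
      by (rule ell_norm_cong) (rule f(2))
    ultimately show "\<exists>f \<in> hardy_space (conj_exponent p). (\<forall>\<alpha> \<in> nat_exponents. fourier_coeff f \<alpha> = x \<alpha>) \<and>
        Lr_norm torus_measure (conj_exponent p) f \<le> C * ell_norm p nat_exponents (fourier_coeff f)"
      by (intro bexI[of _ f]) auto
  qed
  moreover have "?b" if ?c
  proof (intro allI impI)
    fix a :: "nat \<Rightarrow> 'x" assume a: "a \<in> ell p {1..}"
    show "converges_in_dirichlet_hardy (conj_exponent p) a (dirichlet_series a) \<and>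
        dirichlet_hardy_norm (conj_exponent p) (dirichlet_series a) \<le> C * ell_norm p {1..} a"
      using assms(1) by (intro conjI hardy_functions_imp_dirichlet_convergence[OF r _ that[rule_format] a]) auto
  qed
  moreover have "?a" if ?b
    using that by (intro dirichlet_norm_bound_imp_fourier_type assms) blast
  ultimately show ?thesis by blast
qed

end
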